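(* Let $k$ be a field of characteristic zero, let $K = k(x_1,\dots,x_m)$ be the field of rational functions in $x_1,\dots,x_m$ over $k$, and let $\omega = f_1\,dx_1 + \cdots + f_m\,dx_m$ be a closed $1$-form with $f_1,\dots,f_m \in K$. Then $\omega = dg$ for some $g$ of the form \[ g = a + \sum_{i=1}^m \sum_j c_{i,j}\,\log b_{i,j} \] (finite sums), where $a \in K$, $c_{i,j} \in \bar k$ (the algebraic closure of $k$), and $b_{i,j} \in k(x_1,\ldots,x_{i-1},c_{i,j})[x_i]$ has positive degree in $x_i$.
   Context: Write $\partial_i = \partial/\partial x_i$ for the usual commuting partial derivatives on $K$ (zero on $k$, $\partial_i(x_j)=\delta_{ij}$). Let $\mathcal{U}$ be a universal differential extension field of $(K,\partial_1,\dots,\partial_m)$ (in Kolchin's sense): the $\partial_i$ extend to commuting derivations of $\mathcal{U}$, and any system of algebraic differential equations having a solution in some differential extension of $K$ has a solution in $\mathcal{U}$. Algebraic closures are taken inside $\mathcal{U}$; the derivations extend uniquely to algebraic extensions, and elements of $\bar k$ are killed by all $\partial_i$. For $g \in \mathcal{U}$, $dg = \sum_{i=1}^m \partial_i(g)\,dx_i$. The $1$-form $\omega=\sum_i f_i\,dx_i$ is closed if $d\omega=0$, i.e. $\partial_i(f_j)=\partial_j(f_i)$ for all $i,j$. For $f\neq 0$, a logarithm $\log f$ is an element of a differential extension (with commuting derivations $\partial_1,\dots,\partial_m$) satisfying $\partial_i(\log f) = \partial_i(f)/f$ for each $i=1,\dots,m$. *)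

theory Defs
  imports "HOL-Algebra.Algebraic_Closure_Type" "HOL-Algebra.Generated_Fields" "HOL-Library.Poly_Mapping"
begin

section \<open>Differential fields\<close>

definition derivation :: "'a ring \<Rightarrow> ('a \<Rightarrow> 'a) \<Rightarrow> bool" where
  "derivation R d \<longleftrightarrow> d \<in> carrier R \<rightarrow> carrier R \<and>
     (\<forall>a\<in>carrier R. \<forall>b\<in>carrier R.
        d (a \<oplus>\<^bsub>R\<^esub> b) = d a \<oplus>\<^bsub>R\<^esub> d b \<and>
        d (a \<otimes>\<^bsub>R\<^esub> b) = (d a \<otimes>\<^bsub>R\<^esub> b) \<oplus>\<^bsub>R\<^esub> (a \<otimes>\<^bsub>R\<^esub> d b))"

text \<open>Only the derivations with index in \<open>{1..m}\<close> are relevant.\<close>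

definition differential_field :: "nat \<Rightarrow> 'a ring \<Rightarrow> (nat \<Rightarrow> 'a \<Rightarrow> 'a) \<Rightarrow> bool" where
  "differential_field m R D \<longleftrightarrow> field R \<and> (\<forall>i\<in>{1..m}. derivation R (D i)) \<and>
     (\<forall>i\<in>{1..m}. \<forall>j\<in>{1..m}. \<forall>a\<in>carrier R. D i (D j a) = D j (D i a))"

definition differential_extension ::
  "nat \<Rightarrow> 'a ring \<Rightarrow> (nat \<Rightarrow> 'a \<Rightarrow> 'a) \<Rightarrow> 'b ring \<Rightarrow> (nat \<Rightarrow> 'b \<Rightarrow> 'b) \<Rightarrow> ('a \<Rightarrow> 'b) \<Rightarrow> bool" where
  "differential_extension m F D L E h \<longleftrightarrow>
     differential_field m F D \<and> differential_field m L E \<and> h \<in> ring_hom F L \<and>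
     (\<forall>i\<in>{1..m}. \<forall>a\<in>carrier F. h (D i a) = E i (h a))"


section \<open>Algebraic differential equations and universal extensions\<close>

text \<open>Differential polynomials are represented by terms in the language of differential rings,
  with coefficients of type \<open>'a\<close> and indeterminates numbered by natural numbers. Distinct terms
  may denote the same differential polynomial; only their values are ever used.\<close>

datatype (ders: 'i, coefs: 'a) diff_poly =
    Coef 'a
  | Indet nat
  | Deriv 'i "('i, 'a) diff_poly"
  | Plus "('i, 'a) diff_poly" "('i, 'a) diff_poly"
  | Times "('i, 'a) diff_poly" "('i, 'a) diff_poly"

primrec indets :: "('i, 'a) diff_poly \<Rightarrow> nat set" where
  "indets (Coef a) = {}"
| "indets (Indet j) = {j}"
| "indets (Deriv i p) = indets p"
| "indets (Plus p q) = indets p \<union> indets q"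
| "indets (Times p q) = indets p \<union> indets q"

primrec dp_eval ::
  "'b ring \<Rightarrow> ('i \<Rightarrow> 'b \<Rightarrow> 'b) \<Rightarrow> ('a \<Rightarrow> 'b) \<Rightarrow> (nat \<Rightarrow> 'b) \<Rightarrow> ('i, 'a) diff_poly \<Rightarrow> 'b" where
  "dp_eval L E h y (Coef a) = h a"
| "dp_eval L E h y (Indet j) = y j"
| "dp_eval L E h y (Deriv i p) = E i (dp_eval L E h y p)"
| "dp_eval L E h y (Plus p q) = dp_eval L E h y p \<oplus>\<^bsub>L\<^esub> dp_eval L E h y q"
| "dp_eval L E h y (Times p q) = dp_eval L E h y p \<otimes>\<^bsub>L\<^esub> dp_eval L E h y q"

text \<open>A system: a (possibly infinite) set of equations \<open>p = 0\<close> in finitely many unknowns.\<close>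

definition diff_system :: "nat \<Rightarrow> 'a set \<Rightarrow> nat \<Rightarrow> (nat, 'a) diff_poly set \<Rightarrow> bool" where
  "diff_system m K n S \<longleftrightarrow>
     (\<forall>p\<in>S. ders p \<subseteq> {1..m} \<and> coefs p \<subseteq> K \<and> indets p \<subseteq> {..<n})"

definition solves ::
  "'b ring \<Rightarrow> ('i \<Rightarrow> 'b \<Rightarrow> 'b) \<Rightarrow> ('a \<Rightarrow> 'b) \<Rightarrow> (nat \<Rightarrow> 'b) \<Rightarrow> ('i, 'a) diff_poly set \<Rightarrow> bool" where
  "solves L E h y S \<longleftrightarrow> (\<forall>j. y j \<in> carrier L) \<and> (\<forall>p\<in>S. dp_eval L E h y p = \<zero>\<^bsub>L\<^esub>)"

text \<open>Every system over \<open>F\<close> that is solvable in some differential extension of \<open>F\<close> is solvable in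
  \<open>U\<close>. The quantified extension \<open>L\<close> has its carrier in the type of the elements of \<open>F\<close>. If \<open>F\<close> is
  infinite (in particular, of characteristic zero) this covers all extensions: inside an arbitrary
  extension, a solution generates a differential extension of \<open>F\<close> that has the same cardinality
  as \<open>F\<close>, hence a copy with carrier in that type.\<close>

definition universal_extension ::
  "nat \<Rightarrow> 'a ring \<Rightarrow> (nat \<Rightarrow> 'a \<Rightarrow> 'a) \<Rightarrow> 'b ring \<Rightarrow> (nat \<Rightarrow> 'b \<Rightarrow> 'b) \<Rightarrow> ('a \<Rightarrow> 'b) \<Rightarrow> bool" where
  "universal_extension m F D U E e \<longleftrightarrow> differential_extension m F D U E e \<and>
     (\<forall>n S. diff_system m (carrier F) n S \<longrightarrow>
        (\<exists>(L :: 'a ring) E' h y. differential_extension m F D L E' h \<and> solves L E' h y S) \<longrightarrow>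
        (\<exists>y. solves U E e y S))"


section \<open>Subfields of a field\<close>

text \<open>The ambient field is a type; the constant \<open>ring_of_type_algebra\<close> is this field as a ring
  record with carrier \<open>UNIV\<close>.\<close>

abbreviation ambient :: "'u :: field ring" where
  "ambient \<equiv> ring_of_type_algebra"

abbreviation subfield_ring :: "'u :: field set \<Rightarrow> 'u ring" where
  "subfield_ring K \<equiv> ambient\<lparr>carrier := K\<rparr>"

text \<open>\<open>adjoin k S\<close> is the subfield \<open>k(S)\<close>.\<close>

definition adjoin :: "'u :: field set \<Rightarrow> 'u set \<Rightarrow> 'u set" where
  "adjoin k S = generate_field ambient (k \<union> S)"

definition polys_over :: "'u :: field set \<Rightarrow> 'u poly set" where
  "polys_over k = {p. \<forall>n. Polynomial.coeff p n \<in> k}"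

definition algebraic_closure_in_ambient :: "'u :: field set \<Rightarrow> 'u set" where
  "algebraic_closure_in_ambient k = {c. \<exists>p\<in>polys_over k. p \<noteq> 0 \<and> poly p c = 0}"

definition algebraically_independent :: "'u :: field set \<Rightarrow> 'i set \<Rightarrow> ('i \<Rightarrow> 'u) \<Rightarrow> bool" where
  "algebraically_independent k I x \<longleftrightarrow>
     (\<forall>P :: ('i \<Rightarrow>\<^sub>0 nat) \<Rightarrow>\<^sub>0 'u.
        (\<forall>t. Poly_Mapping.lookup P t \<in> k) \<and>
        (\<forall>t\<in>Poly_Mapping.keys P. Poly_Mapping.keys t \<subseteq> I) \<and>
        (\<Sum>t\<in>Poly_Mapping.keys P. Poly_Mapping.lookup P t *
           (\<Prod>i\<in>Poly_Mapping.keys t. x i ^ Poly_Mapping.lookup t i)) = 0 \<longrightarrow> P = 0)"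


section \<open>Forms and logarithms\<close>

text \<open>The 1-form with coefficients \<open>f 1, \<dots>, f m\<close> is represented by the family \<open>f\<close>.\<close>

definition closed_form :: "nat \<Rightarrow> (nat \<Rightarrow> 'u \<Rightarrow> 'u) \<Rightarrow> (nat \<Rightarrow> 'u) \<Rightarrow> bool" where
  "closed_form m D f \<longleftrightarrow> (\<forall>i\<in>{1..m}. \<forall>j\<in>{1..m}. D i (f j) = D j (f i))"

definition is_differential_of :: "nat \<Rightarrow> (nat \<Rightarrow> 'u \<Rightarrow> 'u) \<Rightarrow> (nat \<Rightarrow> 'u) \<Rightarrow> 'u \<Rightarrow> bool" where
  "is_differential_of m D f g \<longleftrightarrow> (\<forall>i\<in>{1..m}. f i = D i g)"

definition is_log :: "nat \<Rightarrow> (nat \<Rightarrow> 'u \<Rightarrow> 'u) \<Rightarrow> 'u :: field \<Rightarrow> 'u \<Rightarrow> bool" where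
  "is_log m D b l \<longleftrightarrow> b \<noteq> 0 \<and> (\<forall>i\<in>{1..m}. D i l = D i b / b)"

end

theory Submission
  imports Defs "HOL-Algebra.Free_Abelian_Groups"
begin

text \<open>
  The form is integrated one variable at a time, beginning with the last. Let \<open>F = k(x\<^sub>1, \<dots>, x\<^sub>m\<^sub>-\<^sub>1)\<close>, so that
  \<open>K = F(x\<^sub>m)\<close>. Hermite reduction (\<open>hermite_reduction\<close>) writes \<open>f\<^sub>m = \<partial>\<^sub>m a + P / Q\<close> with \<open>a \<in> K\<close> and a monic
  squarefree \<open>Q\<close> over \<open>F\<close>. Over an algebraic closure, \<open>P / Q\<close> is the sum of the fractions
  \<open>c\<^sub>\<alpha> / (x\<^sub>m - \<alpha>)\<close>, where \<open>\<alpha>\<close> runs through the roots of \<open>Q\<close> and \<open>c\<^sub>\<alpha> = P(\<alpha>) / Q'(\<alpha>)\<close>. Since the form is closed,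
  \<open>\<partial>\<^sub>i f\<^sub>m\<close> is a derivative with respect to \<open>x\<^sub>m\<close>, for each \<open>i < m\<close>; up to such derivatives it is the sum of the
  fractions \<open>\<partial>\<^sub>i c\<^sub>\<alpha> / (x\<^sub>m - \<alpha>)\<close>. But a derivative has no simple poles
  (\<open>simple_poles_not_exact\<close>), so all \<open>\<partial>\<^sub>i c\<^sub>\<alpha>\<close> vanish, and the residues are algebraic over \<open>k\<close>
  (\<open>constant_algebraic_over_constants\<close>).

  The product \<open>b\<^sub>c\<close> of all \<open>x\<^sub>m - \<alpha>\<close> with \<open>c\<^sub>\<alpha> = c\<close> is the greatest common divisor of \<open>Q\<close> and \<open>P - c * Q'\<close>, hence a
  polynomial over \<open>F(c)\<close>. The form minus the differential of \<open>a + \<Sum> c * log b\<^sub>c\<close> is closed and has no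
  \<open>dx\<^sub>m\<close>. Its coefficients lie in \<open>K\<close>, since Lagrange interpolation identifies the sum of all
  \<open>c\<^sub>\<alpha> * \<partial>\<^sub>i \<alpha> / (x\<^sub>m - \<alpha>)\<close> as a fraction over \<open>F\<close> with denominator \<open>Q\<close> (\<open>residue_decomposition\<close>); having
  derivative zero with respect to \<open>x\<^sub>m\<close>, they even lie in \<open>F\<close>. Induction finishes the argument
  (\<open>closed_form_decomposition\<close>).

  This takes place in an algebraic closure of \<open>\<U>\<close>, to which derivations extend uniquely
  (\<open>derivation_alg_closure\<close>). Formal logarithms are adjoined to it as indeterminates
  (\<open>logarithmic_extension\<close>). The resulting differential field contains a solution of a system of
  differential equations over \<open>K\<close> that describes the residues and the logarithms; by universality, the system
  also has a solution in \<open>\<U>\<close> (\<open>universal_extension_solution\<close>), and any solution is as required.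
\<close>

section \<open>Subfields, and polynomials with coefficients in a subfield\<close>

lemma ambient_simps [simp]:
  "carrier (ambient :: 'u :: field ring) = UNIV"
  "a \<oplus>\<^bsub>ambient\<^esub> b = (a + b :: 'u)"
  "a \<otimes>\<^bsub>ambient\<^esub> b = (a * b :: 'u)"
  "\<zero>\<^bsub>ambient\<^esub> = (0 :: 'u)"
  "\<one>\<^bsub>ambient\<^esub> = (1 :: 'u)"
  by (simp_all add: ring_of_type_algebra_def)

lemma ambient_field: "field (ambient :: 'u :: field ring)"
  by (rule field_from_type_algebra)

lemma ambient_a_inv [simp]: "\<ominus>\<^bsub>ambient\<^esub> a = - (a :: 'u :: field)"
proof -
  interpret A: field "ambient :: 'u ring" by (rule ambient_field)
  show ?thesis
    by (rule A.minus_equality) simp_all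
qed

lemma ambient_m_inv [simp]:
  assumes "a \<noteq> 0" shows "inv\<^bsub>ambient\<^esub> a = inverse (a :: 'u :: field)"
proof -
  interpret A: field "ambient :: 'u ring" by (rule ambient_field)
  show ?thesis
    by (rule A.comm_inv_char) (use assms in simp_all)
qed

lemma ambient_pow [simp]: "a [^]\<^bsub>ambient\<^esub> n = (a :: 'u :: field) ^ n"
proof -
  interpret A: field "ambient :: 'u ring" by (rule ambient_field)
  show ?thesis
    by (induction n) (simp_all add: A.nat_pow_Suc)
qed

lemma subfield_ambientI:
  assumes "1 \<in> F" and "\<And>a b. a \<in> F \<Longrightarrow> b \<in> F \<Longrightarrow> a + b \<in> F" and "\<And>a. a \<in> F \<Longrightarrow> - a \<in> F"
    and "\<And>a b. a \<in> F \<Longrightarrow> b \<in> F \<Longrightarrow> a * b \<in> F" and "\<And>a. a \<in> F \<Longrightarrow> a \<noteq> 0 \<Longrightarrow> inverse a \<in> F"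
  shows "subfield F (ambient :: 'u :: field ring)"
proof -
  interpret A: field "ambient :: 'u ring" by (rule ambient_field)
  show ?thesis
    by (rule A.subfieldI', rule A.subringI) (use assms in auto)
qed

locale ambient_subfield =
  fixes F :: "'u :: field set"
  assumes subfield: "subfield F ambient"
begin

lemma zero [simp, intro]: "0 \<in> F" and one [simp, intro]: "1 \<in> F"
  and add [intro]: "a \<in> F \<Longrightarrow> b \<in> F \<Longrightarrow> a + b \<in> F"
  and uminus [intro]: "a \<in> F \<Longrightarrow> - a \<in> F"
  and mult [intro]: "a \<in> F \<Longrightarrow> b \<in> F \<Longrightarrow> a * b \<in> F"
  using subringE[OF subfieldE(1)[OF subfield]] by auto

lemma minus [intro]: "a \<in> F \<Longrightarrow> b \<in> F \<Longrightarrow> a - b \<in> F"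
  using add[of a "- b"] uminus[of b] by simp

lemma inverse [intro]: "a \<in> F \<Longrightarrow> inverse a \<in> F"
proof (cases "a = 0")
  case False
  moreover assume "a \<in> F"
  ultimately show ?thesis
    using ring.subfield_m_inv(1)[OF field.is_ring[OF ambient_field] subfield, of a] by simp
qed simp

lemma divide [intro]: "a \<in> F \<Longrightarrow> b \<in> F \<Longrightarrow> a / b \<in> F"
  by (simp add: divide_inverse mult inverse)

lemma power [intro]: "a \<in> F \<Longrightarrow> a ^ n \<in> F"
  by (induction n) auto

lemma sum [intro]: "(\<And>i. i \<in> I \<Longrightarrow> g i \<in> F) \<Longrightarrow> sum g I \<in> F"
  by (induction I rule: infinite_finite_induct) auto

lemma of_nat [simp, intro]: "of_nat n \<in> F"
  by (induction n) auto

lemma polys_0 [simp, intro]: "0 \<in> polys_over F" and polys_1 [simp, intro]: "1 \<in> polys_over F"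
  by (auto simp: polys_over_def coeff_1)

lemma coeff_in: "p \<in> polys_over F \<Longrightarrow> Polynomial.coeff p n \<in> F"
  by (simp add: polys_over_def)

lemma polys_pCons [simp]: "pCons a p \<in> polys_over F \<longleftrightarrow> a \<in> F \<and> p \<in> polys_over F"
  by (auto simp: polys_over_def coeff_pCons split: nat.splits)

lemma polys_add [intro]: "p \<in> polys_over F \<Longrightarrow> q \<in> polys_over F \<Longrightarrow> p + q \<in> polys_over F"
  and polys_minus [intro]: "p \<in> polys_over F \<Longrightarrow> q \<in> polys_over F \<Longrightarrow> p - q \<in> polys_over F"
  and polys_uminus [intro]: "p \<in> polys_over F \<Longrightarrow> - p \<in> polys_over F"
  and polys_smult [intro]: "a \<in> F \<Longrightarrow> p \<in> polys_over F \<Longrightarrow> smult a p \<in> polys_over F"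
  and polys_monom [intro]: "a \<in> F \<Longrightarrow> Polynomial.monom a n \<in> polys_over F"
  and polys_pderiv [intro]: "p \<in> polys_over F \<Longrightarrow> pderiv p \<in> polys_over F"
  by (auto simp: polys_over_def coeff_pderiv simp del: of_nat_Suc)

lemma polys_mult [intro]: "p \<in> polys_over F \<Longrightarrow> q \<in> polys_over F \<Longrightarrow> p * q \<in> polys_over F"
  by (auto simp: polys_over_def coeff_mult)

lemma polys_power [intro]: "p \<in> polys_over F \<Longrightarrow> p ^ n \<in> polys_over F"
  by (induction n) auto

lemma polys_map [intro]:
  "p \<in> polys_over F \<Longrightarrow> h 0 = 0 \<Longrightarrow> (\<And>a. a \<in> F \<Longrightarrow> h a \<in> F) \<Longrightarrow> map_poly h p \<in> polys_over F"
  by (auto simp: polys_over_def coeff_map_poly)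

lemma poly_in: "p \<in> polys_over F \<Longrightarrow> a \<in> F \<Longrightarrow> poly p a \<in> F"
  by (induction p) auto

text \<open>Long division divides by nothing but the leading coefficient of the divisor.\<close>

lemma polys_division:
  assumes "p \<in> polys_over F" "q \<in> polys_over F"
  shows "p div q \<in> polys_over F \<and> p mod q \<in> polys_over F"
proof (cases "q = 0")
  case False
  from assms(1) show ?thesis
  proof (induction "Polynomial.degree p" arbitrary: p rule: less_induct)
    case less
    show ?case
    proof (cases "p = 0 \<or> Polynomial.degree p < Polynomial.degree q")
      case True
      then show ?thesis using less.prems by (auto simp: div_poly_less mod_poly_less)
    next
      case False
      then have p: "p \<noteq> 0" "Polynomial.degree q \<le> Polynomial.degree p" by auto
      define t where "t = Polynomial.monom (Polynomial.lead_coeff p / Polynomial.lead_coeff q)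
                            (Polynomial.degree p - Polynomial.degree q)"
      have t: "t \<in> polys_over F"
        unfolding t_def using less.prems assms(2) by (intro polys_monom divide coeff_in)
      have "t \<noteq> 0" using p \<open>q \<noteq> 0\<close> by (simp add: t_def)
      define r where "r = p - t * q"
      have r: "r \<in> polys_over F" unfolding r_def using t less.prems assms(2) by auto
      have deg_tq: "Polynomial.degree (t * q) = Polynomial.degree p"
        using p \<open>q \<noteq> 0\<close> \<open>t \<noteq> 0\<close>
        by (simp add: degree_mult_eq t_def Polynomial.degree_monom_eq)
      have "Polynomial.lead_coeff (t * q) = Polynomial.lead_coeff p"
        using p \<open>q \<noteq> 0\<close> by (simp add: Polynomial.lead_coeff_mult t_def Polynomial.degree_monom_eq)
      then have "Polynomial.coeff r (Polynomial.degree p) = 0"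
        unfolding r_def using deg_tq by simp
      moreover have "Polynomial.degree r \<le> Polynomial.degree p"
        unfolding r_def using deg_tq by (intro degree_diff_le) auto
      ultimately have "r = 0 \<or> Polynomial.degree r < Polynomial.degree p"
        by (metis le_neq_implies_less Polynomial.leading_coeff_0_iff)
      then have "r div q \<in> polys_over F \<and> r mod q \<in> polys_over F"
        using less.hyps[of r] r by auto
      moreover have "p = r + t * q" by (simp add: r_def)
      ultimately show ?thesis using \<open>q \<noteq> 0\<close> t by (simp add: polys_add)
    qed
  qed
qed (use assms in auto)

lemma polys_div [intro]: "p \<in> polys_over F \<Longrightarrow> q \<in> polys_over F \<Longrightarrow> p div q \<in> polys_over F"
  and polys_mod [intro]: "p \<in> polys_over F \<Longrightarrow> q \<in> polys_over F \<Longrightarrow> p mod q \<in> polys_over F"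
  using polys_division by auto

lemma polys_cofactor:
  assumes "p \<in> polys_over F" "q \<in> polys_over F" "p = q * r" "q \<noteq> 0"
  shows "r \<in> polys_over F"
  using polys_div[OF assms(1,2)] assms(3,4) by simp

text \<open>The Euclidean algorithm consists of divisions with remainder, so the greatest common divisor of
  two polynomials over \<open>F\<close>, though computed over the ambient field, has its coefficients in \<open>F\<close>. This is
  what makes the arguments of the logarithms rational over small fields.\<close>

lemma monic_gcd_in_subfield:
  assumes "p \<in> polys_over F" "q \<in> polys_over F" "p \<noteq> 0"
  obtains g u v where "g \<in> polys_over F" "u \<in> polys_over F" "v \<in> polys_over F"
    "Polynomial.lead_coeff g = 1" "g dvd p" "g dvd q" "g = u * p + v * q"
proof -
  have "\<exists>g u v. g \<in> polys_over F \<and> u \<in> polys_over F \<and> v \<in> polys_over F \<and>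
     Polynomial.lead_coeff g = 1 \<and> g dvd p \<and> g dvd q \<and> g = u * p + v * q"
    if "q \<in> polys_over F" "p \<in> polys_over F" "p \<noteq> 0 \<or> q \<noteq> 0" for q p
    using that
  proof (induction "if q = 0 then 0 else Suc (Polynomial.degree q)" arbitrary: p q rule: less_induct)
    case less
    show ?case
    proof (cases "q = 0")
      case True
      define a where "a = inverse (Polynomial.lead_coeff p)"
      have "a \<noteq> 0" using True less.prems by (auto simp: a_def)
      have a: "a \<in> F" unfolding a_def using less.prems by (intro inverse coeff_in)
      have "Polynomial.lead_coeff (smult a p) = 1"
        using True less.prems by (simp add: a_def)
      moreover have "smult a p dvd p" using \<open>a \<noteq> 0\<close> by (simp add: smult_dvd_iff)
      ultimately show ?thesis
        using True less.prems a
        by (intro exI[of _ "smult a p"] exI[of _ "[:a:]"] exI[of _ 0]) auto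
    next
      case False
      have "p mod q = 0 \<or> Polynomial.degree (p mod q) < Polynomial.degree q"
        using False by (meson degree_mod_less)
      then have "(if p mod q = 0 then 0 else Suc (Polynomial.degree (p mod q)))
          < (if q = 0 then 0 else Suc (Polynomial.degree q))"
        using False by auto
      then obtain g u v where g: "g \<in> polys_over F" "u \<in> polys_over F" "v \<in> polys_over F"
         "Polynomial.lead_coeff g = 1" "g dvd q" "g dvd p mod q" "g = u * q + v * (p mod q)"
        using less.hyps[of "p mod q" q] polys_mod[OF less.prems(2,1)] less.prems(1) False by blast
      have "g dvd p" using g(5,6) by (metis dvd_mod_iff)
      moreover have "g = v * p + (u - v * (p div q)) * q"
        using g(7) by (simp add: algebra_simps minus_div_mult_eq_mod [symmetric])
      moreover have "u - v * (p div q) \<in> polys_over F" using g less.prems by blast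
      ultimately show ?thesis using g by blast
    qed
  qed
  then show thesis using assms that by blast
qed

lemma coprime_bezout_in_subfield:
  assumes "p \<in> polys_over F" "q \<in> polys_over F" "p \<noteq> 0" "coprime p q"
  obtains u v where "u \<in> polys_over F" "v \<in> polys_over F" "u * p + v * q = 1"
proof -
  obtain g u v where g: "u \<in> polys_over F" "v \<in> polys_over F"
    "Polynomial.lead_coeff g = 1" "g dvd p" "g dvd q" "g = u * p + v * q"
    using monic_gcd_in_subfield[OF assms(1-3)] by metis
  have "is_unit g" using coprime_common_divisor[OF assms(4)] g by blast
  moreover have "g \<noteq> 0" using g(3) by auto
  ultimately have "Polynomial.degree g = 0" using is_unit_iff_degree by blast
  then have "g = 1" using g(3) by (metis degree_0_id of_nat_1 one_pCons)
  then show thesis using that g by auto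
qed

end


section \<open>Adjunction\<close>

lemma subfield_adjoin: "subfield (adjoin k S) (ambient :: 'u :: field ring)"
  unfolding adjoin_def using field.generate_field_is_subfield[OF ambient_field] by simp

lemma base_subset_adjoin: "k \<subseteq> adjoin k S" and gens_subset_adjoin: "S \<subseteq> adjoin k S"
  unfolding adjoin_def by (auto intro: generate_field.incl)

lemma adjoin_least:
  "subfield L (ambient :: 'u :: field ring) \<Longrightarrow> k \<subseteq> L \<Longrightarrow> S \<subseteq> L \<Longrightarrow> adjoin k S \<subseteq> L"
  unfolding adjoin_def
  using field.generate_field_min_subfield1[OF ambient_field, of "k \<union> S" L] by simp

lemma adjoin_mono: "S \<subseteq> T \<Longrightarrow> adjoin k S \<subseteq> adjoin k (T :: 'u :: field set)"
  by (intro adjoin_least subfield_adjoin base_subset_adjoin)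
     (use gens_subset_adjoin in blast)

lemma adjoin_adjoin: "adjoin (adjoin k S) T = adjoin k (S \<union> T :: 'u :: field set)"
proof
  show "adjoin (adjoin k S) T \<subseteq> adjoin k (S \<union> T)"
    using gens_subset_adjoin[of "S \<union> T" k]
    by (intro adjoin_least[OF subfield_adjoin] adjoin_mono) auto
  show "adjoin k (S \<union> T) \<subseteq> adjoin (adjoin k S) T"
    using gens_subset_adjoin[of S k] base_subset_adjoin[of k S]
      base_subset_adjoin[of "adjoin k S" T] gens_subset_adjoin[of T "adjoin k S"]
    by (intro adjoin_least[OF subfield_adjoin]) auto
qed

lemma adjoin_empty: "subfield k ambient \<Longrightarrow> adjoin k {} = (k :: 'u :: field set)"
  using adjoin_least[of k k "{}"] base_subset_adjoin[of k "{}"] by auto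

text \<open>Zero denominators need not be excluded from these quotients, as \<open>a / 0 = 0\<close>.\<close>

lemma adjoin_singleton:
  assumes "subfield F (ambient :: 'u :: field ring)"
  shows "adjoin F {z} = {a. \<exists>p\<in>polys_over F. \<exists>q\<in>polys_over F. a = poly p z / poly q z}"
    (is "_ = ?Q")
proof
  interpret ambient_subfield F by (rule ambient_subfield.intro) fact
  have quot: "a \<in> ?Q" if "a = poly p z / poly q z" "p \<in> polys_over F" "q \<in> polys_over F" for a p q
    using that by blast
  have "subfield ?Q ambient"
  proof (rule subfield_ambientI)
    show "1 \<in> ?Q" by (rule quot[of _ 1 1]) auto
  next
    fix a assume "a \<in> ?Q"
    then obtain p q where a: "a = poly p z / poly q z" "p \<in> polys_over F" "q \<in> polys_over F" by blast
    show "- a \<in> ?Q" by (rule quot[of _ "- p" q]) (use a in auto)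
    show "inverse a \<in> ?Q" by (rule quot[of _ q p]) (use a in auto)
    fix b assume "b \<in> ?Q"
    then obtain r s where b: "b = poly r z / poly s z" "r \<in> polys_over F" "s \<in> polys_over F" by blast
    show "a * b \<in> ?Q" by (rule quot[of _ "p * r" "q * s"]) (use a b in auto)
    show "a + b \<in> ?Q"
    proof (cases "poly q z = 0 \<or> poly s z = 0")
      case True
      then have "a + b \<in> {a, b}" using a b by auto
      moreover have "{a, b} \<subseteq> ?Q" using \<open>a \<in> ?Q\<close> \<open>b \<in> ?Q\<close> by (simp only: insert_subset empty_subsetI simp_thms)
      ultimately show ?thesis by (rule subsetD[rotated])
    next
      case False
      then have "a + b = poly (p * s + r * q) z / poly (q * s) z"
        using a(1) b(1) by (simp add: add_frac_eq)
      then show ?thesis using a b by (intro quot[of _ "p * s + r * q" "q * s"]) auto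
    qed
  qed
  moreover have "F \<subseteq> ?Q"
  proof
    fix a assume "a \<in> F"
    then show "a \<in> ?Q" by (intro quot[of _ "[:a:]" 1]) auto
  qed
  moreover have "{z} \<subseteq> ?Q" using quot[of z "[:0, 1:]" 1] by simp
  ultimately show "adjoin F {z} \<subseteq> ?Q" by (rule adjoin_least)
next
  interpret A: ambient_subfield "adjoin F {z}" by (rule ambient_subfield.intro) (rule subfield_adjoin)
  have "p \<in> polys_over (adjoin F {z})" if "p \<in> polys_over F" for p
    using that base_subset_adjoin[of F "{z}"] by (auto simp: polys_over_def)
  moreover have "z \<in> adjoin F {z}" using gens_subset_adjoin[of "{z}" F] by simp
  ultimately show "?Q \<subseteq> adjoin F {z}" by (auto intro!: A.divide A.poly_in)
qed


section \<open>Algebraic elements\<close>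

lemma eval_ambient: "ring.eval ambient xs a = poly (Poly (rev xs)) (a :: 'u :: field)"
proof -
  interpret A: field "ambient :: 'u ring" by (rule ambient_field)
  show ?thesis
    by (induction xs) (simp_all add: Poly_append poly_monom algebra_simps)
qed

lemma algebraic_over_ambient_iff:
  assumes "subfield F (ambient :: 'u :: field ring)"
  shows "(ring.algebraic ambient over F) a \<longleftrightarrow> a \<in> algebraic_closure_in_ambient F"
proof -
  interpret ambient_subfield F by (rule ambient_subfield.intro) fact
  interpret A: field "ambient :: 'u ring" by (rule ambient_field)
  show ?thesis
  proof
    assume "(A.algebraic over F) a"
    then obtain xs where xs: "xs \<in> carrier (univ_poly ambient F)" "xs \<noteq> []" "A.eval xs a = 0"
      using A.algebraicE[OF subfieldE(1)[OF subfield], of a] by auto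
    have sub: "set xs \<subseteq> F" and hd: "hd xs \<noteq> 0"
      using xs(1,2) by (auto simp: univ_poly_def polynomial_def)
    define p where "p = Poly (rev xs)"
    have "Polynomial.coeff p n \<in> F" for n
    proof (cases "n < length xs")
      case True
      then have "Polynomial.coeff p n \<in> set xs"
        by (simp add: p_def nth_default_def rev_nth)
      then show ?thesis using sub by blast
    qed (simp add: p_def nth_default_def)
    then have "p \<in> polys_over F" by (simp add: polys_over_def)
    moreover have "Polynomial.coeff p (length xs - 1) = hd xs"
      using xs(2) by (simp add: p_def nth_default_def rev_nth hd_conv_nth)
    then have "p \<noteq> 0" using hd by auto
    moreover have "poly p a = 0" using xs(3) by (simp add: p_def eval_ambient)
    ultimately show "a \<in> algebraic_closure_in_ambient F"
      by (auto simp: algebraic_closure_in_ambient_def)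
  next
    assume "a \<in> algebraic_closure_in_ambient F"
    then obtain p where p: "p \<in> polys_over F" "p \<noteq> 0" "poly p a = 0"
      by (auto simp: algebraic_closure_in_ambient_def)
    define xs where "xs = rev (coeffs p)"
    have "set xs \<subseteq> F" using p(1) by (auto simp: xs_def coeffs_def polys_over_def)
    moreover have "hd xs \<noteq> 0" using p(2) by (simp add: xs_def hd_rev last_coeffs_eq_coeff_degree)
    ultimately have "xs \<in> carrier (univ_poly ambient F)"
      by (simp add: univ_poly_def polynomial_def)
    moreover have "xs \<noteq> []" using p(2) by (simp add: xs_def)
    moreover have "A.eval xs a = \<zero>\<^bsub>ambient\<^esub>" using p(3) by (simp add: xs_def eval_ambient)
    ultimately show "(A.algebraic over F) a" by (rule A.algebraicI)
  qed
qed

lemma subfield_algebraic_closure: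
  assumes "subfield F (ambient :: 'u :: field ring)"
  shows "subfield (algebraic_closure_in_ambient F) ambient"
  using field.subfield_of_algebraics[OF ambient_field assms] algebraic_over_ambient_iff[OF assms]
  by simp

context ambient_subfield
begin

lemma algebraic_base: "a \<in> F \<Longrightarrow> a \<in> algebraic_closure_in_ambient F"
  unfolding algebraic_closure_in_ambient_def
  by (intro CollectI bexI[of _ "[:- a, 1:]"]) auto

text \<open>Division by the minimal polynomial turns the vanishing of a polynomial at an algebraic
  element into a statement about divisibility.\<close>

lemma minimal_polynomial_exists:
  assumes "a \<in> algebraic_closure_in_ambient F"
  obtains p where "p \<in> polys_over F" "Polynomial.lead_coeff p = 1" "poly p a = 0"
    "\<And>q. q \<in> polys_over F \<Longrightarrow> q \<noteq> 0 \<Longrightarrow> poly q a = 0 \<Longrightarrow> Polynomial.degree p \<le> Polynomial.degree q"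
    "\<And>q. q \<in> polys_over F \<Longrightarrow> poly q a = 0 \<Longrightarrow> p dvd q"
proof -
  let ?V = "\<lambda>q. q \<in> polys_over F \<and> q \<noteq> 0 \<and> poly q a = 0"
  obtain q0 where "?V q0" using assms by (auto simp: algebraic_closure_in_ambient_def)
  then obtain p0 where p0: "?V p0" "\<And>q. ?V q \<Longrightarrow> Polynomial.degree p0 \<le> Polynomial.degree q"
    using ex_has_least_nat[of ?V q0 Polynomial.degree] by blast
  define p where "p = smult (inverse (Polynomial.lead_coeff p0)) p0"
  have p: "p \<in> polys_over F" "Polynomial.lead_coeff p = 1" "poly p a = 0"
    unfolding p_def using p0(1) by (auto intro: coeff_in)
  have deg: "Polynomial.degree p \<le> Polynomial.degree q" if "?V q" for q
    using p0(1) p0(2)[OF that] by (simp add: p_def)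
  have "p dvd q" if q: "q \<in> polys_over F" "poly q a = 0" for q
  proof -
    have "poly (q mod p) a = 0"
      using poly_mod[OF p(3), of q] q(2) by simp
    moreover have "Polynomial.degree (q mod p) < Polynomial.degree p \<or> q mod p = 0"
      using p(2) by (metis degree_mod_less Polynomial.leading_coeff_0_iff zero_neq_one)
    ultimately show ?thesis
      using deg[of "q mod p"] polys_mod[OF q(1) p(1)] by (fastforce simp: mod_eq_0_iff_dvd)
  qed
  then show thesis using that p deg by blast
qed

text \<open>Inverting \<open>poly q c\<close> by means of a Bezout relation with the minimal polynomial of \<open>c\<close> shows
  that the polynomial values at an algebraic element already form a field.\<close>

lemma adjoin_algebraic:
  assumes "c \<in> algebraic_closure_in_ambient F" "a \<in> adjoin F {c}"
  obtains q where "q \<in> polys_over F" "a = poly q c"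
proof -
  obtain p where p: "p \<in> polys_over F" "Polynomial.lead_coeff p = 1" "poly p c = 0"
    "\<And>q. q \<in> polys_over F \<Longrightarrow> q \<noteq> 0 \<Longrightarrow> poly q c = 0 \<Longrightarrow> Polynomial.degree p \<le> Polynomial.degree q"
    by (rule minimal_polynomial_exists[OF assms(1)]) (rule that)
  obtain r s where rs: "r \<in> polys_over F" "s \<in> polys_over F" "a = poly r c / poly s c"
    using assms(2) adjoin_singleton[OF subfield, of c] by auto
  show thesis
  proof (cases "poly s c = 0")
    case True
    then show thesis using that[of 0] rs by simp
  next
    case False
    have "p \<noteq> 0" using p(2) by auto
    obtain g u v where g: "g \<in> polys_over F" "v \<in> polys_over F"
      "Polynomial.lead_coeff g = 1" "g dvd p" "g dvd s" "g = u * p + v * s"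
      using monic_gcd_in_subfield[OF p(1) rs(2) \<open>p \<noteq> 0\<close>] by metis
    obtain h where h: "p = g * h" using g(4) by blast
    have "poly g c \<noteq> 0" using g(5) False by auto
    then have "poly h c = 0" using p(3) h by simp
    moreover have "h \<noteq> 0" "g \<noteq> 0" using h \<open>p \<noteq> 0\<close> by auto
    moreover from this have "h \<in> polys_over F" using polys_cofactor[OF p(1) g(1) h] by simp
    ultimately have "Polynomial.degree p \<le> Polynomial.degree h" using p(4) by blast
    then have "Polynomial.degree g = 0"
      using h \<open>h \<noteq> 0\<close> \<open>g \<noteq> 0\<close> by (simp add: degree_mult_eq)
    then have "g = 1" using g(3) by (metis degree_0_id of_nat_1 one_pCons)
    then have "poly v c * poly s c = 1"
      using g(6) p(3) by (metis add_0 mult_zero_right poly_1 poly_add poly_mult)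
    then have "poly v c = 1 / poly s c" using False by (simp add: eq_divide_eq)
    then have "a = poly (r * v) c" using rs(3) by simp
    then show thesis using that[of "r * v"] rs g by blast
  qed
qed

end

section \<open>Derivations\<close>

text \<open>Derivations are needed on subfields, while they are being extended step by step, and on polynomial
  rings, where logarithms are adjoined; hence a domain \<open>F\<close> and an ambient commutative ring.\<close>

definition derivation_on :: "'a :: comm_ring_1 set \<Rightarrow> ('a \<Rightarrow> 'a) \<Rightarrow> bool" where
  "derivation_on F d \<longleftrightarrow>
     (\<forall>a\<in>F. \<forall>b\<in>F. d (a + b) = d a + d b \<and> d (a * b) = d a * b + a * d b)"

lemma derivation_ambient_iff [simp]: "derivation ambient d \<longleftrightarrow> derivation_on UNIV d"
  by (simp add: derivation_def derivation_on_def)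

context
  fixes d :: "'a :: comm_ring_1 \<Rightarrow> 'a"
  assumes d: "derivation_on UNIV d"
begin

lemma derivation_add: "d (a + b) = d a + d b"
  and derivation_mult: "d (a * b) = d a * b + a * d b"
  using d by (simp_all add: derivation_on_def)

lemma derivation_0: "d 0 = 0"
  using derivation_add[of 0 0] by simp

lemma derivation_1: "d 1 = 0"
  using derivation_mult[of 1 1] by simp

lemma derivation_uminus: "d (- a) = - d a"
  using derivation_add[of a "- a"] by (simp add: derivation_0 eq_neg_iff_add_eq_0 add.commute)

lemma derivation_minus: "d (a - b) = d a - d b"
  using derivation_add[of a "- b"] by (simp add: derivation_uminus)

lemma derivation_sum: "d (sum g I) = (\<Sum>i\<in>I. d (g i))"
  by (induction I rule: infinite_finite_induct) (simp_all add: derivation_0 derivation_add)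

end

context
  fixes d :: "'a :: field \<Rightarrow> 'a"
  assumes d: "derivation_on UNIV d"
begin

lemma derivation_inverse: "d (inverse a) = - d a / a\<^sup>2"
proof (cases "a = 0")
  case False
  then have "d a * inverse a + a * d (inverse a) = 0"
    using derivation_mult[OF d, of a "inverse a"] derivation_1[OF d] by simp
  then show ?thesis using False
    by (simp add: field_simps power2_eq_square eq_neg_iff_add_eq_0)
qed (simp add: derivation_0[OF d])

lemma derivation_divide:
  assumes "b \<noteq> 0" shows "d (a / b) = (d a * b - a * d b) / b\<^sup>2"
proof -
  have "d (a / b) = d a * inverse b + a * (- d b / b\<^sup>2)"
    unfolding divide_inverse[of a b] by (simp only: derivation_mult[OF d] derivation_inverse)
  then show ?thesis using assms by (simp add: field_simps power2_eq_square)
qed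

lemma log_derivative_prod:
  "finite I \<Longrightarrow> (\<And>i. i \<in> I \<Longrightarrow> g i \<noteq> 0) \<Longrightarrow> d (prod g I) / prod g I = (\<Sum>i\<in>I. d (g i) / g i)"
proof (induction I rule: finite_induct)
  case (insert i I)
  then have "prod g I \<noteq> 0" "g i \<noteq> 0" by auto
  then show ?case using insert by (simp add: derivation_mult[OF d] add_divide_distrib)
qed (simp add: derivation_1[OF d])

lemma subfield_constants: "subfield {a. d a = 0} ambient"
  by (rule subfield_ambientI)
     (simp_all add: derivation_1[OF d] derivation_add[OF d] derivation_uminus[OF d]
        derivation_mult[OF d] derivation_inverse)

end

lemma derivation_commutator:
  assumes d: "derivation_on UNIV d" and e: "derivation_on UNIV e"
  shows "derivation_on UNIV (\<lambda>a. d (e a) - e (d a))"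
  unfolding derivation_on_def
  by (simp add: derivation_add[OF d] derivation_add[OF e] derivation_mult[OF d]
      derivation_mult[OF e] algebra_simps)

subsection \<open>Derivations and polynomials\<close>

context ambient_subfield
begin

context
  fixes d :: "'u \<Rightarrow> 'u"
  assumes d: "derivation_on F d"
begin

lemma derivation_on_add: "a \<in> F \<Longrightarrow> b \<in> F \<Longrightarrow> d (a + b) = d a + d b"
  and derivation_on_mult: "a \<in> F \<Longrightarrow> b \<in> F \<Longrightarrow> d (a * b) = d a * b + a * d b"
  using d by (simp_all add: derivation_on_def)

lemma derivation_on_0: "d 0 = 0"
  using derivation_on_mult[of 0 0] by simp

lemma derivation_on_poly:
  "p \<in> polys_over F \<Longrightarrow> a \<in> F \<Longrightarrow>
     d (poly p a) = poly (map_poly d p) a + poly (pderiv p) a * d a"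
proof (induction p)
  case (pCons c p)
  then have "c \<in> F" "p \<in> polys_over F" "poly p a \<in> F" by (auto intro: poly_in)
  then show ?case using pCons
    by (simp add: derivation_on_add derivation_on_mult derivation_on_0 map_poly_pCons pderiv_pCons
        mult algebra_simps)
qed (simp add: derivation_on_0)

lemma map_poly_derivation_add:
  "p \<in> polys_over F \<Longrightarrow> q \<in> polys_over F \<Longrightarrow> map_poly d (p + q) = map_poly d p + map_poly d q"
  by (rule poly_eqI) (simp add: coeff_map_poly derivation_on_0 derivation_on_add coeff_in)

lemma map_poly_derivation_smult:
  "a \<in> F \<Longrightarrow> p \<in> polys_over F \<Longrightarrow>
     map_poly d (smult a p) = smult (d a) p + smult a (map_poly d p)"
  by (rule poly_eqI) (simp add: coeff_map_poly derivation_on_0 derivation_on_mult coeff_in)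

lemma map_poly_derivation_mult:
  "p \<in> polys_over F \<Longrightarrow> q \<in> polys_over F \<Longrightarrow>
     map_poly d (p * q) = map_poly d p * q + p * map_poly d q"
proof (induction p)
  case (pCons c p)
  then have "c \<in> F" "p \<in> polys_over F" "p * q \<in> polys_over F" "smult c q \<in> polys_over F"
    "pCons 0 (p * q) \<in> polys_over F" by auto
  then show ?case using pCons
    by (simp add: map_poly_derivation_add map_poly_derivation_smult map_poly_pCons derivation_on_0
        algebra_simps)
qed simp

end

end

locale char0_subfield = ambient_subfield F for F :: "'u :: field_char_0 set"
begin

lemma minimal_polynomial_separable:
  assumes "p \<in> polys_over F" "p \<noteq> 0" "poly p a = 0"
    and "\<And>q. q \<in> polys_over F \<Longrightarrow> q \<noteq> 0 \<Longrightarrow> poly q a = 0 \<Longrightarrow> Polynomial.degree p \<le> Polynomial.degree q"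
  shows "poly (pderiv p) a \<noteq> 0"
proof
  assume *: "poly (pderiv p) a = 0"
  have "Polynomial.degree p > 0"
    using assms(2,3) by (metis degree_0_id poly_const_conv bot_nat_0.not_eq_extremum pCons_0_0)
  then have "pderiv p \<noteq> 0" "Polynomial.degree (pderiv p) < Polynomial.degree p"
    by (simp_all add: pderiv_eq_0_iff degree_pderiv)
  then show False using assms(4)[of "pderiv p"] assms(1) * by auto
qed

text \<open>Differentiating the equation \<open>p(a) = 0\<close> determines the derivative of \<open>a\<close>.\<close>

lemma derivation_algebraic:
  assumes "subfield G ambient" "F \<subseteq> G" "a \<in> G" "derivation_on G e"
    and "p \<in> polys_over F" "poly p a = 0" "poly (pderiv p) a \<noteq> 0"
    and "\<And>c. c \<in> F \<Longrightarrow> e c = d c" "d 0 = 0"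
  shows "e a = - poly (map_poly d p) a / poly (pderiv p) a"
proof -
  interpret G: ambient_subfield G by (rule ambient_subfield.intro) fact
  have "p \<in> polys_over G" using assms(2,5) by (auto simp: polys_over_def)
  then have "0 = poly (map_poly e p) a + poly (pderiv p) a * e a"
    using G.derivation_on_poly[OF assms(4), of p a] G.derivation_on_0[OF assms(4)] assms(3,6) by simp
  also have "map_poly e p = map_poly d p"
    using G.derivation_on_0[OF assms(4)] assms(5,8,9)
    by (intro poly_eqI) (simp add: coeff_map_poly coeff_in)
  finally have "e a * poly (pderiv p) a = - poly (map_poly d p) a"
    by (simp add: eq_neg_iff_add_eq_0 algebra_simps)
  then show ?thesis using assms(7) by (intro eq_divide_imp)
qed

lemma derivation_zero_on_algebraic:
  assumes "derivation_on UNIV e" "\<And>c. c \<in> F \<Longrightarrow> e c = 0" "a \<in> algebraic_closure_in_ambient F"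
  shows "e a = 0"
proof -
  obtain p where p: "p \<in> polys_over F" "Polynomial.lead_coeff p = 1" "poly p a = 0"
    "\<And>q. q \<in> polys_over F \<Longrightarrow> q \<noteq> 0 \<Longrightarrow> poly q a = 0 \<Longrightarrow> Polynomial.degree p \<le> Polynomial.degree q"
    by (rule minimal_polynomial_exists[OF assms(3)]) (rule that)
  have "p \<noteq> 0" using p(2) by auto
  then have "poly (pderiv p) a \<noteq> 0" using minimal_polynomial_separable p by blast
  moreover have "subfield (UNIV :: 'u set) ambient"
    by (rule subfield_ambientI) auto
  ultimately have "e a = - poly (map_poly (\<lambda>_. 0) p) a / poly (pderiv p) a"
    using assms(1,2) p by (intro derivation_algebraic) auto
  moreover have "map_poly (\<lambda>_. 0) p = (0 :: 'u poly)"
    by (rule poly_eqI) (simp add: coeff_map_poly)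
  ultimately show ?thesis by simp
qed

text \<open>Differentiating the coefficients of the minimal polynomial gives a relation of lower degree, so these
  coefficients are constants.\<close>

lemma constant_algebraic_over_constants:
  fixes \<Delta> :: "('u \<Rightarrow> 'u) set"
  assumes \<Delta>: "\<And>e. e \<in> \<Delta> \<Longrightarrow> derivation_on UNIV e" "\<And>e c. e \<in> \<Delta> \<Longrightarrow> c \<in> F \<Longrightarrow> e c \<in> F"
    and a: "a \<in> algebraic_closure_in_ambient F" "\<And>e. e \<in> \<Delta> \<Longrightarrow> e a = 0"
  shows "a \<in> algebraic_closure_in_ambient {c \<in> F. \<forall>e\<in>\<Delta>. e c = 0}"
proof -
  obtain p where p: "p \<in> polys_over F" "Polynomial.lead_coeff p = 1" "poly p a = 0"
    "\<And>q. q \<in> polys_over F \<Longrightarrow> q \<noteq> 0 \<Longrightarrow> poly q a = 0 \<Longrightarrow> Polynomial.degree p \<le> Polynomial.degree q"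
    by (rule minimal_polynomial_exists[OF a(1)]) (rule that)
  have UN: "ambient_subfield (UNIV :: 'u set)"
    by (intro ambient_subfield.intro subfield_ambientI) auto
  have "map_poly e p = 0" if e: "e \<in> \<Delta>" for e
  proof (rule ccontr)
    assume nz: "map_poly e p \<noteq> 0"
    have e0: "e 0 = 0" and e1: "e 1 = 0" using derivation_0 derivation_1 \<Delta>(1)[OF e] by auto
    have "poly (map_poly e p) a = 0"
      using ambient_subfield.derivation_on_poly[OF UN \<Delta>(1)[OF e], of p a] p(3) a(2)[OF e] e0
      by (simp add: polys_over_def)
    moreover have "map_poly e p \<in> polys_over F" using p(1) e0 \<Delta>(2)[OF e] by (intro polys_map) auto
    ultimately have "Polynomial.degree p \<le> Polynomial.degree (map_poly e p)" using p(4) nz by blast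
    moreover have "Polynomial.degree (map_poly e p) \<le> Polynomial.degree p" 
      by (intro Polynomial.degree_le) (simp add: coeff_map_poly e0 coeff_eq_0)
    ultimately have "Polynomial.lead_coeff (map_poly e p) = e (Polynomial.lead_coeff p)"
      by (simp add: coeff_map_poly e0)
    then show False using nz p(2) e1 by simp
  qed
  then have "e (Polynomial.coeff p n) = 0" if "e \<in> \<Delta>" for e n
    using that derivation_0[OF \<Delta>(1)[OF that]] by (metis coeff_map_poly coeff_0)
  then have "p \<in> polys_over {c \<in> F. \<forall>e\<in>\<Delta>. e c = 0}"
    using p(1) by (auto simp: polys_over_def)
  moreover have "p \<noteq> 0" using p(2) by auto
  ultimately show ?thesis using p(3) by (auto simp: algebraic_closure_in_ambient_def)
qed

end

text \<open>The derivative of an algebraic relation over the constants would be a relation of lower degree.\<close>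

lemma transcendental_over_constants:
  fixes z :: "'u :: field_char_0"
  assumes d: "derivation_on UNIV d" and z: "d z = 1"
    and p: "p \<in> polys_over {a. d a = 0}" "poly p z = 0"
  shows "p = 0"
  using p
proof (induction "Polynomial.degree p" arbitrary: p rule: less_induct)
  case less
  interpret C: ambient_subfield "{a. d a = 0}"
    by (rule ambient_subfield.intro) (rule subfield_constants[OF d])
  have UN: "ambient_subfield (UNIV :: 'u set)"
    by (intro ambient_subfield.intro subfield_ambientI) auto
  show ?case
  proof (cases "Polynomial.degree p = 0")
    case True
    then show ?thesis using less.prems by (metis degree_0_id poly_const_conv pCons_0_0)
  next
    case False
    have "map_poly d p = 0"
      using less.prems derivation_0[OF d] by (intro poly_eqI) (auto simp: coeff_map_poly polys_over_def)
    then have "poly (pderiv p) z = 0"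
      using ambient_subfield.derivation_on_poly[OF UN d, of p z] less.prems(2) derivation_0[OF d] z
      by (simp add: polys_over_def)
    moreover have "Polynomial.degree (pderiv p) < Polynomial.degree p"
      using False by (simp add: degree_pderiv)
    ultimately have "pderiv p = 0" using less by blast
    then show ?thesis using False by (simp add: pderiv_eq_0_iff)
  qed
qed

section \<open>Extending derivations to the algebraic closure\<close>

context char0_subfield
begin

text \<open>The equation \<open>p(\<theta>) = 0\<close> leaves one possible derivative \<open>\<theta>'\<close> of \<open>\<theta>\<close>. The value that the chain rule then
  assigns to \<open>q(\<theta>)\<close> does not depend on \<open>q\<close>, because a polynomial vanishing at \<open>\<theta>\<close> is a multiple of \<open>p\<close>.\<close>

lemma derivation_extends_to_simple_extension:
  assumes d: "derivation_on F d" and \<theta>: "\<theta> \<in> algebraic_closure_in_ambient F"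
  obtains d' where "derivation_on (adjoin F {\<theta>}) d'" "\<And>a. a \<in> F \<Longrightarrow> d' a = d a"
proof -
  obtain p where p: "p \<in> polys_over F" "Polynomial.lead_coeff p = 1" "poly p \<theta> = 0"
    "\<And>q. q \<in> polys_over F \<Longrightarrow> q \<noteq> 0 \<Longrightarrow> poly q \<theta> = 0 \<Longrightarrow> Polynomial.degree p \<le> Polynomial.degree q"
    "\<And>q. q \<in> polys_over F \<Longrightarrow> poly q \<theta> = 0 \<Longrightarrow> p dvd q"
    by (rule minimal_polynomial_exists[OF \<theta>]) (rule that)
  have "p \<noteq> 0" using p(2) by auto
  then have sep: "poly (pderiv p) \<theta> \<noteq> 0" using minimal_polynomial_separable p by blast
  define \<theta>' where "\<theta>' = - poly (map_poly d p) \<theta> / poly (pderiv p) \<theta>"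
  define E where "E q = poly (map_poly d q) \<theta> + poly (pderiv q) \<theta> * \<theta>'" for q
  have E_add: "E (q + r) = E q + E r"
    and E_mult: "E (q * r) = E q * poly r \<theta> + poly q \<theta> * E r"
    if "q \<in> polys_over F" "r \<in> polys_over F" for q r
    using that map_poly_derivation_add[OF d] map_poly_derivation_mult[OF d]
    by (simp_all add: E_def pderiv_add pderiv_mult algebra_simps)
  have E0: "E q = 0" if "q \<in> polys_over F" "poly q \<theta> = 0" for q
  proof -
    obtain s where s: "q = p * s" using p(5) \<open>q \<in> _\<close> \<open>poly q \<theta> = 0\<close> by blast
    have "s \<in> polys_over F" using polys_cofactor[OF that(1) p(1) s \<open>p \<noteq> 0\<close>] .
    then have "E q = E p * poly s \<theta>" using E_mult[OF p(1)] p(3) s by simp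
    also have "E p = 0" using sep by (simp add: E_def \<theta>'_def)
    finally show ?thesis by simp
  qed
  have E_cong: "E q = E r" if "q \<in> polys_over F" "r \<in> polys_over F" "poly q \<theta> = poly r \<theta>" for q r
    using E0[of "q - r"] E_add[of "q - r" r] that by auto
  define rep where "rep a = (SOME q. q \<in> polys_over F \<and> a = poly q \<theta>)" for a
  have rep: "rep a \<in> polys_over F \<and> a = poly (rep a) \<theta>" if "a \<in> adjoin F {\<theta>}" for a
    unfolding rep_def by (rule someI_ex) (use adjoin_algebraic[OF \<theta> that] in blast)
  have d': "E (rep a) = E q" if "q \<in> polys_over F" "a = poly q \<theta>" "a \<in> adjoin F {\<theta>}" for a q
    using E_cong[of "rep a" q] rep[of a] that by simp
  interpret A: ambient_subfield "adjoin F {\<theta>}" by (rule ambient_subfield.intro) (rule subfield_adjoin)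
  have "derivation_on (adjoin F {\<theta>}) (\<lambda>a. E (rep a))"
    unfolding derivation_on_def
  proof (intro ballI conjI)
    fix a b assume ab: "a \<in> adjoin F {\<theta>}" "b \<in> adjoin F {\<theta>}"
    note r = rep[OF ab(1)] rep[OF ab(2)]
    have "E (rep (a + b)) = E (rep a + rep b)"
      by (rule d') (use r ab in \<open>auto\<close>)
    then show "E (rep (a + b)) = E (rep a) + E (rep b)" using E_add r by simp
    have "E (rep (a * b)) = E (rep a * rep b)"
      by (rule d') (use r ab in \<open>auto\<close>)
    then show "E (rep (a * b)) = E (rep a) * b + a * E (rep b)" using E_mult r by simp
  qed
  moreover have "E (rep a) = d a" if "a \<in> F" for a
  proof -
    have "E (rep a) = E [:a:]"
      using that base_subset_adjoin[of F "{\<theta>}"] by (intro d') auto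
    then show ?thesis by (simp add: E_def map_poly_pCons derivation_on_0[OF d])
  qed
  ultimately show thesis using that by blast
qed

text \<open>The derivative of each element is forced by its minimal polynomial. Any two elements lie in a
  tower of two simple extensions, on which these forced values form a derivation; hence they form a
  derivation globally.\<close>

lemma derivation_extends_to_algebraic_extension:
  assumes d: "derivation_on F d" and alg: "algebraic_closure_in_ambient F = UNIV"
  obtains d' where "derivation_on UNIV d'" "\<And>a. a \<in> F \<Longrightarrow> d' a = d a"
proof -
  let ?P = "\<lambda>a p. p \<in> polys_over F \<and> poly p a = 0 \<and> poly (pderiv p) a \<noteq> 0"
  have "\<exists>p. ?P a p" for a
  proof -
    have a: "a \<in> algebraic_closure_in_ambient F" using alg by simp
    obtain p where p: "p \<in> polys_over F" "Polynomial.lead_coeff p = 1" "poly p a = 0"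
      "\<And>q. q \<in> polys_over F \<Longrightarrow> q \<noteq> 0 \<Longrightarrow> poly q a = 0 \<Longrightarrow> Polynomial.degree p \<le> Polynomial.degree q"
      by (rule minimal_polynomial_exists[OF a]) (rule that)
    have "p \<noteq> 0" using p(2) by auto
    then show ?thesis using minimal_polynomial_separable[of p a] p by blast
  qed
  then obtain P where P: "?P a (P a)" for a by metis
  define d' where "d' a = - poly (map_poly d (P a)) a / poly (pderiv (P a)) a" for a
  have forced: "e a = d' a"
    if "subfield G ambient" "F \<subseteq> G" "a \<in> G" "derivation_on G e" "\<And>c. c \<in> F \<Longrightarrow> e c = d c" for e G a
    unfolding d'_def using that P[of a] derivation_on_0[OF d] by (intro derivation_algebraic) auto
  have "d' (a + b) = d' a + d' b \<and> d' (a * b) = d' a * b + a * d' b" for a b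
  proof -
    let ?A = "adjoin F {a}" let ?B = "adjoin ?A {b}"
    obtain d1 where d1: "derivation_on ?A d1" "\<And>c. c \<in> F \<Longrightarrow> d1 c = d c"
      using derivation_extends_to_simple_extension[OF d, of a] alg by auto
    interpret A: char0_subfield ?A
      by (intro char0_subfield.intro ambient_subfield.intro subfield_adjoin)
    have FA: "F \<subseteq> ?A" by (rule base_subset_adjoin)
    have "b \<in> algebraic_closure_in_ambient F" using alg by simp
    then have "b \<in> algebraic_closure_in_ambient ?A"
      using FA unfolding algebraic_closure_in_ambient_def polys_over_def by blast
    then obtain d2 where d2: "derivation_on ?B d2" "\<And>c. c \<in> ?A \<Longrightarrow> d2 c = d1 c"
      using A.derivation_extends_to_simple_extension[OF d1(1)] by metis
    have B: "subfield ?B ambient" by (rule subfield_adjoin)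
    interpret B: ambient_subfield ?B by (rule ambient_subfield.intro) (rule B)
    have AB: "?A \<subseteq> ?B" by (rule base_subset_adjoin)
    have ab: "a \<in> ?B" "b \<in> ?B"
      using AB gens_subset_adjoin[of "{a}" F] gens_subset_adjoin[of "{b}" ?A] by auto
    have "F \<subseteq> ?B" using FA AB by blast
    moreover have "d2 c = d c" if "c \<in> F" for c using that d2(2) d1(2) FA by auto
    ultimately have *: "d2 c = d' c" if "c \<in> ?B" for c
      using that by (intro forced[OF B _ _ d2(1)]) auto
    have "d2 (a + b) = d2 a + d2 b \<and> d2 (a * b) = d2 a * b + a * d2 b"
      using d2(1) ab unfolding derivation_on_def by blast
    then show ?thesis using * ab B.add B.mult by simp
  qed
  then have "derivation_on UNIV d'" by (simp add: derivation_on_def)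
  moreover have "d' a = d a" if "a \<in> F" for a
    using forced[OF subfield _ that d] by simp
  ultimately show thesis using that by blast
qed

end

lemma map_poly_to_ac_in_range: "map_poly to_ac p \<in> polys_over (range to_ac)"
  by (simp add: polys_over_def coeff_map_poly)

lemma subfield_range_to_ac: "subfield (range to_ac) (ambient :: 'u :: field alg_closure ring)"
proof (rule subfield_ambientI)
  show "1 \<in> range (to_ac :: 'u \<Rightarrow> _)" by (metis to_ac_1 rangeI)
next
  fix a b :: "'u alg_closure" assume "a \<in> range to_ac" "b \<in> range to_ac"
  then obtain a' b' where "a = to_ac a'" "b = to_ac b'" by blast
  then have "a + b = to_ac (a' + b')" "a * b = to_ac (a' * b')" by simp_all
  then show "a + b \<in> range to_ac" "a * b \<in> range to_ac" by blast+
next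
  fix a :: "'u alg_closure" assume "a \<in> range to_ac"
  then obtain a' where "a = to_ac a'" by blast
  then have "- a = to_ac (- a')" "inverse a = to_ac (inverse a')"
    by (simp_all add: to_ac_minus to_ac_inverse)
  then show "- a \<in> range to_ac" "inverse a \<in> range to_ac" by blast+
qed

lemma algebraic_over_range_to_ac: "algebraic_closure_in_ambient (range to_ac) = (UNIV :: 'u :: field alg_closure set)"
proof -
  have "a \<in> algebraic_closure_in_ambient (range to_ac)" for a :: "'u alg_closure"
  proof -
    obtain p where "p \<noteq> 0" "poly (map_poly to_ac p) a = 0" by (rule alg_closure_algebraic)
    then show ?thesis
      unfolding algebraic_closure_in_ambient_def
      by (intro CollectI bexI[of _ "map_poly to_ac p"])
         (simp_all add: map_poly_to_ac_in_range map_poly_eq_0_iff)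
  qed
  then show ?thesis by blast
qed

lemma derivation_alg_closure:
  assumes "derivation_on UNIV (d :: 'u :: field_char_0 \<Rightarrow> 'u)"
  obtains d' where "derivation_on UNIV d'" "\<And>a. d' (to_ac a) = to_ac (d a)"
proof -
  interpret char0_subfield "range (to_ac :: 'u \<Rightarrow> _)"
    by (intro char0_subfield.intro ambient_subfield.intro subfield_range_to_ac)
  have "derivation_on (range to_ac) (\<lambda>a. to_ac (d (of_ac a)))"
    unfolding derivation_on_def
    by (auto simp flip: to_ac_add to_ac_mult simp: derivation_add[OF assms] derivation_mult[OF assms])
  then obtain d' where "derivation_on UNIV d'" "\<And>a. a \<in> range to_ac \<Longrightarrow> d' a = to_ac (d (of_ac a))"
    using derivation_extends_to_algebraic_extension algebraic_over_range_to_ac by metis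
  then show thesis using that by simp
qed

text \<open>Commutators of derivations are derivations, so extensions of commuting derivations commute.\<close>

lemma derivations_commute_alg_closure:
  fixes d e :: "'u :: field_char_0 alg_closure \<Rightarrow> 'u alg_closure"
  assumes "derivation_on UNIV d" "derivation_on UNIV e" "\<And>a. d (e (to_ac a)) = e (d (to_ac a))"
  shows "d (e a) = e (d a)"
proof -
  interpret char0_subfield "range (to_ac :: 'u \<Rightarrow> _)"
    by (intro char0_subfield.intro ambient_subfield.intro subfield_range_to_ac)
  have "d (e a) - e (d a) = 0"
    using derivation_zero_on_algebraic[OF derivation_commutator[OF assms(1,2)]] assms(3)
      algebraic_over_range_to_ac by auto
  then show ?thesis by simp
qed

section \<open>Rational functions in an element with derivative one\<close>

lemma coprime_if_unit_combination:
  fixes p q :: "'u :: field poly"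
  assumes "g = u * p + v * q" "is_unit g"
  shows "coprime p q"
proof (rule coprimeI)
  fix c assume "c dvd p" "c dvd q"
  then have "c dvd g" unfolding assms(1) by (simp add: dvd_add dvd_mult)
  then show "is_unit c" using assms(2) by (rule dvd_trans)
qed

context ambient_subfield
begin

lemma coprime_factor_dvd:
  assumes "p \<in> polys_over F" "q \<in> polys_over F" "q \<noteq> 0" "coprime p q" "q dvd p * r"
  shows "q dvd r"
proof -
  have "coprime q p" using assms(4) by (simp add: coprime_commute)
  then obtain u v where "u * q + v * p = 1"
    using coprime_bezout_in_subfield[OF assms(2,1,3)] by metis
  then have "r = (u * q + v * p) * r" by simp
  then have "r = q * (u * r) + v * (p * r)" by (simp add: algebra_simps)
  then show ?thesis using assms(5) by (metis dvd_add dvd_mult dvd_triv_left)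
qed

text \<open>A divisor of least positive degree has no proper divisors over \<open>F\<close>, so its greatest common divisor with
  a polynomial over \<open>F\<close> is a unit or the divisor itself.\<close>

lemma prime_divisor_in_subfield:
  assumes "g \<in> polys_over F" "g \<noteq> 0" "Polynomial.degree g > 0"
  obtains v where "v \<in> polys_over F" "v dvd g" "Polynomial.degree v > 0"
    "\<And>s. s \<in> polys_over F \<Longrightarrow> v dvd s \<or> coprime v s"
proof -
  let ?V = "\<lambda>v. v \<in> polys_over F \<and> v dvd g \<and> Polynomial.degree v > 0"
  obtain v where v: "?V v" and least: "\<And>w. ?V w \<Longrightarrow> Polynomial.degree v \<le> Polynomial.degree w"
    using ex_has_least_nat[of ?V g Polynomial.degree] assms by auto
  have "v \<noteq> 0" using v by auto
  have "v dvd s \<or> coprime v s" if s: "s \<in> polys_over F" for s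
  proof -
    obtain h u w where h: "h \<in> polys_over F" "Polynomial.lead_coeff h = 1" "h dvd v" "h dvd s"
      "h = u * v + w * s"
      by (rule monic_gcd_in_subfield[OF conjunct1[OF v] s \<open>v \<noteq> 0\<close>]) (rule that)
    have "h \<noteq> 0" using h(2) by auto
    show ?thesis
    proof (cases "Polynomial.degree h = 0")
      case True
      then have "is_unit h" using \<open>h \<noteq> 0\<close> by (simp add: is_unit_iff_degree)
      then show ?thesis using coprime_if_unit_combination[OF h(5)] by blast
    next
      case False
      then have "Polynomial.degree v \<le> Polynomial.degree h" using least[of h] h v by (meson dvd_trans gr0I)
      obtain t where t: "v = h * t" using h(3) by blast
      then have "t \<noteq> 0" using \<open>v \<noteq> 0\<close> by auto
      then have "Polynomial.degree t = 0"
        using \<open>Polynomial.degree v \<le> Polynomial.degree h\<close> t \<open>h \<noteq> 0\<close> by (simp add: degree_mult_eq)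
      then have "is_unit t" using \<open>t \<noteq> 0\<close> by (simp add: is_unit_iff_degree)
      then have "v dvd s" using t h(4) by (simp add: mult_unit_dvd_iff)
      then show ?thesis ..
    qed
  qed
  then show thesis using that v by blast
qed

lemma split_off_power:
  fixes q v :: "'u poly"
  assumes "q \<noteq> 0" "Polynomial.degree v > 0"
  obtains e w where "q = v ^ e * w" "\<not> v dvd w"
proof -
  have "\<exists>e w. q = v ^ e * w \<and> \<not> v dvd w"
    using assms(1)
  proof (induction "Polynomial.degree q" arbitrary: q rule: less_induct)
    case less
    show ?case
    proof (cases "v dvd q")
      case True
      then obtain r where r: "q = v * r" by blast
      then have "r \<noteq> 0" "v \<noteq> 0" using less.prems by auto
      then have "Polynomial.degree r < Polynomial.degree q" using r assms(2) by (simp add: degree_mult_eq)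
      then obtain e w where "r = v ^ e * w" "\<not> v dvd w" using less.hyps \<open>r \<noteq> 0\<close> by blast
      then show ?thesis using r by (intro exI[of _ "Suc e"] exI[of _ w]) (simp add: mult.assoc)
    next
      case False
      then show ?thesis by (intro exI[of _ 0] exI[of _ q]) simp
    qed
  qed
  then show thesis using that by blast
qed

end

lemma pderiv_sum: "pderiv (sum f I) = (\<Sum>i\<in>I. pderiv (f i))"
  by (induction I rule: infinite_finite_induct) (simp_all add: pderiv_add)

lemma (in char0_subfield) antiderivative_in_subfield:
  assumes "t \<in> polys_over F"
  obtains T where "T \<in> polys_over F" "pderiv T = t"
proof
  let ?T = "\<Sum>i\<le>Polynomial.degree t.
      Polynomial.monom (Polynomial.coeff t i / of_nat (Suc i)) (Suc i)"
  have "Polynomial.coeff ?T n \<in> F" for n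
    using assms by (auto simp: coeff_sum coeff_in simp del: of_nat_Suc intro!: sum divide)
  then show "?T \<in> polys_over F" by (simp add: polys_over_def)
  have "pderiv ?T = (\<Sum>i\<le>Polynomial.degree t. Polynomial.monom (Polynomial.coeff t i) i)"
    by (simp add: pderiv_sum pderiv_monom del: of_nat_Suc)
  then show "pderiv ?T = t" by (simp add: poly_as_sum_of_monoms)
qed

locale primitive_extension = char0_subfield F for F :: "'u :: field_char_0 set" +
  fixes \<delta> :: "'u \<Rightarrow> 'u" and z :: 'u
  assumes \<delta>: "derivation_on UNIV \<delta>" and \<delta>_F: "\<And>c. c \<in> F \<Longrightarrow> \<delta> c = 0" and \<delta>_z: "\<delta> z = 1"
begin

lemma polys_over_constants: "p \<in> polys_over F \<Longrightarrow> p \<in> polys_over {a. \<delta> a = 0}"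
  using \<delta>_F by (auto simp: polys_over_def)

lemma eval_eq_0_iff [simp]: "p \<in> polys_over F \<Longrightarrow> poly p z = 0 \<longleftrightarrow> p = 0"
  using transcendental_over_constants[OF \<delta> \<delta>_z polys_over_constants] by auto

lemma \<delta>_poly_constants: "p \<in> polys_over {a. \<delta> a = 0} \<Longrightarrow> \<delta> (poly p z) = poly (pderiv p) z"
proof -
  assume p: "p \<in> polys_over {a. \<delta> a = 0}"
  have UN: "ambient_subfield (UNIV :: 'u set)"
    by (intro ambient_subfield.intro subfield_ambientI) auto
  have "map_poly \<delta> p = 0"
    using p derivation_0[OF \<delta>] by (intro poly_eqI) (auto simp: coeff_map_poly polys_over_def)
  then show ?thesis
    using ambient_subfield.derivation_on_poly[OF UN \<delta>, of p z] \<delta>_z by (simp add: polys_over_def)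
qed

lemma \<delta>_poly: "p \<in> polys_over F \<Longrightarrow> \<delta> (poly p z) = poly (pderiv p) z"
  by (intro \<delta>_poly_constants polys_over_constants)

lemma in_extension: "p \<in> polys_over F \<Longrightarrow> q \<in> polys_over F \<Longrightarrow> poly p z / poly q z \<in> adjoin F {z}"
  using adjoin_singleton[OF subfield, of z] by blast

lemma reduced_fraction:
  assumes "a \<in> adjoin F {z}"
  obtains p q where "p \<in> polys_over F" "q \<in> polys_over F" "q \<noteq> 0" "coprime p q"
    "a = poly p z / poly q z"
proof -
  obtain p q where pq: "p \<in> polys_over F" "q \<in> polys_over F" "a = poly p z / poly q z"
    using assms adjoin_singleton[OF subfield, of z] by blast
  show thesis
  proof (cases "q = 0")
    case True
    then show thesis using that[of 0 1] pq by simp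
  next
    case False
    obtain g u v where g: "g \<in> polys_over F" "u \<in> polys_over F" "v \<in> polys_over F"
      "Polynomial.lead_coeff g = 1" "g dvd q" "g dvd p" "g = u * q + v * p"
      by (rule monic_gcd_in_subfield[OF pq(2,1) False]) (rule that)
    obtain q' p' where q': "q = g * q'" and p': "p = g * p'" using g(5,6) by (meson dvdE)
    have "g \<noteq> 0" using g(4) by auto
    have "g * 1 = g * (u * q' + v * p')" using g(7) q' p' by (simp add: algebra_simps)
    then have one: "1 = u * q' + v * p'" using \<open>g \<noteq> 0\<close> by (simp only: mult_cancel_left) simp
    have "coprime p' q'"
      using coprime_if_unit_combination[OF one] by (simp add: coprime_commute)
    moreover have "p' \<in> polys_over F" "q' \<in> polys_over F"
      using polys_cofactor pq g(1) p' q' \<open>g \<noteq> 0\<close> by blast+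
    moreover have "q' \<noteq> 0" using q' False by auto
    moreover have "poly g z \<noteq> 0" using \<open>g \<noteq> 0\<close> g(1) by simp
    then have "a = poly p' z / poly q' z" using pq(3) p' q' by simp
    ultimately show thesis using that by blast
  qed
qed

lemma \<delta>_fraction:
  assumes "p \<in> polys_over F" "q \<in> polys_over F" "q \<noteq> 0"
  shows "\<delta> (poly p z / poly q z)
    = poly (pderiv p * q - p * pderiv q) z / poly (q ^ 2) z"
  using assms by (simp add: derivation_divide[OF \<delta>] \<delta>_poly)

text \<open>In lowest terms, a vanishing derivative makes numerator and denominator divide their own
  derivatives, which have smaller degree.\<close>

lemma constant_in_extension:
  assumes "a \<in> adjoin F {z}" "\<delta> a = 0"
  shows "a \<in> F"
proof -
  obtain p q where pq: "p \<in> polys_over F" "q \<in> polys_over F" "q \<noteq> 0" "coprime p q"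
    "a = poly p z / poly q z"
    using reduced_fraction[OF assms(1)] by blast
  have "poly (pderiv p * q - p * pderiv q) z = 0"
    using \<delta>_fraction[OF pq(1-3)] assms(2) pq by simp
  moreover have "pderiv p * q - p * pderiv q \<in> polys_over F" using pq by blast
  ultimately have "pderiv p * q - p * pderiv q = 0" using eval_eq_0_iff by blast
  then have *: "pderiv p * q = p * pderiv q" by simp
  have "r = 0 \<or> Polynomial.degree r = 0" if "r dvd pderiv r" for r :: "'u poly"
  proof (cases "pderiv r = 0")
    case False
    then have "Polynomial.degree r \<le> Polynomial.degree (pderiv r)" using that by (intro dvd_imp_degree_le)
    then show ?thesis by (cases "Polynomial.degree r") (simp_all add: degree_pderiv)
  qed (simp add: pderiv_eq_0_iff)
  moreover have "q dvd pderiv q"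
    using coprime_factor_dvd[OF pq(1-4)] * by (metis dvd_triv_right)
  moreover have "p dvd pderiv p" if "p \<noteq> 0"
    using coprime_factor_dvd[OF pq(2,1) that, of "pderiv p"] pq(4) *
    by (metis coprime_commute dvd_triv_left mult.commute)
  ultimately have deg: "Polynomial.degree p = 0" "Polynomial.degree q = 0"
    using pq(3) by (metis degree_0)+
  have "poly p z = Polynomial.coeff p 0" "poly q z = Polynomial.coeff q 0"
    using deg by (auto elim!: degree_eq_zeroE)
  then show ?thesis using pq by (simp add: coeff_in divide)
qed

subsection \<open>Hermite reduction\<close>

text \<open>If the denominator has a multiple factor \<open>v\<close>, say \<open>q = v ^ (n + 2) * w\<close>, then a Bezout relation between
  \<open>v\<close> and \<open>v' * w\<close> splits the fraction into \<open>C / (v ^ (n + 1) * w)\<close> and \<open>B * v' / v ^ (n + 2)\<close>, and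
  integration by parts lowers the pole order of the second summand.\<close>

lemma hermite_reduction_fraction:
  assumes "p \<in> polys_over F" "q \<in> polys_over F" "q \<noteq> 0"
  shows "\<exists>a\<in>adjoin F {z}. \<exists>P\<in>polys_over F. \<exists>Q\<in>polys_over F.
      Polynomial.lead_coeff Q = 1 \<and> coprime Q (pderiv Q) \<and>
      (P = 0 \<or> Polynomial.degree P < Polynomial.degree Q) \<and>
      poly p z / poly q z = \<delta> a + poly P z / poly Q z"
  using assms
proof (induction "Polynomial.degree q" arbitrary: p q rule: less_induct)
  case less
  interpret E: ambient_subfield "adjoin F {z}" by (rule ambient_subfield.intro) (rule subfield_adjoin)
  note p = less.prems(1) and q = less.prems(2,3)
  have qz: "poly q z \<noteq> 0" using q by simp
  have polyE: "poly r z \<in> adjoin F {z}" if "r \<in> polys_over F" for r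
    using in_extension[OF that polys_1] by simp
  show ?case
  proof (cases "coprime q (pderiv q)")
    case True
    define c where "c = inverse (Polynomial.lead_coeff q)"
    have c: "c \<in> F" "c \<noteq> 0" using q by (auto simp: c_def coeff_in)
    obtain T where T: "T \<in> polys_over F" "pderiv T = p div q"
      using antiderivative_in_subfield[of "p div q"] p q by blast
    have "poly p z = poly (p div q) z * poly q z + poly (p mod q) z"
      by (metis div_mult_mod_eq poly_add poly_mult)
    then have "poly p z / poly q z = \<delta> (poly T z) + poly (smult c (p mod q)) z / poly (smult c q) z"
      using qz c T by (simp add: \<delta>_poly field_simps)
    moreover have "smult c (p mod q) = 0 \<or>
        Polynomial.degree (smult c (p mod q)) < Polynomial.degree (smult c q)"
      using degree_mod_less[OF q(2), of p] c(2) by auto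
    moreover have "Polynomial.lead_coeff (smult c q) = 1" using q(2) by (simp add: c_def)
    moreover have "coprime (smult c q) (pderiv (smult c q))"
      using True c(2) unfolding coprime_def by (simp add: pderiv_smult dvd_smult_iff)
    moreover have "smult c (p mod q) \<in> polys_over F" "smult c q \<in> polys_over F"
      using c p q by blast+
    ultimately show ?thesis using polyE[OF T(1)] by blast
  next
    case False
    obtain g s t where g: "g \<in> polys_over F" "s \<in> polys_over F" "t \<in> polys_over F"
      "Polynomial.lead_coeff g = 1" "g dvd q" "g dvd pderiv q" "g = s * q + t * pderiv q"
      by (rule monic_gcd_in_subfield[OF q(1) polys_pderiv[OF q(1)] q(2)]) (rule that)
    have "g \<noteq> 0" using g(4) by auto
    have "Polynomial.degree g > 0"
    proof (rule ccontr)
      assume "\<not> ?thesis"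
      then have "is_unit g" using \<open>g \<noteq> 0\<close> by (simp add: is_unit_iff_degree)
      then show False using coprime_if_unit_combination[OF g(7)] False by blast
    qed
    obtain v where v: "v \<in> polys_over F" "v dvd g" "Polynomial.degree v > 0"
      and prime: "\<And>s. s \<in> polys_over F \<Longrightarrow> v dvd s \<or> coprime v s"
      by (rule prime_divisor_in_subfield[OF g(1) \<open>g \<noteq> 0\<close> \<open>Polynomial.degree g > 0\<close>]) (rule that)
    have "v \<noteq> 0" using v(3) by auto
    have v': "pderiv v \<in> polys_over F" using v by blast
    have "\<not> v dvd pderiv v"
      using v(3) dvd_imp_degree_le[of v "pderiv v"] by (auto simp: degree_pderiv pderiv_eq_0_iff)
    then have cop': "coprime (pderiv v) v" using prime[OF v'] by (simp add: coprime_commute)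
    obtain w1 where w1: "q = v * w1" using v(2) g(5) by (meson dvd_trans dvdE)
    have "v dvd pderiv q" using v(2) g(6) by (rule dvd_trans)
    then have "v dvd pderiv v * w1"
      using w1 by (simp add: pderiv_mult) (metis dvd_add_right_iff dvd_triv_left mult.commute)
    then have "v dvd w1" using coprime_factor_dvd[OF v' v(1) \<open>v \<noteq> 0\<close> cop'] by blast
    obtain e w where e: "q = v ^ e * w" and w: "\<not> v dvd w"
      using split_off_power[OF q(2) v(3)] .
    have "e \<noteq> 0" using e w w1 by (metis dvd_triv_left mult_1 power_0)
    moreover have "e \<noteq> 1" using e w w1 \<open>v dvd w1\<close> \<open>v \<noteq> 0\<close> by (metis mult_cancel_left power_one_right)
    ultimately obtain n where n: "e = Suc (Suc n)" by (metis One_nat_def not0_implies_Suc)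
    have wF: "w \<in> polys_over F" using polys_cofactor[OF q(1) _ e] v(1) \<open>v \<noteq> 0\<close> by auto
    have "w \<noteq> 0" using e q(2) by auto
    have "\<not> v dvd pderiv v * w" using coprime_factor_dvd[OF v' v(1) \<open>v \<noteq> 0\<close> cop'] w by blast
    moreover have "pderiv v * w \<in> polys_over F" using v' wF by blast
    ultimately have vw: "pderiv v * w \<in> polys_over F" "coprime v (pderiv v * w)" using prime by blast+
    obtain s t where st: "s \<in> polys_over F" "t \<in> polys_over F" "s * v + t * (pderiv v * w) = 1"
      by (rule coprime_bezout_in_subfield[OF v(1) vw(1) \<open>v \<noteq> 0\<close> vw(2)]) (rule that)
    define B where "B = p * t"
    define q1 where "q1 = v ^ Suc n * w"
    define p1 where "p1 = p * s + smult (inverse (of_nat (Suc n))) (pderiv B * w)"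
    have B: "B \<in> polys_over F" unfolding B_def using p st by blast
    have q1: "q1 \<in> polys_over F" "q1 \<noteq> 0"
      unfolding q1_def using wF v(1) \<open>v \<noteq> 0\<close> \<open>w \<noteq> 0\<close> by auto
    have p1: "p1 \<in> polys_over F"
      unfolding p1_def
      by (intro polys_add polys_mult polys_smult inverse of_nat polys_pderiv p st(1) wF B)
    have "Polynomial.degree q1 < Polynomial.degree q"
      using e n v(3) \<open>v \<noteq> 0\<close> \<open>w \<noteq> 0\<close> by (simp add: q1_def degree_mult_eq)
    from less.hyps[OF this p1 q1] obtain a P Q where IH: "a \<in> adjoin F {z}" "P \<in> polys_over F"
      "Q \<in> polys_over F" "Polynomial.lead_coeff Q = 1" "coprime Q (pderiv Q)"
      "P = 0 \<or> Polynomial.degree P < Polynomial.degree Q"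
      "poly p1 z / poly q1 z = \<delta> a + poly P z / poly Q z" by blast
    define N where "N = (of_nat (Suc n) :: 'u)"
    have N: "N \<noteq> 0" "N \<in> F" unfolding N_def by (simp_all del: of_nat_Suc)
    define A where "A = poly B z / poly (smult (- N) (v ^ Suc n)) z"
    have den: "smult (- N) (v ^ Suc n) \<in> polys_over F"
      by (intro polys_smult uminus polys_power v(1) N)
    have den0: "smult (- N) (v ^ Suc n) \<noteq> 0" using \<open>v \<noteq> 0\<close> N by simp
    have vz: "poly v z \<noteq> 0" "poly w z \<noteq> 0" using v(1) wF \<open>v \<noteq> 0\<close> \<open>w \<noteq> 0\<close> by simp_all
    have dden: "poly (pderiv (smult (- N) (v ^ Suc n))) z
        = - N * (N * poly v z ^ n * poly (pderiv v) z)"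
      by (simp only: pderiv_smult pderiv_power_Suc poly_smult poly_mult poly_power N_def)
    have "\<delta> A = (poly (pderiv B) z * (- N * poly v z ^ Suc n)
        - poly B z * (- N * (N * poly v z ^ n * poly (pderiv v) z))) / (- N * poly v z ^ Suc n)\<^sup>2"
      unfolding A_def \<delta>_fraction[OF B den den0]
      by (simp only: poly_diff poly_mult dden poly_power poly_smult)
    also have "\<dots> = poly B z * poly (pderiv v) z / poly v z ^ Suc (Suc n)
        - poly (pderiv B) z / (N * poly v z ^ Suc n)"
      using N vz by (simp add: field_simps power2_eq_square)
    finally have dA: "\<delta> A = \<dots>" .
    have "poly p z = poly p z * poly (s * v + t * (pderiv v * w)) z" using st(3) by simp
    then have pz: "poly p z = poly (p * s) z * poly v z + poly B z * poly (pderiv v) z * poly w z"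
      by (simp add: B_def algebra_simps)
    have "poly p z / poly q z = \<delta> A + poly p1 z / poly q1 z"
      unfolding dA pz e n q1_def p1_def N_def [symmetric] using N vz
      by (simp add: field_simps N_def [symmetric] del: of_nat_Suc)
    also have "\<dots> = \<delta> (A + a) + poly P z / poly Q z"
      using IH(7) by (simp add: derivation_add[OF \<delta>])
    finally have "poly p z / poly q z = \<delta> (A + a) + poly P z / poly Q z" .
    moreover have "A + a \<in> adjoin F {z}" unfolding A_def using in_extension[OF B den] IH(1) by blast
    ultimately show ?thesis using IH(2-6) by blast
  qed
qed

lemma hermite_reduction:
  assumes "g \<in> adjoin F {z}"
  obtains a P Q where "a \<in> adjoin F {z}" "P \<in> polys_over F" "Q \<in> polys_over F"
    "Polynomial.lead_coeff Q = 1" "coprime Q (pderiv Q)"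
    "P = 0 \<or> Polynomial.degree P < Polynomial.degree Q"
    "g = \<delta> a + poly P z / poly Q z"
proof -
  obtain p q where "p \<in> polys_over F" "q \<in> polys_over F" "q \<noteq> 0" "g = poly p z / poly q z"
    using reduced_fraction[OF assms] by metis
  then show thesis using hermite_reduction_fraction[of p q] that by blast
qed

end

section \<open>Residues\<close>

lemma monic_separable_splits:
  fixes Q :: "'a :: {alg_closed_field, field_char_0} poly"
  assumes "Polynomial.lead_coeff Q = 1" "\<And>\<alpha>. poly Q \<alpha> = 0 \<Longrightarrow> poly (pderiv Q) \<alpha> \<noteq> 0"
  shows "Q = (\<Prod>\<alpha> | poly Q \<alpha> = 0. [:- \<alpha>, 1:])"
  using assms
proof (induction "Polynomial.degree Q" arbitrary: Q rule: less_induct)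
  case less
  have "Q \<noteq> 0" using less.prems(1) by auto
  show ?case
  proof (cases "Polynomial.degree Q = 0")
    case True
    then obtain c where "Q = [:c:]" by (rule degree_eq_zeroE)
    then have "Q = 1" using less.prems(1) by (simp add: one_pCons)
    then show ?thesis by simp
  next
    case False
    then obtain \<alpha> where \<alpha>: "poly Q \<alpha> = 0" using alg_closed_imp_poly_has_root by blast
    then obtain R where R: "Q = [:- \<alpha>, 1:] * R" using poly_eq_0_iff_dvd by blast
    have "R \<noteq> 0" using R \<open>Q \<noteq> 0\<close> by auto
    have Q': "pderiv Q = R + [:- \<alpha>, 1:] * pderiv R"
      unfolding R pderiv_mult by (simp add: pderiv_pCons)
    have "Polynomial.lead_coeff R = 1"
      using less.prems(1) unfolding R Polynomial.lead_coeff_mult by simp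
    moreover have "Polynomial.degree R < Polynomial.degree Q"
      unfolding R using \<open>R \<noteq> 0\<close> by (subst degree_mult_eq) auto
    moreover have "poly (pderiv R) \<beta> \<noteq> 0" if "poly R \<beta> = 0" for \<beta>
      using less.prems(2)[of \<beta>] that unfolding Q' by (auto simp: R)
    ultimately have IH: "R = (\<Prod>\<alpha> | poly R \<alpha> = 0. [:- \<alpha>, 1:])" using less.hyps by blast
    have "poly R \<alpha> \<noteq> 0" using less.prems(2)[OF \<alpha>] unfolding Q' by simp
    moreover have "{\<beta>. poly Q \<beta> = 0} = insert \<alpha> {\<beta>. poly R \<beta> = 0}" unfolding R by auto
    moreover have "finite {\<beta>. poly R \<beta> = 0}" using poly_roots_finite[OF \<open>R \<noteq> 0\<close>] .
    ultimately have "(\<Prod>\<alpha> | poly Q \<alpha> = 0. [:- \<alpha>, 1:])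
        = [:- \<alpha>, 1:] * (\<Prod>\<alpha> | poly R \<alpha> = 0. [:- \<alpha>, 1:])" by simp
    then show ?thesis using IH R by argo
  qed
qed

lemma degree_prod_linear: "Polynomial.degree (\<Prod>\<alpha>\<in>S. [:- \<alpha>, 1 :: 'a :: field:]) = card S"
  by (subst degree_prod_eq_sum_degree) auto

text \<open>Partial fractions for simple poles, which is Lagrange interpolation of the numerator.\<close>

lemma simple_partial_fractions:
  fixes Q :: "'a :: {alg_closed_field, field_char_0} poly"
  assumes Q: "Polynomial.lead_coeff Q = 1" "\<And>\<alpha>. poly Q \<alpha> = 0 \<Longrightarrow> poly (pderiv Q) \<alpha> \<noteq> 0"
    and P: "P = 0 \<or> Polynomial.degree P < Polynomial.degree Q" and \<zeta>: "poly Q \<zeta> \<noteq> 0"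
  shows "poly P \<zeta> / poly Q \<zeta> =
    (\<Sum>\<alpha> | poly Q \<alpha> = 0. (poly P \<alpha> / poly (pderiv Q) \<alpha>) / (\<zeta> - \<alpha>))"
proof -
  define S where "S = {\<alpha>. poly Q \<alpha> = 0}"
  define R where "R \<alpha> = (\<Prod>\<beta>\<in>S - {\<alpha>}. [:- \<beta>, 1:])" for \<alpha> :: 'a
  have "Q \<noteq> 0" using Q(1) by auto
  then have fin: "finite S" unfolding S_def by (rule poly_roots_finite)
  have split: "Q = (\<Prod>\<alpha>\<in>S. [:- \<alpha>, 1:])" unfolding S_def using monic_separable_splits[OF Q] .
  have QR: "Q = [:- \<alpha>, 1:] * R \<alpha>" if "\<alpha> \<in> S" for \<alpha>
    unfolding R_def using split prod.remove[OF fin that] by metis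
  have R_self: "poly (R \<alpha>) \<alpha> = poly (pderiv Q) \<alpha>" if "\<alpha> \<in> S" for \<alpha>
    unfolding QR[OF that] pderiv_mult by (simp add: pderiv_pCons)
  have R_other: "poly (R \<alpha>) \<beta> = 0" if "\<alpha> \<in> S" "\<beta> \<in> S" "\<beta> \<noteq> \<alpha>" for \<alpha> \<beta>
    unfolding R_def poly_prod using fin that by (intro prod_zero) auto
  let ?L = "\<Sum>\<alpha>\<in>S. smult (poly P \<alpha> / poly (pderiv Q) \<alpha>) (R \<alpha>)"
  have degQ: "Polynomial.degree Q = card S" by (subst split) (rule degree_prod_linear)
  have "P = ?L"
  proof (cases "S = {}")
    case True
    then show ?thesis using P degQ by simp
  next
    case False
    then have pos: "card S > 0" using fin by (simp add: card_gt_0_iff)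
    show ?thesis
    proof (rule poly_eqI_degree[of S])
      fix \<beta> assume \<beta>: "\<beta> \<in> S"
      have "poly ?L \<beta> = (\<Sum>\<alpha>\<in>S. if \<alpha> = \<beta> then poly P \<beta> else 0)"
        unfolding poly_sum
        using R_self R_other \<beta> Q(2) by (intro sum.cong) (auto simp: S_def)
      then show "poly P \<beta> = poly ?L \<beta>" using fin \<beta> by simp
    next
      show "card S > Polynomial.degree P" using P degQ pos by auto
      have "Polynomial.degree ?L \<le> card S - 1"
      proof (rule degree_sum_le[OF fin])
        fix \<alpha> assume "\<alpha> \<in> S"
        then have "Polynomial.degree (R \<alpha>) = card S - 1"
          unfolding R_def degree_prod_linear using fin by simp
        then show "Polynomial.degree (smult (poly P \<alpha> / poly (pderiv Q) \<alpha>) (R \<alpha>)) \<le> card S - 1"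
          using degree_smult_le[of _ "R \<alpha>"] by metis
      qed
      then show "card S > Polynomial.degree ?L" using pos by linarith
    qed
  qed
  then have "poly P \<zeta> / poly Q \<zeta> = poly ?L \<zeta> / poly Q \<zeta>" by simp
  also have "\<dots> = (\<Sum>\<alpha>\<in>S. (poly P \<alpha> / poly (pderiv Q) \<alpha>) * poly (R \<alpha>) \<zeta> / poly Q \<zeta>)"
    by (simp add: poly_sum sum_divide_distrib)
  also have "\<dots> = (\<Sum>\<alpha>\<in>S. (poly P \<alpha> / poly (pderiv Q) \<alpha>) / (\<zeta> - \<alpha>))"
  proof (rule sum.cong[OF refl])
    fix \<alpha> assume "\<alpha> \<in> S"
    then have *: "poly Q \<zeta> = (\<zeta> - \<alpha>) * poly (R \<alpha>) \<zeta>" by (subst QR[of \<alpha>]) (auto simp: algebra_simps)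
    then have "poly (R \<alpha>) \<zeta> \<noteq> 0" "\<zeta> - \<alpha> \<noteq> 0" using \<zeta> by auto
    then show "(poly P \<alpha> / poly (pderiv Q) \<alpha>) * poly (R \<alpha>) \<zeta> / poly Q \<zeta>
        = (poly P \<alpha> / poly (pderiv Q) \<alpha>) / (\<zeta> - \<alpha>)" by (simp add: * )
  qed
  finally show ?thesis by (simp add: S_def)
qed

locale alg_closed_primitive_extension = primitive_extension F \<delta> z
  for F :: "'u :: {alg_closed_field, field_char_0} set" and \<delta> z
begin

text \<open>A derivative of a rational function has no simple poles: differentiation raises the order of
  a pole by one. Hence a sum of simple fractions is a derivative only if all residues vanish.\<close>

lemma simple_poles_not_exact:
  assumes S: "finite S" "S \<subseteq> F" and r: "\<And>\<alpha>. \<alpha> \<in> S \<Longrightarrow> r \<alpha> \<in> F"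
    and G: "G \<in> adjoin F {z}" "(\<Sum>\<alpha>\<in>S. r \<alpha> / (z - \<alpha>)) = \<delta> G"
    and "\<alpha> \<in> S"
  shows "r \<alpha> = 0"
proof -
  define Q where "Q = (\<Prod>\<alpha>\<in>S. [:- \<alpha>, 1:])"
  define R where "R \<alpha> = (\<Prod>\<beta>\<in>S - {\<alpha>}. [:- \<beta>, 1:])" for \<alpha> :: 'u
  define N where "N = (\<Sum>\<alpha>\<in>S. smult (r \<alpha>) (R \<alpha>))"
  have prodF: "(\<Prod>\<alpha>\<in>T. [:- \<alpha>, 1:]) \<in> polys_over F" if "T \<subseteq> F" for T
    using that by (induction T rule: infinite_finite_induct) (auto intro!: polys_mult)
  have Q: "Q \<in> polys_over F" unfolding Q_def using S(2) by (rule prodF)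
  have R: "R \<alpha> \<in> polys_over F" for \<alpha> unfolding R_def using S(2) by (intro prodF) auto
  have polys_sum: "sum f T \<in> polys_over F" if "\<And>\<alpha>. \<alpha> \<in> T \<Longrightarrow> f \<alpha> \<in> polys_over F" for f and T :: "'u set"
    using that by (induction T rule: infinite_finite_induct) auto
  have N: "N \<in> polys_over F" unfolding N_def by (intro polys_sum polys_smult R r)
  have "Q \<noteq> 0" unfolding Q_def using S(1) by (simp add: prod_zero_iff)
  then have Qz: "poly Q z \<noteq> 0" using Q by simp
  have QR: "Q = [:- \<alpha>, 1:] * R \<alpha>" if "\<alpha> \<in> S" for \<alpha>
    unfolding Q_def R_def using prod.remove[OF S(1) that] by metis
  have "(\<Sum>\<alpha>\<in>S. r \<alpha> / (z - \<alpha>)) = (\<Sum>\<alpha>\<in>S. r \<alpha> * poly (R \<alpha>) z / poly Q z)"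
  proof (rule sum.cong[OF refl])
    fix \<alpha> assume "\<alpha> \<in> S"
    then have *: "poly Q z = (z - \<alpha>) * poly (R \<alpha>) z" by (subst QR[of \<alpha>]) (auto simp: algebra_simps)
    then have "poly (R \<alpha>) z \<noteq> 0" "z - \<alpha> \<noteq> 0" using Qz by auto
    then show "r \<alpha> / (z - \<alpha>) = r \<alpha> * poly (R \<alpha>) z / poly Q z" by (simp add: * )
  qed
  also have "\<dots> = poly N z / poly Q z" by (simp add: N_def poly_sum sum_divide_distrib)
  finally have NQ: "poly N z / poly Q z = \<delta> G" using G(2) by simp
  obtain u v where uv: "u \<in> polys_over F" "v \<in> polys_over F" "v \<noteq> 0" "coprime u v"
    "G = poly u z / poly v z"
    by (rule reduced_fraction[OF G(1)]) (rule that)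
  define T where "T = pderiv u * v - u * pderiv v"
  have T: "T \<in> polys_over F" unfolding T_def using uv by blast
  have "poly v z \<noteq> 0" using uv by simp
  have "poly N z / poly Q z = poly T z / poly (v ^ 2) z"
    unfolding NQ uv(5) T_def by (rule \<delta>_fraction[OF uv(1-3)])
  then have "poly (N * v ^ 2 - Q * T) z = 0" using Qz \<open>poly v z \<noteq> 0\<close> by (simp add: field_simps)
  moreover have "N * v ^ 2 - Q * T \<in> polys_over F"
    by (intro polys_minus polys_mult polys_power N Q T uv)
  ultimately have "N * v ^ 2 - Q * T = 0" using eval_eq_0_iff by blast
  then have eq: "N * v ^ 2 = Q * T" by simp
  have ord_Q: "order \<beta> Q \<le> 1" for \<beta>
  proof (cases "\<beta> \<in> S")
    case True
    have "poly (R \<beta>) \<beta> \<noteq> 0"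
      unfolding R_def poly_prod using S(1) by (simp add: prod_zero_iff)
    then have "order \<beta> Q = order \<beta> [:- \<beta>, 1:]"
      using QR[OF True] \<open>Q \<noteq> 0\<close> by (simp add: Polynomial.order_mult order_0I del: mult_pCons_left)
    then show ?thesis using order_power_n_n[of \<beta> 1] by simp
  next
    case False
    then have "poly Q \<beta> \<noteq> 0" unfolding Q_def poly_prod using S(1) by (auto simp: prod_zero_iff)
    then show ?thesis by (simp add: order_0I)
  qed
  have "N = 0"
  proof (rule ccontr)
    assume "N \<noteq> 0"
    then have nz: "N * v ^ 2 \<noteq> 0" "Q * T \<noteq> 0" "T \<noteq> 0" using uv(3) eq by auto
    have "Polynomial.degree v = 0"
    proof (rule ccontr)
      assume dv: "Polynomial.degree v \<noteq> 0"
      then obtain \<beta> where \<beta>: "poly v \<beta> = 0" using alg_closed_imp_poly_has_root by blast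
      define n where "n = order \<beta> v"
      have "n \<ge> 1" using \<beta> uv(3) by (simp add: n_def order_root Suc_leI)
      have v': "pderiv v \<noteq> 0" using dv by (simp add: pderiv_eq_0_iff)
      have ord_v': "n = Suc (order \<beta> (pderiv v))"
        unfolding n_def using order_pderiv[OF uv(3) \<beta>] .
      \<comment> \<open>At a root of \<open>v\<close> of order \<open>n\<close>, the left-hand side of \<open>N * v ^ 2 = Q * T\<close> has order at least \<open>2 * n\<close>,
        whereas \<open>Q\<close> has order at most \<open>1\<close> and \<open>T\<close> has order exactly \<open>n - 1\<close>.\<close>
      have "order \<beta> (Q * T) = order \<beta> N + 2 * n"
        unfolding eq [symmetric] using nz(1) uv(3)
        by (simp add: Polynomial.order_mult power2_eq_square n_def)
      then have "n \<le> order \<beta> T"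
        using ord_Q[of \<beta>] Polynomial.order_mult[OF nz(2), of \<beta>] \<open>n \<ge> 1\<close> by linarith
      then have "[:- \<beta>, 1:] ^ n dvd T" by (simp add: order_divides)
      moreover have "[:- \<beta>, 1:] ^ n dvd pderiv u * v"
        by (intro dvd_mult) (simp add: n_def order_1)
      ultimately have "[:- \<beta>, 1:] ^ n dvd u * pderiv v"
        unfolding T_def by (metis dvd_diff diff_diff_eq2 add_diff_cancel_left')
      moreover have "poly u \<beta> \<noteq> 0"
      proof
        assume "poly u \<beta> = 0"
        then have "is_unit [:- \<beta>, 1:]"
          using \<beta> uv(4) by (meson coprime_common_divisor poly_eq_0_iff_dvd)
        then show False by (simp add: is_unit_iff_degree)
      qed
      moreover from this have "u * pderiv v \<noteq> 0" using v' by auto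
      ultimately have "n \<le> order \<beta> (pderiv v)"
        using Polynomial.order_mult[of u "pderiv v" \<beta>] by (simp add: order_divides order_0I)
      then show False using ord_v' by simp
    qed
    moreover from this have "pderiv v = 0" by (simp add: pderiv_eq_0_iff)
    ultimately have "Polynomial.degree N = Polynomial.degree Q + Polynomial.degree T"
      using arg_cong[OF eq, of Polynomial.degree] nz \<open>N \<noteq> 0\<close> \<open>Q \<noteq> 0\<close> uv(3)
      by (simp add: degree_mult_eq degree_power_eq)
    moreover have "Polynomial.degree Q = card S" unfolding Q_def by (rule degree_prod_linear)
    moreover have "Polynomial.degree N \<le> card S - 1" unfolding N_def
    proof (rule degree_sum_le[OF S(1)])
      fix \<alpha> assume "\<alpha> \<in> S"
      then have "Polynomial.degree (R \<alpha>) = card S - 1"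
        unfolding R_def degree_prod_linear using S(1) by simp
      then show "Polynomial.degree (smult (r \<alpha>) (R \<alpha>)) \<le> card S - 1"
        using degree_smult_le[of _ "R \<alpha>"] by metis
    qed
    moreover have "card S > 0" using \<open>\<alpha> \<in> S\<close> S(1) card_gt_0_iff by blast
    ultimately show False by linarith
  qed
  have "poly N \<alpha> = (\<Sum>\<beta>\<in>S. if \<beta> = \<alpha> then r \<alpha> * poly (R \<alpha>) \<alpha> else 0)"
    unfolding N_def poly_sum
  proof (rule sum.cong[OF refl])
    fix \<beta> assume "\<beta> \<in> S"
    have "poly (R \<beta>) \<alpha> = 0" if "\<beta> \<noteq> \<alpha>"
      unfolding R_def poly_prod using S(1) \<open>\<alpha> \<in> S\<close> that by (intro prod_zero) auto
    then show "poly (smult (r \<beta>) (R \<beta>)) \<alpha> = (if \<beta> = \<alpha> then r \<alpha> * poly (R \<alpha>) \<alpha> else 0)" by auto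
  qed
  then have "r \<alpha> * poly (R \<alpha>) \<alpha> = 0" using \<open>N = 0\<close> \<open>\<alpha> \<in> S\<close> S(1) by simp
  moreover have "poly (R \<alpha>) \<alpha> \<noteq> 0"
    unfolding R_def poly_prod using S(1) by (simp add: prod_zero_iff)
  ultimately show ?thesis by simp
qed

end

lemma derivation_maps_adjoin:
  assumes e: "derivation_on UNIV e" and gens: "\<And>c. c \<in> k \<union> S \<Longrightarrow> e c \<in> adjoin k S"
    and a: "a \<in> adjoin k S"
  shows "e a \<in> adjoin k (S :: 'u :: field set)"
proof -
  interpret A: ambient_subfield "adjoin k S" by (rule ambient_subfield.intro) (rule subfield_adjoin)
  have "subfield {a \<in> adjoin k S. e a \<in> adjoin k S} ambient"
  proof (rule subfield_ambientI)
    fix a assume "a \<in> {a \<in> adjoin k S. e a \<in> adjoin k S}"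
    then show "inverse a \<in> {a \<in> adjoin k S. e a \<in> adjoin k S}"
      by (simp add: derivation_inverse[OF e] A.divide A.uminus A.power A.inverse)
  qed (auto simp: derivation_add[OF e] derivation_uminus[OF e] derivation_mult[OF e] derivation_1[OF e])
  then have "adjoin k S \<subseteq> {a \<in> adjoin k S. e a \<in> adjoin k S}"
    using gens base_subset_adjoin[of k S] gens_subset_adjoin[of S k]
    by (intro adjoin_least) auto
  then show ?thesis using a by blast
qed

lemma derivation_zero_on_adjoin:
  assumes e: "derivation_on UNIV e" and gens: "\<And>c. c \<in> k \<union> S \<Longrightarrow> e c = 0" and a: "a \<in> adjoin k S"
  shows "e a = (0 :: 'u :: field)"
proof -
  have "adjoin k S \<subseteq> {a. e a = 0}"
    using gens by (intro adjoin_least subfield_constants[OF e]) auto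
  then show ?thesis using a by blast
qed

context alg_closed_primitive_extension
begin

text \<open>By the integrability condition, \<open>e g\<close> is a derivative; up to derivatives, it is also the sum of simple
  fractions whose numerators are the images of the residues under \<open>e\<close>. So these images vanish. Poles with the
  same residue \<open>c\<close> are collected in one polynomial, the greatest common divisor of \<open>Q\<close> and \<open>P - c * Q'\<close>
  (Rothstein and Trager); its coefficients lie in \<open>F(c)\<close> by the Euclidean algorithm.\<close>

lemma residue_decomposition:
  assumes \<Delta>: "\<And>e. e \<in> \<Delta> \<Longrightarrow> derivation_on UNIV e" "\<And>e. e \<in> \<Delta> \<Longrightarrow> e z = 0"
      "\<And>e c. e \<in> \<Delta> \<Longrightarrow> c \<in> F \<Longrightarrow> e c \<in> F" "\<And>e a. e \<in> \<Delta> \<Longrightarrow> e (\<delta> a) = \<delta> (e a)"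
    and g: "g \<in> adjoin F {z}" "\<And>e. e \<in> \<Delta> \<Longrightarrow> \<exists>h\<in>adjoin F {z}. e g = \<delta> h"
  obtains a T b where "a \<in> adjoin F {z}" "finite T"
    "\<And>c. c \<in> T \<Longrightarrow> c \<in> algebraic_closure_in_ambient F" "\<And>c e. c \<in> T \<Longrightarrow> e \<in> \<Delta> \<Longrightarrow> e c = 0"
    "\<And>c. c \<in> T \<Longrightarrow> b c \<in> polys_over (adjoin F {c})" "\<And>c. c \<in> T \<Longrightarrow> Polynomial.lead_coeff (b c) = 1"
    "\<And>c. c \<in> T \<Longrightarrow> Polynomial.degree (b c) > 0" "\<And>c. c \<in> T \<Longrightarrow> poly (b c) z \<noteq> 0"
    "g = \<delta> a + (\<Sum>c\<in>T. c * (\<delta> (poly (b c) z) / poly (b c) z))"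
    "\<And>e. e \<in> \<Delta> \<Longrightarrow> (\<Sum>c\<in>T. c * (e (poly (b c) z) / poly (b c) z)) \<in> adjoin F {z}"
proof -
  obtain a P Q where aPQ: "a \<in> adjoin F {z}" "P \<in> polys_over F" "Q \<in> polys_over F"
    "Polynomial.lead_coeff Q = 1" "coprime Q (pderiv Q)"
    "P = 0 \<or> Polynomial.degree P < Polynomial.degree Q"
    "g = \<delta> a + poly P z / poly Q z"
    by (rule hermite_reduction[OF g(1)]) (rule that)
  have "Q \<noteq> 0" using aPQ(4) by auto
  then have Qz: "poly Q z \<noteq> 0" using aPQ(3) by simp
  have sep: "poly (pderiv Q) \<alpha> \<noteq> 0" if "poly Q \<alpha> = 0" for \<alpha>
  proof
    assume "poly (pderiv Q) \<alpha> = 0"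
    then have "is_unit [:- \<alpha>, 1:]"
      using that aPQ(5) by (meson coprime_common_divisor poly_eq_0_iff_dvd)
    then show False by (simp add: is_unit_iff_degree)
  qed
  define S where "S = {\<alpha>. poly Q \<alpha> = 0}"
  define \<rho> where "\<rho> \<alpha> = poly P \<alpha> / poly (pderiv Q) \<alpha>" for \<alpha>
  define T where "T = \<rho> ` S"
  have fin: "finite S" unfolding S_def using \<open>Q \<noteq> 0\<close> by (rule poly_roots_finite)
  have simple: "poly W z / poly Q z = (\<Sum>\<alpha>\<in>S. (poly W \<alpha> / poly (pderiv Q) \<alpha>) / (z - \<alpha>))"
    if "W = 0 \<or> Polynomial.degree W < Polynomial.degree Q" for W
    unfolding S_def by (rule simple_partial_fractions[OF aPQ(4) sep that Qz])
  interpret Alg: ambient_subfield "algebraic_closure_in_ambient F"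
    by (rule ambient_subfield.intro) (rule subfield_algebraic_closure[OF subfield])
  have F_Alg: "p \<in> polys_over (algebraic_closure_in_ambient F)" if "p \<in> polys_over F" for p
    using that algebraic_base by (auto simp: polys_over_def)
  have S_alg: "\<alpha> \<in> algebraic_closure_in_ambient F" if "\<alpha> \<in> S" for \<alpha>
    using that aPQ(3) \<open>Q \<noteq> 0\<close> by (auto simp: S_def algebraic_closure_in_ambient_def)
  have \<rho>_alg: "\<rho> \<alpha> \<in> algebraic_closure_in_ambient F" if "\<alpha> \<in> S" for \<alpha>
    unfolding \<rho>_def using S_alg[OF that] aPQ(2,3)
    by (intro Alg.divide Alg.poly_in F_Alg polys_pderiv)
  have const: "\<delta> c = 0" if "c \<in> algebraic_closure_in_ambient F" for c
    by (rule derivation_zero_on_algebraic[OF \<delta> \<delta>_F that])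
  have z\<alpha>: "z - \<alpha> \<noteq> 0" if "\<alpha> \<in> S" for \<alpha>
    using Qz that by (auto simp: S_def)

  \<comment> \<open>The poles need not lie in \<open>F\<close>, but they are constants of \<open>\<delta>\<close>, and \<open>z\<close> is transcendental over those.\<close>
  define C where "C = {a. \<delta> a = 0}"
  interpret PC: alg_closed_primitive_extension C \<delta> z
    by (intro alg_closed_primitive_extension.intro primitive_extension.intro char0_subfield.intro
        ambient_subfield.intro primitive_extension_axioms.intro)
      (use subfield_constants[OF \<delta>] \<delta> \<delta>_z in \<open>simp_all add: C_def\<close>)
  interpret EC: ambient_subfield "adjoin C {z}" by (rule ambient_subfield.intro) (rule subfield_adjoin)
  interpret E: ambient_subfield "adjoin F {z}" by (rule ambient_subfield.intro) (rule subfield_adjoin)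
  have E_EC: "a \<in> adjoin C {z}" if "a \<in> adjoin F {z}" for a
  proof -
    have "adjoin F {z} \<subseteq> adjoin C {z}"
      using base_subset_adjoin[of C "{z}"] gens_subset_adjoin[of "{z}" C] \<delta>_F
      by (intro adjoin_least subfield_adjoin) (auto simp: C_def)
    then show ?thesis using that by blast
  qed

  have residue_const: "e (\<rho> \<alpha>) = 0" if e: "e \<in> \<Delta>" and \<alpha>: "\<alpha> \<in> S" for e \<alpha>
  proof -
    note de = \<Delta>(1)[OF e]
    obtain h where h: "h \<in> adjoin F {z}" "e g = \<delta> h" using g(2)[OF e] by blast
    have e_const: "e c \<in> C" if "c \<in> C" for c
      using that \<Delta>(4)[OF e, of c] derivation_0[OF de] by (simp add: C_def)
    have ea: "e a \<in> adjoin F {z}"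
    proof (rule derivation_maps_adjoin[OF de _ aPQ(1)])
      fix c assume "c \<in> F \<union> {z}"
      then show "e c \<in> adjoin F {z}" using \<Delta>(2,3)[OF e] base_subset_adjoin[of F "{z}"] by auto
    qed
    define G where "G = (\<Sum>\<beta>\<in>S. \<rho> \<beta> * e \<beta> / (z - \<beta>))"
    have summand: "e (\<rho> \<beta> / (z - \<beta>)) = e (\<rho> \<beta>) / (z - \<beta>) - \<delta> (\<rho> \<beta> * e \<beta> / (z - \<beta>))"
      if "\<beta> \<in> S" for \<beta>
    proof -
      have d0: "\<delta> \<beta> = 0" "\<delta> (\<rho> \<beta>) = 0" using const S_alg \<rho>_alg that by auto
      then have "\<delta> (e \<beta>) = 0" using e_const by (simp add: C_def)
      then have "\<delta> (\<rho> \<beta> * e \<beta>) = 0" using d0 by (simp add: derivation_mult[OF \<delta>])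
      then have "\<delta> (\<rho> \<beta> * e \<beta> / (z - \<beta>)) = - (\<rho> \<beta> * e \<beta>) / (z - \<beta>)\<^sup>2"
        using z\<alpha>[OF that] d0 \<delta>_z by (simp add: derivation_divide[OF \<delta>] derivation_minus[OF \<delta>])
      moreover have "e (\<rho> \<beta> / (z - \<beta>)) = (e (\<rho> \<beta>) * (z - \<beta>) + \<rho> \<beta> * e \<beta>) / (z - \<beta>)\<^sup>2"
        using z\<alpha>[OF that] \<Delta>(2)[OF e] by (simp add: derivation_divide[OF de] derivation_minus[OF de])
      moreover have "(e (\<rho> \<beta>) * (z - \<beta>) + \<rho> \<beta> * e \<beta>) / (z - \<beta>)\<^sup>2
          = e (\<rho> \<beta>) / (z - \<beta>) - - (\<rho> \<beta> * e \<beta>) / (z - \<beta>)\<^sup>2"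
        using z\<alpha>[OF that] by (simp add: add_divide_distrib power2_eq_square)
      ultimately show ?thesis by simp
    qed
    have "e g = e (\<delta> a) + (\<Sum>\<beta>\<in>S. e (\<rho> \<beta> / (z - \<beta>)))"
      unfolding aPQ(7) simple[OF aPQ(6)] \<rho>_def [symmetric]
      by (simp add: derivation_add[OF de] derivation_sum[OF de])
    also have "\<dots> = \<delta> (e a) + ((\<Sum>\<beta>\<in>S. e (\<rho> \<beta>) / (z - \<beta>)) - \<delta> G)"
      using summand by (simp add: \<Delta>(4)[OF e] sum_subtractf G_def derivation_sum[OF \<delta>])
    finally have eq: "(\<Sum>\<beta>\<in>S. e (\<rho> \<beta>) / (z - \<beta>)) = \<delta> (h - e a + G)"
      using h(2) by (simp add: derivation_add[OF \<delta>] derivation_minus[OF \<delta>])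
    have SC: "\<beta> \<in> C" "\<rho> \<beta> \<in> C" if "\<beta> \<in> S" for \<beta>
      using const S_alg[OF that] \<rho>_alg[OF that] by (simp_all add: C_def)
    have CE: "c \<in> adjoin C {z}" if "c \<in> C" for c using that base_subset_adjoin[of C "{z}"] by blast
    have zE: "z \<in> adjoin C {z}" using gens_subset_adjoin[of "{z}" C] by blast
    have "\<rho> \<beta> * e \<beta> / (z - \<beta>) \<in> adjoin C {z}" if "\<beta> \<in> S" for \<beta>
      using CE[OF SC(1)[OF that]] CE[OF SC(2)[OF that]] CE[OF e_const[OF SC(1)[OF that]]] zE
      by (intro EC.divide EC.mult EC.minus)
    then have "G \<in> adjoin C {z}" unfolding G_def by (rule EC.sum)
    then have "h - e a + G \<in> adjoin C {z}" using E_EC[OF h(1)] E_EC[OF ea] by blast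
    then show ?thesis
      using PC.simple_poles_not_exact[OF fin _ _ _ eq \<alpha>] SC e_const by blast
  qed

  have "\<exists>b. b \<in> polys_over (adjoin F {c}) \<and> Polynomial.lead_coeff b = 1 \<and>
      b dvd Q \<and> {\<alpha>. poly b \<alpha> = 0} = {\<alpha> \<in> S. \<rho> \<alpha> = c}" if "c \<in> T" for c
  proof -
    interpret Fc: ambient_subfield "adjoin F {c}" by (rule ambient_subfield.intro) (rule subfield_adjoin)
    have sub: "p \<in> polys_over (adjoin F {c})" if "p \<in> polys_over F" for p
      using that base_subset_adjoin[of F "{c}"] by (auto simp: polys_over_def)
    have c: "c \<in> adjoin F {c}" using gens_subset_adjoin[of "{c}" F] by blast
    let ?R = "P - smult c (pderiv Q)"
    have R: "?R \<in> polys_over (adjoin F {c})"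
      by (intro Fc.polys_minus Fc.polys_smult sub c aPQ polys_pderiv)
    obtain b u v where b: "b \<in> polys_over (adjoin F {c})" "u \<in> polys_over (adjoin F {c})"
      "v \<in> polys_over (adjoin F {c})" "Polynomial.lead_coeff b = 1" "b dvd Q" "b dvd ?R"
      "b = u * Q + v * ?R"
      by (rule Fc.monic_gcd_in_subfield[OF sub[OF aPQ(3)] R \<open>Q \<noteq> 0\<close>]) (rule that)
    have "poly b \<alpha> = 0 \<longleftrightarrow> \<alpha> \<in> S \<and> \<rho> \<alpha> = c" for \<alpha>
    proof
      assume "poly b \<alpha> = 0"
      then have "poly Q \<alpha> = 0" "poly ?R \<alpha> = 0" using b(5,6) by (meson poly_eq_0_iff_dvd dvd_trans)+
      then show "\<alpha> \<in> S \<and> \<rho> \<alpha> = c" using sep[of \<alpha>] by (simp add: S_def \<rho>_def)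
    next
      assume \<alpha>: "\<alpha> \<in> S \<and> \<rho> \<alpha> = c"
      then have "poly Q \<alpha> = 0" "poly ?R \<alpha> = 0" using sep[of \<alpha>] by (auto simp: S_def \<rho>_def)
      then show "poly b \<alpha> = 0" by (subst b(7)) simp
    qed
    then show ?thesis using b(1,4,5) by blast
  qed
  then have "\<forall>c\<in>T. \<exists>b. b \<in> polys_over (adjoin F {c}) \<and> Polynomial.lead_coeff b = 1 \<and>
      b dvd Q \<and> {\<alpha>. poly b \<alpha> = 0} = {\<alpha> \<in> S. \<rho> \<alpha> = c}" by (rule ballI)
  from bchoice[OF this] obtain b where "\<forall>c\<in>T. b c \<in> polys_over (adjoin F {c}) \<and>
      Polynomial.lead_coeff (b c) = 1 \<and> b c dvd Q \<and> {\<alpha>. poly (b c) \<alpha> = 0} = {\<alpha> \<in> S. \<rho> \<alpha> = c}" ..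
  then have b: "\<And>c. c \<in> T \<Longrightarrow> b c \<in> polys_over (adjoin F {c})"
    "\<And>c. c \<in> T \<Longrightarrow> Polynomial.lead_coeff (b c) = 1" "\<And>c. c \<in> T \<Longrightarrow> b c dvd Q"
    "\<And>c. c \<in> T \<Longrightarrow> {\<alpha>. poly (b c) \<alpha> = 0} = {\<alpha> \<in> S. \<rho> \<alpha> = c}"
    by simp_all
  have b_split: "b c = (\<Prod>\<alpha> | \<alpha> \<in> S \<and> \<rho> \<alpha> = c. [:- \<alpha>, 1:])" if c: "c \<in> T" for c
  proof -
    have "poly (pderiv (b c)) \<alpha> \<noteq> 0" if "poly (b c) \<alpha> = 0" for \<alpha>
    proof
      assume *: "poly (pderiv (b c)) \<alpha> = 0"
      obtain w where w: "Q = b c * w" using b(3)[OF c] by blast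
      have "poly Q \<alpha> = 0" "poly (pderiv Q) \<alpha> = 0" using that * by (simp_all add: w pderiv_mult)
      then show False using sep by blast
    qed
    then show ?thesis using monic_separable_splits[OF b(2)[OF c]] b(4)[OF c] by simp
  qed
  have b_eval: "poly (b c) z = (\<Prod>\<alpha> | \<alpha> \<in> S \<and> \<rho> \<alpha> = c. z - \<alpha>)" if "c \<in> T" for c
    using b_split[OF that] by (simp add: poly_prod)
  have fin': "finite {\<alpha>. \<alpha> \<in> S \<and> \<rho> \<alpha> = c}" for c using fin by simp
  have b_nz: "poly (b c) z \<noteq> 0" if "c \<in> T" for c
    unfolding b_eval[OF that] using fin' z\<alpha> by (simp add: prod_zero_iff)
  have log_sum: "(\<Sum>c\<in>T. c * (e (poly (b c) z) / poly (b c) z))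
      = (\<Sum>\<alpha>\<in>S. \<rho> \<alpha> * (e (z - \<alpha>) / (z - \<alpha>)))" if e: "derivation_on UNIV e" for e
  proof -
    have "(\<Sum>\<alpha>\<in>S. \<rho> \<alpha> * (e (z - \<alpha>) / (z - \<alpha>)))
        = (\<Sum>c\<in>T. \<Sum>\<alpha> | \<alpha> \<in> S \<and> \<rho> \<alpha> = c. \<rho> \<alpha> * (e (z - \<alpha>) / (z - \<alpha>)))"
      unfolding T_def by (rule sum.image_gen[OF fin])
    also have "\<dots> = (\<Sum>c\<in>T. c * (e (poly (b c) z) / poly (b c) z))"
    proof (rule sum.cong[OF refl])
      fix c assume c: "c \<in> T"
      have "(\<Sum>\<alpha> | \<alpha> \<in> S \<and> \<rho> \<alpha> = c. \<rho> \<alpha> * (e (z - \<alpha>) / (z - \<alpha>)))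
          = c * (\<Sum>\<alpha> | \<alpha> \<in> S \<and> \<rho> \<alpha> = c. e (z - \<alpha>) / (z - \<alpha>))"
        by (simp add: sum_distrib_left)
      also have "\<dots> = c * (e (poly (b c) z) / poly (b c) z)"
        unfolding b_eval[OF c] using z\<alpha> by (subst log_derivative_prod[OF e fin']) auto
      finally show "(\<Sum>\<alpha> | \<alpha> \<in> S \<and> \<rho> \<alpha> = c. \<rho> \<alpha> * (e (z - \<alpha>) / (z - \<alpha>)))
          = c * (e (poly (b c) z) / poly (b c) z)" .
    qed
    finally show ?thesis by simp
  qed

  have "(\<Sum>\<alpha>\<in>S. \<rho> \<alpha> * (\<delta> (z - \<alpha>) / (z - \<alpha>))) = poly P z / poly Q z"
    unfolding simple[OF aPQ(6)] \<rho>_def [symmetric]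
    using const S_alg by (intro sum.cong) (simp_all add: derivation_minus[OF \<delta>] \<delta>_z)
  then have g_eq: "g = \<delta> a + (\<Sum>c\<in>T. c * (\<delta> (poly (b c) z) / poly (b c) z))"
    using aPQ(7) log_sum[OF \<delta>] by simp

  obtain u V where uV: "u \<in> polys_over F" "V \<in> polys_over F" "u * Q + V * pderiv Q = 1"
    by (rule coprime_bezout_in_subfield[OF aPQ(3) polys_pderiv[OF aPQ(3)] \<open>Q \<noteq> 0\<close> aPQ(5)]) (rule that)
  have "(\<Sum>c\<in>T. c * (e (poly (b c) z) / poly (b c) z)) \<in> adjoin F {z}" if e: "e \<in> \<Delta>" for e
  proof -
    note de = \<Delta>(1)[OF e]
    have UN: "ambient_subfield (UNIV :: 'u set)"
      by (intro ambient_subfield.intro subfield_ambientI) auto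
    \<comment> \<open>Differentiating \<open>Q(\<alpha>) = 0\<close> expresses \<open>e \<alpha>\<close> by \<open>\<alpha>\<close>, so the residues of the sum are the values
      at the poles of one polynomial over \<open>F\<close>, and partial fractions can be read backwards.\<close>
    define W where "W = (P * V * map_poly e Q) mod Q"
    have W: "W \<in> polys_over F"
      unfolding W_def
      by (intro polys_mod polys_mult polys_map aPQ uV derivation_0[OF de] \<Delta>(3)[OF e])
    have deg_W: "W = 0 \<or> Polynomial.degree W < Polynomial.degree Q"
      unfolding W_def using \<open>Q \<noteq> 0\<close> by (rule degree_mod_less)
    have "poly W \<alpha> / poly (pderiv Q) \<alpha> / (z - \<alpha>) = \<rho> \<alpha> * (e (z - \<alpha>) / (z - \<alpha>))"
      if \<alpha>: "\<alpha> \<in> S" for \<alpha>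
    proof -
      have Q\<alpha>: "poly Q \<alpha> = 0" using \<alpha> by (simp add: S_def)
      have "poly V \<alpha> * poly (pderiv Q) \<alpha> = 1"
        using arg_cong[OF uV(3), of "\<lambda>p. poly p \<alpha>"] Q\<alpha> by simp
      then have V: "poly V \<alpha> = 1 / poly (pderiv Q) \<alpha>" using sep[OF Q\<alpha>] by (simp add: eq_divide_eq)
      have "poly (map_poly e Q) \<alpha> + poly (pderiv Q) \<alpha> * e \<alpha> = 0"
        using ambient_subfield.derivation_on_poly[OF UN de, of Q \<alpha>] Q\<alpha> derivation_0[OF de]
        by (simp add: polys_over_def)
      then have "poly (map_poly e Q) \<alpha> = poly (pderiv Q) \<alpha> * (- e \<alpha>)"
        by (simp add: eq_neg_iff_add_eq_0)
      then have "poly W \<alpha> = poly P \<alpha> * (- e \<alpha>)"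
        unfolding W_def poly_mod[OF Q\<alpha>] using V sep[OF Q\<alpha>] by simp
      then show ?thesis
        by (simp add: \<rho>_def derivation_minus[OF de] \<Delta>(2)[OF e])
    qed
    then have "(\<Sum>c\<in>T. c * (e (poly (b c) z) / poly (b c) z)) = poly W z / poly Q z"
      unfolding log_sum[OF de] simple[OF deg_W] by simp
    then show ?thesis using in_extension[OF W aPQ(3)] by simp
  qed
  moreover have "Polynomial.degree (b c) > 0" if "c \<in> T" for c
  proof -
    obtain \<alpha> where \<alpha>: "\<alpha> \<in> S" "\<rho> \<alpha> = c" using \<open>c \<in> T\<close> by (auto simp: T_def)
    then have "poly (b c) \<alpha> = 0" using b(4)[OF that] by blast
    moreover have "b c \<noteq> 0" using b(2)[OF that] by auto
    ultimately show ?thesis by (metis degree_0_id gr0I pCons_0_0 poly_const_conv)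
  qed
  moreover have "finite T" unfolding T_def using fin by simp
  moreover have "c \<in> algebraic_closure_in_ambient F" "e \<in> \<Delta> \<Longrightarrow> e c = 0" if "c \<in> T" for c e
    using that \<rho>_alg residue_const by (auto simp: T_def)
  ultimately show thesis using that[OF aPQ(1), of T b] b(1,2) b_nz g_eq by blast
qed

end

section \<open>Integration of closed forms, one variable at a time\<close>

lemma log_derivatives_commute:
  fixes b :: "'u :: field"
  assumes d: "derivation_on UNIV d" and e: "derivation_on UNIV e" and "d (e b) = e (d b)"
    and "d c = 0" "e c = 0" and "b \<noteq> 0"
  shows "d (c * (e b / b)) = e (c * (d b / b))"
proof -
  have "d (c * (e b / b)) = c * ((d (e b) * b - e b * d b) / b\<^sup>2)"
    unfolding derivation_mult[OF d] derivation_divide[OF d \<open>b \<noteq> 0\<close>] using assms(4) by simp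
  moreover have "e (c * (d b / b)) = c * ((e (d b) * b - d b * e b) / b\<^sup>2)"
    unfolding derivation_mult[OF e] derivation_divide[OF e \<open>b \<noteq> 0\<close>] using assms(5) by simp
  ultimately show ?thesis using assms(3) by (simp add: mult.commute)
qed

locale coordinate_derivations =
  fixes k :: "'u :: {alg_closed_field, field_char_0} set"
    and m :: nat and x :: "nat \<Rightarrow> 'u" and D :: "nat \<Rightarrow> 'u \<Rightarrow> 'u"
  assumes k: "subfield k ambient"
    and D: "\<And>i. i \<in> {1..m} \<Longrightarrow> derivation_on UNIV (D i)"
    and comm: "\<And>i j a. i \<in> {1..m} \<Longrightarrow> j \<in> {1..m} \<Longrightarrow> D i (D j a) = D j (D i a)"
    and D_k: "\<And>i a. i \<in> {1..m} \<Longrightarrow> a \<in> k \<Longrightarrow> D i a = 0"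
    and D_x: "\<And>i j. i \<in> {1..m} \<Longrightarrow> j \<in> {1..m} \<Longrightarrow> D i (x j) = (if i = j then 1 else 0)"
begin

definition K :: "nat \<Rightarrow> 'u set" where "K r = adjoin k (x ` {1..r})"

lemma subfield_K: "subfield (K r) ambient"
  unfolding K_def by (rule subfield_adjoin)

lemma K_0: "K 0 = k"
  unfolding K_def using adjoin_empty[OF k] by simp

lemma K_Suc: "K (Suc r) = adjoin (K r) {x (Suc r)}"
proof -
  have "x ` {1..Suc r} = x ` {1..r} \<union> {x (Suc r)}" by (auto simp: atLeastAtMostSuc_conv)
  then show ?thesis unfolding K_def adjoin_adjoin by simp
qed

lemma K_mono: "r \<le> s \<Longrightarrow> K r \<subseteq> K s"
  unfolding K_def by (intro adjoin_mono image_mono) auto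

lemma D_K:
  assumes i: "i \<in> {1..m}" and a: "a \<in> K m"
  shows "D i a \<in> K m"
proof -
  interpret K: ambient_subfield "K m" by (rule ambient_subfield.intro) (rule subfield_K)
  show ?thesis using a unfolding K_def
  proof (rule derivation_maps_adjoin[OF D[OF i], rotated])
    fix c assume "c \<in> k \<union> x ` {1..m}"
    then have "D i c = 0 \<or> D i c = 1"
    proof
      assume "c \<in> k" then show ?thesis using D_k[OF i] by blast
    next
      assume "c \<in> x ` {1..m}"
      then obtain j where "c = x j" "j \<in> {1..m}" by blast
      then show ?thesis using D_x[OF i, of j] by (cases "i = j") simp_all
    qed
    then show "D i c \<in> adjoin k (x ` {1..m})"
      using K.zero K.one unfolding K_def by (elim disjE) simp_all
  qed
qed

lemma fewer_variables:
  assumes "r \<le> m" shows "coordinate_derivations k r x D"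
proof (rule coordinate_derivations.intro)
  have le: "i \<in> {1..m}" if "i \<in> {1..r}" for i using that assms by simp
  show "subfield k ambient" by (rule k)
  fix i assume i: "i \<in> {1..r}"
  show "derivation_on UNIV (D i)" by (rule D[OF le[OF i]])
  show "D i a = 0" if "a \<in> k" for a by (rule D_k[OF le[OF i] that])
  fix j assume j: "j \<in> {1..r}"
  show "D i (D j a) = D j (D i a)" for a by (rule comm[OF le[OF i] le[OF j]])
  show "D i (x j) = (if i = j then 1 else 0)" by (rule D_x[OF le[OF i] le[OF j]])
qed

lemma D_K_zero: "r < i \<Longrightarrow> i \<le> m \<Longrightarrow> a \<in> K r \<Longrightarrow> D i a = 0"
  unfolding K_def
  by (rule derivation_zero_on_adjoin[OF D]) (auto simp: D_k D_x)

lemma extension_step: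
  assumes "Suc r \<le> m"
  shows "alg_closed_primitive_extension (K r) (D (Suc r)) (x (Suc r))"
  by (intro alg_closed_primitive_extension.intro primitive_extension.intro char0_subfield.intro
        ambient_subfield.intro primitive_extension_axioms.intro)
     (use assms subfield_K D D_x D_K_zero[of r "Suc r"] in simp_all)

lemma constants_of_K:
  assumes "a \<in> K m" "\<And>i. i \<in> {1..m} \<Longrightarrow> D i a = 0"
  shows "a \<in> k"
proof -
  have "r \<le> m \<Longrightarrow> a \<in> K r \<Longrightarrow> (\<And>i. i \<in> {1..r} \<Longrightarrow> D i a = 0) \<Longrightarrow> a \<in> k" for r
  proof (induction r)
    case (Suc r)
    interpret P: alg_closed_primitive_extension "K r" "D (Suc r)" "x (Suc r)"
      using Suc.prems by (intro extension_step)
    have "a \<in> K r" using P.constant_in_extension[of a] Suc.prems by (simp add: K_Suc)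
    then show ?case using Suc by simp
  qed (simp add: K_0)
  then show ?thesis using assms by blast
qed

lemma D_algebraic_zero:
  assumes i: "i \<in> {1..m}" and c: "c \<in> algebraic_closure_in_ambient k"
  shows "D i c = 0"
proof -
  interpret k: char0_subfield k by (intro char0_subfield.intro ambient_subfield.intro k)
  show ?thesis by (rule k.derivation_zero_on_algebraic[OF D[OF i] D_k[OF i] c])
qed

end

text \<open>Subtracting the differential of \<open>a + \<Sum> c * log b\<close> found by integrating in direction \<open>x\<^sub>r\<close> leaves
  a closed form without \<open>dx\<^sub>r\<close>; by closedness its coefficients do not depend on \<open>x\<^sub>r\<close> either.\<close>

lemma closed_form_decomposition:
  fixes k :: "'u :: {alg_closed_field, field_char_0} set"
  assumes "coordinate_derivations k m x D"
    and "\<And>i. i \<in> {1..m} \<Longrightarrow> f i \<in> adjoin k (x ` {1..m})" and "closed_form m D f"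
  shows "\<exists>a (n :: nat \<Rightarrow> nat) c p. a \<in> adjoin k (x ` {1..m}) \<and>
    (\<forall>i\<in>{1..m}. \<forall>j<n i. c i j \<in> algebraic_closure_in_ambient k \<and>
      p i j \<in> polys_over (adjoin (adjoin k (x ` {1..<i})) {c i j}) \<and>
      Polynomial.lead_coeff (p i j) = 1 \<and> Polynomial.degree (p i j) > 0 \<and> poly (p i j) (x i) \<noteq> 0) \<and>
    (\<forall>v\<in>{1..m}. f v = D v a +
      (\<Sum>i=1..m. \<Sum>j<n i. c i j * (D v (poly (p i j) (x i)) / poly (p i j) (x i))))"
  using assms
proof (induction m arbitrary: f)
  case 0
  interpret coordinate_derivations k 0 x D by fact
  have "0 \<in> adjoin k (x ` {1..0})"
    using ambient_subfield.zero[OF ambient_subfield.intro[OF subfield_adjoin]] .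
  then show ?case by auto
next
  case (Suc r)
  interpret coordinate_derivations k "Suc r" x D by fact
  interpret R: coordinate_derivations k r x D by (rule fewer_variables) simp
  define \<delta> where "\<delta> = D (Suc r)"
  define z where "z = x (Suc r)"
  interpret P: alg_closed_primitive_extension "K r" \<delta> z
    unfolding \<delta>_def z_def by (rule extension_step) simp
  interpret KS: ambient_subfield "K (Suc r)" by (rule ambient_subfield.intro) (rule subfield_K)
  have Kz: "adjoin (K r) {z} = K (Suc r)" by (simp add: K_Suc z_def)
  have f: "f i \<in> K (Suc r)" if "i \<in> {1..Suc r}" for i using Suc.prems(2)[OF that] by (simp add: K_def)
  have closed: "D i (f j) = D j (f i)" if "i \<in> {1..Suc r}" "j \<in> {1..Suc r}" for i j
    using Suc.prems(3) that unfolding closed_form_def by blast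
  have \<Delta>: "derivation_on UNIV e" "e z = 0" "\<And>c. c \<in> K r \<Longrightarrow> e c \<in> K r" "\<And>a. e (\<delta> a) = \<delta> (e a)"
    "\<exists>h\<in>adjoin (K r) {z}. e (f (Suc r)) = \<delta> h" if e: "e \<in> D ` {1..r}" for e
  proof -
    obtain i where i: "e = D i" "i \<in> {1..r}" using e by blast
    then have iS: "i \<in> {1..Suc r}" and S: "Suc r \<in> {1..Suc r}" by simp_all
    show "derivation_on UNIV e" using D[OF iS] i(1) by simp
    show "e z = 0" using D_x[OF iS S] i by (simp add: z_def)
    show "e c \<in> K r" if "c \<in> K r" for c using R.D_K[OF i(2) that] i(1) by simp
    show "e (\<delta> a) = \<delta> (e a)" for a using comm[OF iS S] i(1) by (simp add: \<delta>_def)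
    show "\<exists>h\<in>adjoin (K r) {z}. e (f (Suc r)) = \<delta> h"
      using closed[OF iS S] f[OF iS] i(1) unfolding Kz \<delta>_def by blast
  qed
  obtain a T b where dec: "a \<in> adjoin (K r) {z}" "finite T"
    "\<And>c. c \<in> T \<Longrightarrow> c \<in> algebraic_closure_in_ambient (K r)"
    "\<And>c e. c \<in> T \<Longrightarrow> e \<in> D ` {1..r} \<Longrightarrow> e c = 0"
    "\<And>c. c \<in> T \<Longrightarrow> b c \<in> polys_over (adjoin (K r) {c})"
    "\<And>c. c \<in> T \<Longrightarrow> Polynomial.lead_coeff (b c) = 1"
    "\<And>c. c \<in> T \<Longrightarrow> Polynomial.degree (b c) > 0" "\<And>c. c \<in> T \<Longrightarrow> poly (b c) z \<noteq> 0"
    "f (Suc r) = \<delta> a + (\<Sum>c\<in>T. c * (\<delta> (poly (b c) z) / poly (b c) z))"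
    "\<And>e. e \<in> D ` {1..r} \<Longrightarrow>
       (\<Sum>c\<in>T. c * (e (poly (b c) z) / poly (b c) z)) \<in> adjoin (K r) {z}"
  proof (rule P.residue_decomposition[where \<Delta> = "D ` {1..r}" and g = "f (Suc r)"])
    show "f (Suc r) \<in> adjoin (K r) {z}" unfolding Kz by (rule f) simp
  qed (rule \<Delta> that; assumption)+
  have T_alg: "c \<in> algebraic_closure_in_ambient k" if "c \<in> T" for c
  proof -
    have "c \<in> algebraic_closure_in_ambient {a \<in> K r. \<forall>e\<in>D ` {1..r}. e a = 0}"
      using \<Delta> dec(3,4)[OF that] by (intro P.constant_algebraic_over_constants) auto
    moreover have "{a \<in> K r. \<forall>e\<in>D ` {1..r}. e a = 0} \<subseteq> k"
      using R.constants_of_K by (auto simp: R.K_def K_def)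
    ultimately show ?thesis
      unfolding algebraic_closure_in_ambient_def polys_over_def by blast
  qed
  define L where "L v = (\<Sum>c\<in>T. c * (D v (poly (b c) z) / poly (b c) z))" for v
  define \<eta> where "\<eta> v = f v - D v a - L v" for v
  have \<eta>_closed: "D i (\<eta> j) = D j (\<eta> i)" if i: "i \<in> {1..Suc r}" and j: "j \<in> {1..Suc r}" for i j
  proof -
    have "D i (L j) = D j (L i)"
      unfolding L_def derivation_sum[OF D[OF i]] derivation_sum[OF D[OF j]]
    proof (rule sum.cong[OF refl])
      fix c assume c: "c \<in> T"
      show "D i (c * (D j (poly (b c) z) / poly (b c) z))
          = D j (c * (D i (poly (b c) z) / poly (b c) z))"
        by (rule log_derivatives_commute[OF D[OF i] D[OF j] comm[OF i j]
              D_algebraic_zero[OF i T_alg[OF c]] D_algebraic_zero[OF j T_alg[OF c]] dec(8)[OF c]])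
    qed
    then show ?thesis
      unfolding \<eta>_def using closed[OF i j] comm[OF i j]
      by (simp add: derivation_minus[OF D[OF i]] derivation_minus[OF D[OF j]])
  qed
  have \<eta>_Suc: "\<eta> (Suc r) = 0" using dec(9) by (simp add: \<eta>_def L_def \<delta>_def)
  have \<eta>_K: "\<eta> i \<in> K r" if i: "i \<in> {1..r}" for i
  proof -
    have "L i \<in> K (Suc r)" using dec(10)[of "D i"] i by (simp add: L_def Kz)
    moreover have "D i a \<in> K (Suc r)" using D_K[of i a] dec(1) i by (simp add: Kz)
    ultimately have "\<eta> i \<in> adjoin (K r) {z}" unfolding Kz \<eta>_def using f[of i] i by auto
    moreover have "\<delta> (\<eta> i) = 0"
      using \<eta>_closed[of "Suc r" i] \<eta>_Suc i derivation_0[OF D[of i]] by (simp add: \<delta>_def)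
    ultimately show ?thesis by (rule P.constant_in_extension)
  qed
  have cf: "closed_form r D \<eta>" using \<eta>_closed by (simp add: closed_form_def)
  have IH_ex: "\<exists>a (n :: nat \<Rightarrow> nat) c p. a \<in> adjoin k (x ` {1..r}) \<and>
    (\<forall>i\<in>{1..r}. \<forall>j<n i. c i j \<in> algebraic_closure_in_ambient k \<and>
      p i j \<in> polys_over (adjoin (adjoin k (x ` {1..<i})) {c i j}) \<and>
      Polynomial.lead_coeff (p i j) = 1 \<and> Polynomial.degree (p i j) > 0 \<and> poly (p i j) (x i) \<noteq> 0) \<and>
    (\<forall>v\<in>{1..r}. \<eta> v = D v a +
      (\<Sum>i=1..r. \<Sum>j<n i. c i j * (D v (poly (p i j) (x i)) / poly (p i j) (x i))))"
    by (rule Suc.IH[OF R.coordinate_derivations_axioms _ cf]) (rule \<eta>_K[unfolded K_def])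
  obtain a' c p and n :: "nat \<Rightarrow> nat" where
    IH: "a' \<in> adjoin k (x ` {1..r})"
    "\<forall>i\<in>{1..r}. \<forall>j<n i. c i j \<in> algebraic_closure_in_ambient k \<and>
      p i j \<in> polys_over (adjoin (adjoin k (x ` {1..<i})) {c i j}) \<and>
      Polynomial.lead_coeff (p i j) = 1 \<and> Polynomial.degree (p i j) > 0 \<and> poly (p i j) (x i) \<noteq> 0"
    "\<forall>v\<in>{1..r}. \<eta> v = D v a' +
      (\<Sum>i=1..r. \<Sum>j<n i. c i j * (D v (poly (p i j) (x i)) / poly (p i j) (x i)))"
    using IH_ex by (elim exE conjE) (rule that)
  have a'_K: "a' \<in> K r" unfolding K_def by (rule IH(1))
  obtain t where t: "bij_betw t {..<card T} T"
    using ex_bij_betw_nat_finite[OF dec(2)] by (auto simp: atLeast0LessThan)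
  define n' where "n' i = (if i = Suc r then card T else n i)" for i
  define c' where "c' i j = (if i = Suc r then t j else c i j)" for i j
  define p' where "p' i j = (if i = Suc r then b (t j) else p i j)" for i j
  have data: "c' i j \<in> algebraic_closure_in_ambient k \<and>
      p' i j \<in> polys_over (adjoin (adjoin k (x ` {1..<i})) {c' i j}) \<and>
      Polynomial.lead_coeff (p' i j) = 1 \<and> Polynomial.degree (p' i j) > 0 \<and> poly (p' i j) (x i) \<noteq> 0"
    if i: "i \<in> {1..Suc r}" and j: "j < n' i" for i j
  proof (cases "i = Suc r")
    case True
    then have "t j \<in> T" using j t by (auto simp: n'_def bij_betw_def)
    then show ?thesis
      using T_alg dec(5-8)[of "t j"] True
      by (simp add: c'_def p'_def z_def K_def atLeastLessThanSuc_atLeastAtMost)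
  next
    case False
    then show ?thesis using IH(2) i j by (simp add: n'_def c'_def p'_def)
  qed
  have L_eq: "L v = (\<Sum>j<n' (Suc r). c' (Suc r) j *
      (D v (poly (p' (Suc r) j) (x (Suc r))) / poly (p' (Suc r) j) (x (Suc r))))" for v
    unfolding L_def n'_def c'_def p'_def z_def
    using sum.reindex_bij_betw[OF t, of "\<lambda>c. c * (D v (poly (b c) (x (Suc r))) / poly (b c) (x (Suc r)))"]
    by simp
  have IH3: "\<eta> v = D v a' +
      (\<Sum>i=1..r. \<Sum>j<n' i. c' i j * (D v (poly (p' i j) (x i)) / poly (p' i j) (x i)))"
    if v: "v \<in> {1..Suc r}" for v
  proof -
    have "\<eta> v = D v a' + (\<Sum>i=1..r. \<Sum>j<n i. c i j * (D v (poly (p i j) (x i)) / poly (p i j) (x i)))"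
    proof (cases "v = Suc r")
      case True
      have "D v (poly (p i j) (x i)) = 0" if i: "i \<in> {1..r}" and j: "j < n i" for i j
      proof -
        have Dv: "derivation_on UNIV (D v)" using D True by simp
        interpret C: ambient_subfield "{a. D v a = 0}"
          by (rule ambient_subfield.intro) (rule subfield_constants[OF Dv])
        have IH2: "c i j \<in> algebraic_closure_in_ambient k"
          "p i j \<in> polys_over (adjoin (adjoin k (x ` {1..<i})) {c i j})" using IH(2) i j by auto
        have "adjoin (adjoin k (x ` {1..<i})) {c i j} \<subseteq> {a. D v a = 0}"
        proof (intro adjoin_least[OF C.subfield] subsetI)
          fix a assume "a \<in> k" then show "a \<in> {a. D v a = 0}" using D_k True by simp
        next
          fix a assume "a \<in> x ` {1..<i}"
          then show "a \<in> {a. D v a = 0}" using D_x True i by auto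
        next
          fix a assume "a \<in> {c i j}"
          then show "a \<in> {a. D v a = 0}" using D_algebraic_zero[OF _ IH2(1)] True by simp
        qed
        then have "p i j \<in> polys_over {a. D v a = 0}" using IH2(2) by (auto simp: polys_over_def)
        moreover have "x i \<in> {a. D v a = 0}" using D_x[of v i] True i by simp
        ultimately show ?thesis using C.poly_in by blast
      qed
      moreover have "D v a' = 0" using D_K_zero[of r v a'] a'_K True by simp
      ultimately show ?thesis using \<eta>_Suc True by simp
    next
      case False
      then show ?thesis using IH(3) v by simp
    qed
    moreover have "(\<Sum>i=1..r. \<Sum>j<n i. c i j * (D v (poly (p i j) (x i)) / poly (p i j) (x i)))
        = (\<Sum>i=1..r. \<Sum>j<n' i. c' i j * (D v (poly (p' i j) (x i)) / poly (p' i j) (x i)))"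
      by (intro sum.cong) (auto simp: n'_def c'_def p'_def)
    ultimately show ?thesis by simp
  qed
  have "f v = D v (a' + a) + (\<Sum>i=1..Suc r. \<Sum>j<n' i. c' i j *
      (D v (poly (p' i j) (x i)) / poly (p' i j) (x i)))" if v: "v \<in> {1..Suc r}" for v
  proof -
    have "f v = \<eta> v + D v a + L v" by (simp add: \<eta>_def)
    then show ?thesis using IH3[OF v] L_eq[of v] by (simp add: derivation_add[OF D[OF v]])
  qed
  moreover have "a' + a \<in> adjoin k (x ` {1..Suc r})"
    using a'_K dec(1) K_mono[of r "Suc r"] KS.add[of a' a] unfolding Kz by (auto simp: K_def)
  ultimately show ?case using data
    by (intro exI[of _ "a' + a"] exI[of _ n'] exI[of _ c'] exI[of _ p']) blast
qed

section \<open>Adjoining logarithms\<close>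

text \<open>Logarithms are adjoined as independent indeterminates: a polynomial ring in indeterminates
  \<open>t\<^sub>0, t\<^sub>1, \<dots>\<close> carries a derivation with prescribed values \<open>g j\<close> at the \<open>t\<^sub>j\<close>, and derivations of
  an integral domain extend to its field of fractions.\<close>

lemma poly_mapping_sum_single:
  "(\<Sum>s\<in>Poly_Mapping.keys p. Poly_Mapping.single s (Poly_Mapping.lookup p s)) = p"
  by (rule poly_mapping_eqI)
     (auto simp: lookup_sum lookup_single when_def in_keys_iff)

lemma poly_mapping_add_induct [case_names zero single add]:
  fixes p :: "'s \<Rightarrow>\<^sub>0 'b :: comm_monoid_add"
  assumes "P 0" "\<And>s a. P (Poly_Mapping.single s a)" "\<And>p q. P p \<Longrightarrow> P q \<Longrightarrow> P (p + q)"
  shows "P p"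
proof -
  have "P (\<Sum>s\<in>A. Poly_Mapping.single s (Poly_Mapping.lookup p s))" for A
    by (induction A rule: infinite_finite_induct) (use assms in auto)
  then show ?thesis by (metis poly_mapping_sum_single)
qed

type_synonym monomial = "nat \<Rightarrow>\<^sub>0 nat"

abbreviation monom_of :: "monomial \<Rightarrow> 'a :: zero \<Rightarrow> monomial \<Rightarrow>\<^sub>0 'a" where
  "monom_of \<equiv> Poly_Mapping.single"

abbreviation var :: "nat \<Rightarrow> monomial" where
  "var j \<equiv> Poly_Mapping.single j 1"

text \<open>The value of the derivation at the monomial \<open>a * t\<^sup>s\<close>, by the product rule.\<close>

definition monomial_derivation ::
  "('a :: comm_ring_1 \<Rightarrow> 'a) \<Rightarrow> (nat \<Rightarrow> 'a) \<Rightarrow> monomial \<Rightarrow> 'a \<Rightarrow> monomial \<Rightarrow>\<^sub>0 'a" where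
  "monomial_derivation d g s a = monom_of s (d a) +
     (\<Sum>j\<in>Poly_Mapping.keys s. monom_of (s - var j) (of_nat (Poly_Mapping.lookup s j) * a * g j))"

definition poly_derivation ::
  "('a :: comm_ring_1 \<Rightarrow> 'a) \<Rightarrow> (nat \<Rightarrow> 'a) \<Rightarrow> (monomial \<Rightarrow>\<^sub>0 'a) \<Rightarrow> monomial \<Rightarrow>\<^sub>0 'a" where
  "poly_derivation d g p =
     (\<Sum>s\<in>Poly_Mapping.keys p. monomial_derivation d g s (Poly_Mapping.lookup p s))"

context
  fixes d :: "'a :: comm_ring_1 \<Rightarrow> 'a" and g :: "nat \<Rightarrow> 'a"
  assumes d: "derivation_on UNIV d"
begin

lemma monomial_derivation_add:
  "monomial_derivation d g s (a + b) = monomial_derivation d g s a + monomial_derivation d g s b"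
  by (simp add: monomial_derivation_def derivation_add[OF d] single_add sum.distrib algebra_simps)

lemma monomial_derivation_0: "monomial_derivation d g s 0 = 0"
  by (simp add: monomial_derivation_def derivation_0[OF d])

lemma poly_derivation_superset:
  "finite A \<Longrightarrow> Poly_Mapping.keys p \<subseteq> A \<Longrightarrow>
     poly_derivation d g p = (\<Sum>s\<in>A. monomial_derivation d g s (Poly_Mapping.lookup p s))"
  unfolding poly_derivation_def
  by (rule sum.mono_neutral_left) (auto simp: monomial_derivation_0 in_keys_iff)

lemma poly_derivation_add: "poly_derivation d g (p + q) = poly_derivation d g p + poly_derivation d g q"
proof -
  let ?A = "Poly_Mapping.keys p \<union> Poly_Mapping.keys q"
  have "Poly_Mapping.keys (p + q) \<subseteq> ?A" by (rule Poly_Mapping.keys_add)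
  then show ?thesis
    by (simp add: poly_derivation_superset[of ?A] lookup_add monomial_derivation_add sum.distrib)
qed

lemma poly_derivation_0: "poly_derivation d g 0 = 0"
  by (simp add: poly_derivation_def)

lemma poly_derivation_single: "poly_derivation d g (monom_of s a) = monomial_derivation d g s a"
  by (subst poly_derivation_superset[of "{s}"]) auto

lemma monomial_derivation_superset:
  "finite A \<Longrightarrow> Poly_Mapping.keys s \<subseteq> A \<Longrightarrow> monomial_derivation d g s a = monom_of s (d a) +
     (\<Sum>j\<in>A. monom_of (s - var j) (of_nat (Poly_Mapping.lookup s j) * a * g j))"
  unfolding monomial_derivation_def
  by (subst sum.mono_neutral_left[of A "Poly_Mapping.keys s"]) (auto simp: in_keys_iff)

lemma minus_var_add:
  fixes s t :: monomial
  assumes "Poly_Mapping.lookup s j > 0"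
  shows "s - var j + t = s + t - var j"
  using assms by (intro poly_mapping_eqI) (auto simp: lookup_add lookup_minus lookup_single when_def)

lemma monomial_derivation_mult:
  "monomial_derivation d g (s + t) (a * b) =
     monomial_derivation d g s a * monom_of t b + monom_of s a * monomial_derivation d g t b"
proof -
  let ?A = "Poly_Mapping.keys s \<union> Poly_Mapping.keys t"
  let ?M = "\<lambda>s a j. monom_of (s - var j) (of_nat (Poly_Mapping.lookup s j) * a * g j)"
  have "?M (s + t) (a * b) j = ?M s a j * monom_of t b + monom_of s a * ?M t b j" for j
  proof -
    have 1: "?M s a j * monom_of t b
        = monom_of (s + t - var j) (of_nat (Poly_Mapping.lookup s j) * (a * b) * g j)"
    proof (cases "Poly_Mapping.lookup s j = 0")
      case False
      then have "s - var j + t = s + t - var j" by (intro minus_var_add) simp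
      then show ?thesis unfolding mult_single by (simp only: ac_simps)
    qed simp
    have 2: "monom_of s a * ?M t b j
        = monom_of (s + t - var j) (of_nat (Poly_Mapping.lookup t j) * (a * b) * g j)"
    proof (cases "Poly_Mapping.lookup t j = 0")
      case False
      then have "s + (t - var j) = s + t - var j"
        using minus_var_add[of t j s] by (simp only: add.commute)
      then show ?thesis unfolding mult_single by (simp only: ac_simps)
    qed simp
    show ?thesis unfolding 1 2 by (simp add: lookup_add algebra_simps flip: single_add)
  qed
  moreover have "Poly_Mapping.keys (s + t) \<subseteq> ?A" by (rule Poly_Mapping.keys_add)
  ultimately show ?thesis
    by (simp add: monomial_derivation_superset[of ?A] derivation_mult[OF d] single_add mult_single
        sum.distrib sum_distrib_left sum_distrib_right algebra_simps)
qed

lemma derivation_poly_derivation: "derivation_on UNIV (poly_derivation d g)"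
proof -
  let ?E = "poly_derivation d g"
  have mono_mult: "?E (monom_of s a * q) = ?E (monom_of s a) * q + monom_of s a * ?E q" for s a q
  proof (induction q rule: poly_mapping_add_induct)
    case (single t b)
    then show ?case by (simp add: mult_single poly_derivation_single monomial_derivation_mult)
  qed (simp_all add: poly_derivation_0 poly_derivation_add algebra_simps)
  have "?E (p * q) = ?E p * q + p * ?E q" for p q
  proof (induction p rule: poly_mapping_add_induct)
    case (single s a)
    show ?case by (rule mono_mult)
  qed (simp_all add: poly_derivation_0 poly_derivation_add algebra_simps)
  then show ?thesis by (simp add: derivation_on_def poly_derivation_add)
qed

lemma poly_derivation_const: "poly_derivation d g (monom_of 0 a) = monom_of 0 (d a)"
  by (simp add: poly_derivation_single monomial_derivation_def)

lemma poly_derivation_var: "poly_derivation d g (monom_of (var j) 1) = monom_of 0 (g j)"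
  by (simp add: poly_derivation_single monomial_derivation_def derivation_1[OF d])

end

text \<open>Constants and indeterminates generate the polynomial ring, so they detect derivations.\<close>

lemma poly_derivation_eq_0:
  fixes E :: "(monomial \<Rightarrow>\<^sub>0 'a :: comm_ring_1) \<Rightarrow> _"
  assumes E: "derivation_on UNIV E" and "\<And>a. E (monom_of 0 a) = 0" "\<And>j. E (monom_of (var j) 1) = 0"
  shows "E p = 0"
proof -
  have mult: "E (monom_of (s + t) (a * b)) = 0"
    if "E (monom_of s a) = 0" "E (monom_of t b) = 0" for s t a b
    using derivation_mult[OF E, of "monom_of s a" "monom_of t b"] that by (simp add: mult_single)
  have "E (monom_of (Poly_Mapping.single j n) 1) = 0" for j n
  proof (induction n)
    case (Suc n)
    then show ?case
      using mult[of "Poly_Mapping.single j n" 1 "var j" 1] assms(3) by (simp flip: single_add)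
  qed (simp add: derivation_1[OF E])
  then have "E (monom_of s 1) = 0" for s
  proof (induction s rule: poly_mapping_add_induct)
    case (add s t)
    then show ?case using mult[of s 1 t 1] by simp
  qed (simp_all add: assms(2) derivation_1[OF E])
  then have "E (monom_of s a) = 0" for s a using mult[of s 1 0 a] assms(2) by simp
  then show ?thesis
    by (induction p rule: poly_mapping_add_induct) (simp_all add: derivation_0[OF E] derivation_add[OF E])
qed

subsection \<open>Derivations of a field of fractions\<close>

lemma derivation_extends_to_fract:
  assumes d: "derivation_on UNIV (d :: 'a :: idom \<Rightarrow> 'a)"
  obtains d' where "derivation_on UNIV d'" "\<And>a. d' (Fract a 1) = Fract (d a) 1"
proof -
  define V where "V a b = Fract (d a * b - a * d b) (b * b)" for a b
  have V_cong: "V a b = V a' b'" if "b \<noteq> 0" "b' \<noteq> 0" "Fract a b = Fract a' b'" for a b a' b'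
  proof -
    have eq: "a * b' = a' * b" using that by (simp add: eq_fract)
    then have "d a * b' + a * d b' = d a' * b + a' * d b"
      using derivation_mult[OF d] by metis
    \<comment> \<open>The quotient rule respects equality of fractions by virtue of \<open>a * b' = a' * b\<close> and its derivative.\<close>
    moreover have "(d a * b - a * d b) * (b' * b') - (d a' * b' - a' * d b') * (b * b)
        = b * b' * ((d a * b' + a * d b') - (d a' * b + a' * d b))
          + (a' * b - a * b') * (d b * b' + d b' * b)"
      by (simp add: algebra_simps)
    ultimately have "(d a * b - a * d b) * (b' * b') = (d a' * b' - a' * d b') * (b * b)"
      using eq by simp
    then show ?thesis using that by (simp add: V_def eq_fract)
  qed
  define d' where "d' q = (SOME r. \<exists>a b. b \<noteq> 0 \<and> q = Fract a b \<and> r = V a b)" for q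
  have d': "d' (Fract a b) = V a b" if "b \<noteq> 0" for a b
  proof -
    have "\<exists>a' b'. b' \<noteq> 0 \<and> Fract a b = Fract a' b' \<and> d' (Fract a b) = V a' b'"
      unfolding d'_def by (rule someI_ex) (use that in blast)
    then show ?thesis using V_cong that by metis
  qed
  have "d' (p + q) = d' p + d' q \<and> d' (p * q) = d' p * q + p * d' q" for p q
  proof -
    obtain a b where p: "p = Fract a b" "b \<noteq> 0" by (cases p)
    obtain r s where q: "q = Fract r s" "s \<noteq> 0" by (cases q)
    show ?thesis using p q
      by (simp add: d' V_def eq_fract derivation_add[OF d] derivation_mult[OF d] algebra_simps)
  qed
  then have "derivation_on UNIV d'" by (simp add: derivation_on_def)
  moreover have "d' (Fract a 1) = Fract (d a) 1" for a
    by (simp add: d' V_def derivation_1[OF d])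
  ultimately show thesis using that by blast
qed

lemma derivation_fract_eq_0:
  assumes E: "derivation_on UNIV E" and 0: "\<And>a. E (Fract a 1) = 0"
  shows "E (q :: 'a :: idom fract) = 0"
proof -
  obtain a b where q: "q = Fract a b" "b \<noteq> 0" by (cases q)
  have "Fract b 1 \<noteq> 0" using q(2) by (simp add: Zero_fract_def eq_fract)
  have "E (Fract a 1 / Fract b 1) = 0"
    unfolding derivation_divide[OF E \<open>Fract b 1 \<noteq> 0\<close>] using 0 by simp
  then show ?thesis using q by simp
qed

text \<open>The extended derivations commute because their commutators kill the constants and the
  indeterminates, the latter being the closedness of the differentials \<open>db / b\<close>.\<close>

lemma logarithmic_extension:
  fixes D :: "'i \<Rightarrow> 'a :: field \<Rightarrow> 'a" and b :: "nat \<Rightarrow> 'a"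
  assumes D: "\<And>i. i \<in> I \<Longrightarrow> derivation_on UNIV (D i)"
    and comm: "\<And>i j a. i \<in> I \<Longrightarrow> j \<in> I \<Longrightarrow> D i (D j a) = D j (D i a)"
    and b: "\<And>n. b n \<noteq> 0"
  obtains h :: "'a \<Rightarrow> (monomial \<Rightarrow>\<^sub>0 'a) fract" and E l where
    "\<And>a c. h (a + c) = h a + h c" "\<And>a c. h (a * c) = h a * h c" "h 1 = 1"
    "\<And>i. i \<in> I \<Longrightarrow> derivation_on UNIV (E i)"
    "\<And>i j a. i \<in> I \<Longrightarrow> j \<in> I \<Longrightarrow> E i (E j a) = E j (E i a)"
    "\<And>i a. i \<in> I \<Longrightarrow> E i (h a) = h (D i a)"
    "\<And>i n. i \<in> I \<Longrightarrow> E i (l n) = h (D i (b n) / b n)"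
proof -
  define g where "g i n = D i (b n) / b n" for i n
  define P where "P i = poly_derivation (D i) (g i)" for i
  have P: "derivation_on UNIV (P i)" if "i \<in> I" for i
    unfolding P_def by (rule derivation_poly_derivation[OF D[OF that]])
  have P_const: "P i (monom_of 0 a) = monom_of 0 (D i a)" if "i \<in> I" for i a
    unfolding P_def by (rule poly_derivation_const[OF D[OF that]])
  have P_var: "P i (monom_of (var n) 1) = monom_of 0 (g i n)" if "i \<in> I" for i n
    unfolding P_def by (rule poly_derivation_var[OF D[OF that]])
  have g_comm: "D i (g j n) = D j (g i n)" if "i \<in> I" "j \<in> I" for i j n
    using log_derivatives_commute[OF D[OF that(1)] D[OF that(2)] comm[OF that], of 1 "b n"] b that
      derivation_1[OF D] by (simp add: g_def)
  have P_comm: "P i (P j p) = P j (P i p)" if "i \<in> I" "j \<in> I" for i j p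
  proof -
    have "P i (P j p) - P j (P i p) = 0"
      by (rule poly_derivation_eq_0[OF derivation_commutator[OF P[OF that(1)] P[OF that(2)]]])
         (simp_all add: that P_const P_var comm[OF that] g_comm[OF that] del: One_nat_def)
    then show ?thesis by simp
  qed
  have "\<exists>d'. derivation_on UNIV d' \<and> (\<forall>p. d' (Fract p 1) = Fract (P i p) 1)" if "i \<in> I" for i
    using derivation_extends_to_fract[OF P[OF that]] by blast
  then have "\<forall>i\<in>I. \<exists>d'. derivation_on UNIV d' \<and> (\<forall>p. d' (Fract p 1) = Fract (P i p) 1)" by blast
  from bchoice[OF this] obtain E where
    E: "\<forall>i\<in>I. derivation_on UNIV (E i) \<and> (\<forall>p. E i (Fract p 1) = Fract (P i p) 1)" ..
  define h where "h a = Fract (monom_of 0 a) 1" for a :: 'a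
  show thesis
  proof (rule that[of h E "\<lambda>n. Fract (monom_of (var n) 1) 1"])
    show "h (a + c) = h a + h c" "h (a * c) = h a * h c" for a c
      by (simp_all add: h_def single_add mult_single)
    show "h 1 = 1" by (simp add: h_def One_fract_def)
    fix i assume i: "i \<in> I"
    show "derivation_on UNIV (E i)" using E i by blast
    show "E i (h a) = h (D i a)" for a using E i by (simp add: h_def P_const)
    show "E i (Fract (monom_of (var n) 1) 1) = h (D i (b n) / b n)" for n
      using E i by (simp add: h_def P_var g_def del: One_nat_def)
    fix j assume j: "j \<in> I"
    have "E i (E j q) - E j (E i q) = 0" for q
      by (rule derivation_fract_eq_0[OF derivation_commutator])
         (use E i j P_comm[OF i j] in auto)
    then show "E i (E j q) = E j (E i q)" for q by simp
  qed
qed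

section \<open>Solutions in fields of another type\<close>

subsection \<open>Cardinality\<close>

text \<open>Lists, polynomials, algebraic elements and fractions over an infinite set are no more numerous than
  its elements. So the field that contains the residues and the logarithms can be copied into the type of
  the ground field.\<close>

lemma list_injection:
  assumes "inj (f :: 'a \<Rightarrow> 'u :: field_char_0)"
  shows "\<exists>g :: 'a list \<Rightarrow> 'u. inj g"
proof -
  obtain b :: "'u list \<Rightarrow> 'u" where "bij b"
    using lists_infinite_bij_betw_types[OF infinite_UNIV_char_0] by blast
  then have "inj (b \<circ> map f)" using assms by (intro inj_compose) (auto simp: bij_def)
  then show ?thesis by blast
qed

lemma prod_injection:
  assumes "inj (f :: 'a \<Rightarrow> 'u :: field_char_0)" "inj (g :: 'b \<Rightarrow> 'u)"
  shows "\<exists>h :: 'a \<times> 'b \<Rightarrow> 'u. inj h"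
proof -
  obtain b :: "'u list \<Rightarrow> 'u" where b: "inj b"
    using list_injection[OF inj_on_id[of UNIV, unfolded id_def]] by blast
  have "inj (\<lambda>(x, y). b [f x, g y])"
    by (auto intro!: injI simp: inj_eq[OF b] inj_eq[OF assms(1)] inj_eq[OF assms(2)])
  then show ?thesis by blast
qed

lemma surj_injection:
  assumes "inj (f :: 'a \<Rightarrow> 'u)" "surj (s :: 'a \<Rightarrow> 'b)"
  shows "\<exists>g :: 'b \<Rightarrow> 'u. inj g"
  using inj_compose[OF assms(1) surj_imp_inj_inv[OF assms(2)]] by blast

lemma poly_mapping_injection:
  assumes "inj (f :: 'a \<Rightarrow> 'u :: field_char_0)" "inj (g :: 'b :: comm_monoid_add \<Rightarrow> 'u)"
  shows "\<exists>h :: ('a \<Rightarrow>\<^sub>0 'b) \<Rightarrow> 'u. inj h"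
proof -
  let ?s = "\<lambda>xs :: ('a \<times> 'b) list. \<Sum>(s, a)\<leftarrow>xs. Poly_Mapping.single s a"
  have "p \<in> range ?s" for p
  proof -
    obtain ks where ks: "set ks = Poly_Mapping.keys p" "distinct ks"
      using finite_distinct_list[OF finite_keys[of p]] by (elim exE conjE) (rule that)
    have "?s (map (\<lambda>k. (k, Poly_Mapping.lookup p k)) ks)
        = (\<Sum>k\<leftarrow>ks. Poly_Mapping.single k (Poly_Mapping.lookup p k))" by (simp add: comp_def)
    also have "\<dots> = p"
      unfolding sum_list_distinct_conv_sum_set[OF ks(2)] ks(1) by (rule poly_mapping_sum_single)
    finally show ?thesis by (rule range_eqI[OF sym])
  qed
  then have surj: "surj ?s" by (intro equalityI subsetI UNIV_I)
  obtain h0 :: "'a \<times> 'b \<Rightarrow> 'u" where "inj h0" using prod_injection[OF assms] ..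
  from list_injection[OF this] obtain h :: "('a \<times> 'b) list \<Rightarrow> 'u" where "inj h" ..
  from surj_injection[OF this surj] show ?thesis .
qed

lemma alg_closure_injection: "\<exists>h :: 'u :: field_char_0 alg_closure \<Rightarrow> 'u. inj h"
proof -
  have "inj (coeffs :: 'u poly \<Rightarrow> 'u list)" by (simp add: inj_def coeffs_eq_iff)
  moreover obtain b :: "'u list \<Rightarrow> 'u" where "inj b"
    using list_injection[OF inj_on_id[of UNIV, unfolded id_def]] by blast
  ultimately have "inj (b \<circ> coeffs :: 'u poly \<Rightarrow> 'u)" by (intro inj_compose)
  moreover have "inj (of_nat :: nat \<Rightarrow> 'u)" by (rule inj_of_nat)
  ultimately obtain h :: "'u poly \<times> nat \<Rightarrow> 'u" where h: "inj h" using prod_injection by blast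
  define rs where "rs p = (SOME xs. set xs = {a. poly (map_poly to_ac p) a = 0})" for p :: "'u poly"
  have rs: "set (rs p) = {a. poly (map_poly to_ac p) a = 0}" if "p \<noteq> 0" for p
  proof -
    have "map_poly to_ac p \<noteq> 0" using that by (simp add: map_poly_eq_0_iff)
    then have "finite {a. poly (map_poly to_ac p) a = 0}" by (rule poly_roots_finite)
    then have "\<exists>xs. set xs = {a. poly (map_poly to_ac p) a = 0}" by (rule finite_list)
    then show ?thesis unfolding rs_def by (rule someI_ex)
  qed
  have "a \<in> range (\<lambda>(p, n). rs p ! n)" for a :: "'u alg_closure"
  proof -
    obtain p where "p \<noteq> 0" "poly (map_poly to_ac p) a = 0" by (rule alg_closure_algebraic)
    then have "a \<in> set (rs p)" by (simp add: rs)
    then obtain n where "a = rs p ! n" by (metis in_set_conv_nth)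
    then show ?thesis by (intro image_eqI[of _ _ "(p, n)"]) simp_all
  qed
  then have "surj (\<lambda>(p, n). rs p ! n)" by blast
  then show ?thesis using surj_injection[OF h] by blast
qed

lemma logarithmic_extension_injection:
  "\<exists>h :: (monomial \<Rightarrow>\<^sub>0 'u :: field_char_0 alg_closure) fract \<Rightarrow> 'u. inj h"
proof -
  have "inj (of_nat :: nat \<Rightarrow> 'u)" by (rule inj_of_nat)
  then obtain f :: "monomial \<Rightarrow> 'u" where "inj f"
  proof -
    assume n: "inj (of_nat :: nat \<Rightarrow> 'u)" and *: "\<And>f :: monomial \<Rightarrow> 'u. inj f \<Longrightarrow> thesis"
    show thesis using poly_mapping_injection[OF n n] * by blast
  qed
  moreover obtain g :: "'u alg_closure \<Rightarrow> 'u" where "inj g" using alg_closure_injection by blast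
  ultimately obtain h :: "(monomial \<Rightarrow>\<^sub>0 'u alg_closure) \<Rightarrow> 'u" where h: "inj h"
    using poly_mapping_injection by blast
  then obtain h2 :: "(monomial \<Rightarrow>\<^sub>0 'u alg_closure) \<times> (monomial \<Rightarrow>\<^sub>0 'u alg_closure) \<Rightarrow> 'u" where "inj h2"
    using prod_injection[OF h h] by blast
  moreover have "q \<in> range (\<lambda>(a, b). Fract a b)" for q :: "(monomial \<Rightarrow>\<^sub>0 'u alg_closure) fract"
  proof -
    obtain a b where "q = Fract a b" by (cases q)
    then show ?thesis by (intro image_eqI[of _ _ "(a, b)"]) simp_all
  qed
  then have "surj (\<lambda>(a, b). Fract a b :: (monomial \<Rightarrow>\<^sub>0 'u alg_closure) fract)" by blast
  ultimately show ?thesis using surj_injection by blast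
qed

subsection \<open>Transport\<close>

text \<open>The definition of universality speaks of extensions with carrier in one fixed type; the injection
  \<open>\<psi>\<close> copies an extension of another type into it.\<close>

lemma universal_extension_solution:
  fixes F :: "'a ring" and E' :: "nat \<Rightarrow> 'b :: field \<Rightarrow> 'b" and h :: "'a \<Rightarrow> 'b" and \<psi> :: "'b \<Rightarrow> 'a"
  assumes U: "universal_extension m F DF U E e"
    and der: "\<And>i. i \<in> {1..m} \<Longrightarrow> derivation_on UNIV (E' i)"
    and comm: "\<And>i j a. i \<in> {1..m} \<Longrightarrow> j \<in> {1..m} \<Longrightarrow> E' i (E' j a) = E' j (E' i a)"
    and h: "h \<in> ring_hom F ambient"
    and hD: "\<And>i a. i \<in> {1..m} \<Longrightarrow> a \<in> carrier F \<Longrightarrow> h (DF i a) = E' i (h a)"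
    and \<psi>: "inj \<psi>"
    and S: "diff_system m (carrier F) n S" "solves ambient E' h y S"
  shows "\<exists>y. solves U E e y S"
proof -
  define \<phi> where "\<phi> = inv_into UNIV \<psi>"
  have \<phi>\<psi> [simp]: "\<phi> (\<psi> b) = b" for b unfolding \<phi>_def using \<psi> by (rule inv_f_f)
  define L where "L = image_ring \<psi> (ambient :: 'b ring)"
  have L: "carrier L = range \<psi>" "\<zero>\<^bsub>L\<^esub> = \<psi> 0" "\<one>\<^bsub>L\<^esub> = \<psi> 1"
    "\<And>a b. \<psi> a \<oplus>\<^bsub>L\<^esub> \<psi> b = \<psi> (a + b)" "\<And>a b. \<psi> a \<otimes>\<^bsub>L\<^esub> \<psi> b = \<psi> (a * b)"
    unfolding L_def image_ring_def image_group_def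
    by (simp_all add: monoid.defs \<phi>_def [symmetric])
  define EL where "EL i a = \<psi> (E' i (\<phi> a))" for i a
  have "field L"
    unfolding L_def using \<psi> by (intro field.inj_imp_image_ring_is_field ambient_field) (auto intro: inj_on_subset)
  then have "differential_field m L EL"
    using comm derivation_add[OF der] derivation_mult[OF der]
    by (auto simp: differential_field_def derivation_def EL_def L)
  moreover have "\<psi> \<circ> h \<in> ring_hom F L"
    using h by (auto simp: ring_hom_def L)
  ultimately have ext: "differential_extension m F DF L EL (\<psi> \<circ> h)"
    using U hD by (auto simp: universal_extension_def differential_extension_def EL_def)
  have "dp_eval L EL (\<psi> \<circ> h) (\<psi> \<circ> y) p = \<psi> (dp_eval ambient E' h y p)" for p
    by (induction p) (simp_all add: L EL_def)
  then have "solves L EL (\<psi> \<circ> h) (\<psi> \<circ> y) S"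
    using S(2) by (auto simp: solves_def L)
  then show ?thesis using U ext S(1) unfolding universal_extension_def by blast
qed

section \<open>Descent from the algebraic closure to the ground field\<close>

lemma map_poly_to_ac_preimage:
  assumes "P \<in> polys_over (to_ac ` F)" "subfield F ambient"
  obtains Q where "Q \<in> polys_over F" "P = map_poly to_ac Q"
proof -
  interpret ambient_subfield F by (rule ambient_subfield.intro) fact
  have P: "Polynomial.coeff P s \<in> to_ac ` F" for s using assms(1) by (simp add: polys_over_def)
  have "of_ac (Polynomial.coeff P s) \<in> F" for s using P[of s] by auto
  then have "map_poly of_ac P \<in> polys_over F" by (simp add: polys_over_def coeff_map_poly)
  moreover have "to_ac (of_ac (Polynomial.coeff P s)) = Polynomial.coeff P s" for s using P[of s] by auto
  then have "P = map_poly to_ac (map_poly of_ac P)" by (intro poly_eqI) (simp add: coeff_map_poly)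
  ultimately show thesis using that by blast
qed

lemma subfield_image_to_ac:
  assumes "subfield F (ambient :: 'u :: field ring)"
  shows "subfield (to_ac ` F) ambient"
proof (rule subfield_ambientI)
  interpret ambient_subfield F by (rule ambient_subfield.intro) fact
  show "1 \<in> to_ac ` F" by (rule image_eqI[of _ _ 1]) auto
  fix a assume "a \<in> to_ac ` F"
  then obtain a' where a: "a = to_ac a'" "a' \<in> F" by blast
  show "- a \<in> to_ac ` F" by (rule image_eqI[of _ _ "- a'"]) (use a in auto)
  show "inverse a \<in> to_ac ` F" by (rule image_eqI[of _ _ "inverse a'"]) (use a in auto)
  fix b assume "b \<in> to_ac ` F"
  then obtain b' where b: "b = to_ac b'" "b' \<in> F" by blast
  show "a + b \<in> to_ac ` F" by (rule image_eqI[of _ _ "a' + b'"]) (use a b in auto)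
  show "a * b \<in> to_ac ` F" by (rule image_eqI[of _ _ "a' * b'"]) (use a b in auto)
qed

lemma adjoin_image_to_ac: "adjoin (to_ac ` k) (to_ac ` S) = to_ac ` adjoin k (S :: 'u :: field set)"
proof
  show "adjoin (to_ac ` k) (to_ac ` S) \<subseteq> to_ac ` adjoin k S"
    using base_subset_adjoin[of k S] gens_subset_adjoin[of S k]
    by (intro adjoin_least subfield_image_to_ac subfield_adjoin) auto
  interpret A: ambient_subfield "adjoin (to_ac ` k) (to_ac ` S)"
    by (rule ambient_subfield.intro) (rule subfield_adjoin)
  have "adjoin k S \<subseteq> {a. to_ac a \<in> adjoin (to_ac ` k) (to_ac ` S)}"
    using base_subset_adjoin[of "to_ac ` k" "to_ac ` S"] gens_subset_adjoin[of "to_ac ` S" "to_ac ` k"]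
    by (intro adjoin_least subfield_ambientI) (auto intro: A.add A.mult A.uminus A.inverse)
  then show "to_ac ` adjoin k S \<subseteq> adjoin (to_ac ` k) (to_ac ` S)" by blast
qed

text \<open>The value at \<open>(\<xi>, c)\<close> of the polynomial \<open>\<Sum>s\<le>d. q\<^sub>s(Y) X ^ s\<close> in two variables, with coefficients
  mapped by \<open>h\<close>.\<close>

definition bipoly :: "('a :: field \<Rightarrow> 'b :: field) \<Rightarrow> (nat \<Rightarrow> 'a poly) \<Rightarrow> nat \<Rightarrow> 'b \<Rightarrow> 'b \<Rightarrow> 'b" where
  "bipoly h q d c \<xi> = poly (Poly (map (\<lambda>s. poly (map_poly h (q s)) c) [0..<Suc d])) \<xi>"

text \<open>For the descent, each \<open>b\<^sub>i\<^sub>j\<close> is written as a polynomial in \<open>x\<^sub>i\<close> and \<open>c\<^sub>i\<^sub>j\<close> over \<open>k(x\<^sub>1, \<dots>, x\<^sub>i\<^sub>-\<^sub>1)\<close>. Then the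
  decomposition can be expressed by equations over the ground field whose unknowns are the residues, the
  logarithms and the inverses of the \<open>b\<^sub>i\<^sub>j\<close>.\<close>

lemma decomposition_over_algebraic_closure:
  fixes k :: "'u :: field_char_0 set"
  assumes k: "subfield k ambient"
    and D: "\<And>i. i \<in> {1..m} \<Longrightarrow> derivation_on UNIV (D i)"
    and comm: "\<And>i j a. i \<in> {1..m} \<Longrightarrow> j \<in> {1..m} \<Longrightarrow> D i (D j a) = D j (D i a)"
    and D_k: "\<And>i a. i \<in> {1..m} \<Longrightarrow> a \<in> k \<Longrightarrow> D i a = 0"
    and D_x: "\<And>i j. i \<in> {1..m} \<Longrightarrow> j \<in> {1..m} \<Longrightarrow> D i (x j) = (if i = j then 1 else 0)"
    and f: "\<And>i. i \<in> {1..m} \<Longrightarrow> f i \<in> adjoin k (x ` {1..m})" and closed: "closed_form m D f"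
  obtains D' a c q d \<mu> and n :: "nat \<Rightarrow> nat" where
    "\<And>i. i \<in> {1..m} \<Longrightarrow> derivation_on UNIV (D' i)"
    "\<And>i a. i \<in> {1..m} \<Longrightarrow> D' i (to_ac a) = to_ac (D i a)"
    "\<And>i j a. i \<in> {1..m} \<Longrightarrow> j \<in> {1..m} \<Longrightarrow> D' i (D' j a) = D' j (D' i a)"
    "a \<in> adjoin k (x ` {1..m})"
    "\<And>i j. i \<in> {1..m} \<Longrightarrow> j < n i \<Longrightarrow> \<mu> i j \<in> polys_over k \<and> \<mu> i j \<noteq> 0 \<and>
       poly (map_poly to_ac (\<mu> i j)) (c i j) = 0"
    "\<And>i j s. i \<in> {1..m} \<Longrightarrow> j < n i \<Longrightarrow> q i j s \<in> polys_over (adjoin k (x ` {1..<i}))"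
    "\<And>i j. i \<in> {1..m} \<Longrightarrow> j < n i \<Longrightarrow> d i j > 0 \<and> q i j (d i j) = 1 \<and>
       bipoly to_ac (q i j) (d i j) (c i j) (to_ac (x i)) \<noteq> 0"
    "\<And>v. v \<in> {1..m} \<Longrightarrow> to_ac (f v) = D' v (to_ac a) + (\<Sum>i=1..m. \<Sum>j<n i. c i j *
       (D' v (bipoly to_ac (q i j) (d i j) (c i j) (to_ac (x i)))
          / bipoly to_ac (q i j) (d i j) (c i j) (to_ac (x i))))"
proof -
  have "\<forall>i\<in>{1..m}. \<exists>d'. derivation_on UNIV d' \<and> (\<forall>a. d' (to_ac a) = to_ac (D i a))"
    using derivation_alg_closure[OF D] by blast
  from bchoice[OF this] obtain D' where
    D': "\<forall>i\<in>{1..m}. derivation_on UNIV (D' i) \<and> (\<forall>a. D' i (to_ac a) = to_ac (D i a))" ..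
  have D'_der: "derivation_on UNIV (D' i)" and D'_ac: "D' i (to_ac a) = to_ac (D i a)"
    if "i \<in> {1..m}" for i a using D' that by blast+
  have D'_comm: "D' i (D' j a) = D' j (D' i a)" if "i \<in> {1..m}" "j \<in> {1..m}" for i j a
    by (rule derivations_commute_alg_closure[OF D'_der[OF that(1)] D'_der[OF that(2)]])
       (simp only: D'_ac that comm[OF that])
  have image: "(to_ac \<circ> x) ` I = to_ac ` (x ` I)" for I by (simp add: image_comp)
  have coord: "coordinate_derivations (to_ac ` k) m (to_ac \<circ> x) D'"
  proof (rule coordinate_derivations.intro)
    show "subfield (to_ac ` k) ambient" using k by (rule subfield_image_to_ac)
    fix i assume i: "i \<in> {1..m}"
    show "derivation_on UNIV (D' i)" by (rule D'_der[OF i])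
    show "D' i a = 0" if "a \<in> to_ac ` k" for a using that D_k[OF i] D'_ac[OF i] by auto
    fix j assume j: "j \<in> {1..m}"
    show "D' i (D' j a) = D' j (D' i a)" for a by (rule D'_comm[OF i j])
    show "D' i ((to_ac \<circ> x) j) = (if i = j then 1 else 0)" using D_x[OF i j] D'_ac[OF i] by simp
  qed
  have f': "(to_ac \<circ> f) i \<in> adjoin (to_ac ` k) ((to_ac \<circ> x) ` {1..m})" if "i \<in> {1..m}" for i
    unfolding image adjoin_image_to_ac using f[OF that] by simp
  have closed': "closed_form m D' (to_ac \<circ> f)"
    using closed D'_ac unfolding closed_form_def by simp
  have "\<exists>a (n :: nat \<Rightarrow> nat) c p. a \<in> to_ac ` adjoin k (x ` {1..m}) \<and>
    (\<forall>i\<in>{1..m}. \<forall>j<n i. c i j \<in> algebraic_closure_in_ambient (to_ac ` k) \<and>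
      p i j \<in> polys_over (adjoin (to_ac ` adjoin k (x ` {1..<i})) {c i j}) \<and>
      Polynomial.lead_coeff (p i j) = 1 \<and> Polynomial.degree (p i j) > 0 \<and>
      poly (p i j) (to_ac (x i)) \<noteq> 0) \<and>
    (\<forall>v\<in>{1..m}. to_ac (f v) = D' v a + (\<Sum>i=1..m. \<Sum>j<n i.
      c i j * (D' v (poly (p i j) (to_ac (x i))) / poly (p i j) (to_ac (x i)))))"
    by (rule closed_form_decomposition[OF coord f' closed',
          unfolded image adjoin_image_to_ac comp_apply])
  then obtain a c p and n :: "nat \<Rightarrow> nat" where
    a: "a \<in> to_ac ` adjoin k (x ` {1..m})" and
    p: "\<forall>i\<in>{1..m}. \<forall>j<n i. c i j \<in> algebraic_closure_in_ambient (to_ac ` k) \<and>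
      p i j \<in> polys_over (adjoin (to_ac ` adjoin k (x ` {1..<i})) {c i j}) \<and>
      Polynomial.lead_coeff (p i j) = 1 \<and> Polynomial.degree (p i j) > 0 \<and>
      poly (p i j) (to_ac (x i)) \<noteq> 0" and
    dec: "\<forall>v\<in>{1..m}. to_ac (f v) = D' v a + (\<Sum>i=1..m. \<Sum>j<n i.
      c i j * (D' v (poly (p i j) (to_ac (x i))) / poly (p i j) (to_ac (x i))))"
    by (elim exE conjE) (rule that)
  obtain a0 where a0: "a = to_ac a0" "a0 \<in> adjoin k (x ` {1..m})" using a by blast
  define valid where "valid i j \<longleftrightarrow> i \<in> {1..m} \<and> j < n i" for i j
  have "\<exists>\<mu>. \<mu> \<in> polys_over k \<and> \<mu> \<noteq> 0 \<and> poly (map_poly to_ac \<mu>) (c i j) = 0" if "valid i j" for i j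
  proof -
    have "c i j \<in> algebraic_closure_in_ambient (to_ac ` k)" using p that by (auto simp: valid_def)
    then obtain P where P: "P \<in> polys_over (to_ac ` k)" "P \<noteq> 0" "poly P (c i j) = 0"
      by (auto simp: algebraic_closure_in_ambient_def)
    obtain Q where "Q \<in> polys_over k" "P = map_poly to_ac Q"
      by (rule map_poly_to_ac_preimage[OF P(1) k])
    then show ?thesis using P by (intro exI[of _ Q]) auto
  qed
  then obtain \<mu> where \<mu>: "\<And>i j. valid i j \<Longrightarrow> \<mu> i j \<in> polys_over k \<and> \<mu> i j \<noteq> 0 \<and>
      poly (map_poly to_ac (\<mu> i j)) (c i j) = 0" by metis
  have "\<exists>q. q \<in> polys_over (adjoin k (x ` {1..<i})) \<and>
      Polynomial.coeff (p i j) s = poly (map_poly to_ac q) (c i j) \<and>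
      (s = Polynomial.degree (p i j) \<longrightarrow> q = 1)" if "valid i j" for i j s
  proof (cases "s = Polynomial.degree (p i j)")
    case True
    have "Polynomial.lead_coeff (p i j) = 1" using p that by (auto simp: valid_def)
    moreover have "1 \<in> polys_over (adjoin k (x ` {1..<i}))"
      by (rule ambient_subfield.polys_1[OF ambient_subfield.intro[OF subfield_adjoin]])
    moreover have "map_poly to_ac 1 = 1" by (simp add: map_poly_1)
    ultimately show ?thesis using True by (intro exI[of _ 1]) simp
  next
    case False
    let ?F = "to_ac ` adjoin k (x ` {1..<i})"
    have F: "subfield ?F ambient" by (intro subfield_image_to_ac subfield_adjoin)
    interpret F: ambient_subfield ?F by (rule ambient_subfield.intro) (rule F)
    have "c i j \<in> algebraic_closure_in_ambient (to_ac ` k)" using p that by (auto simp: valid_def)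
    moreover have "to_ac ` k \<subseteq> ?F" using base_subset_adjoin[of k "x ` {1..<i}"] by blast
    ultimately have "c i j \<in> algebraic_closure_in_ambient ?F"
      unfolding algebraic_closure_in_ambient_def polys_over_def by blast
    moreover have "Polynomial.coeff (p i j) s \<in> adjoin ?F {c i j}"
      using p that by (simp add: valid_def polys_over_def)
    ultimately obtain Q where Q: "Q \<in> polys_over ?F" "Polynomial.coeff (p i j) s = poly Q (c i j)"
      by (rule F.adjoin_algebraic)
    obtain q where "q \<in> polys_over (adjoin k (x ` {1..<i}))" "Q = map_poly to_ac q"
      by (rule map_poly_to_ac_preimage[OF Q(1) subfield_adjoin])
    then show ?thesis using Q(2) False by blast
  qed
  then obtain q where q: "\<And>i j s. valid i j \<Longrightarrow> q i j s \<in> polys_over (adjoin k (x ` {1..<i})) \<and>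
      Polynomial.coeff (p i j) s = poly (map_poly to_ac (q i j s)) (c i j) \<and>
      (s = Polynomial.degree (p i j) \<longrightarrow> q i j s = 1)" by metis
  define d where "d i j = Polynomial.degree (p i j)" for i j
  have b: "bipoly to_ac (q i j) (d i j) (c i j) (to_ac (x i)) = poly (p i j) (to_ac (x i))"
    if "valid i j" for i j
  proof -
    have "Polynomial.lead_coeff (p i j) = 1" using p that by (simp add: valid_def)
    then have "p i j \<noteq> 0" by auto
    then have "map (\<lambda>s. poly (map_poly to_ac (q i j s)) (c i j)) [0..<Suc (d i j)] = coeffs (p i j)"
      using q[OF that] by (simp add: coeffs_def d_def)
    then show ?thesis by (simp add: bipoly_def)
  qed
  have "to_ac (f v) = D' v (to_ac a0) + (\<Sum>i=1..m. \<Sum>j<n i. c i j *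
       (D' v (bipoly to_ac (q i j) (d i j) (c i j) (to_ac (x i)))
          / bipoly to_ac (q i j) (d i j) (c i j) (to_ac (x i))))" if "v \<in> {1..m}" for v
    using dec that b by (simp add: a0(1) valid_def)
  then show thesis
    using that[of D' a0 n \<mu> c q d] D'_der D'_ac D'_comm a0(2) \<mu> q b p
    unfolding valid_def d_def by simp
qed

section \<open>The differential system for the residues and the logarithms\<close>

text \<open>A solution of the system below in the universal extension consists of elements \<open>c\<^sub>i\<^sub>j\<close> that may be conjugate to
  the residues instead of equal to them. This does no harm, since the system contains everything that is
  claimed: \<open>c\<^sub>i\<^sub>j\<close> is a root of a polynomial over \<open>k\<close>, \<open>b\<^sub>i\<^sub>j\<close> is invertible, the logarithmic derivatives are
  as prescribed, and the form is the differential of the sum. That \<open>b\<^sub>i\<^sub>j\<close> has positive degree in \<open>x\<^sub>i\<close> is no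
  equation, but it holds for any value of \<open>c\<^sub>i\<^sub>j\<close> because \<open>b\<^sub>i\<^sub>j\<close> is monic.\<close>

definition dp_over :: "'i set \<Rightarrow> 'a set \<Rightarrow> nat set \<Rightarrow> ('i, 'a) diff_poly \<Rightarrow> bool" where
  "dp_over V K N p \<longleftrightarrow> ders p \<subseteq> V \<and> coefs p \<subseteq> K \<and> indets p \<subseteq> N"

lemma dp_over_simps [simp]:
  "dp_over V K N (Coef a) \<longleftrightarrow> a \<in> K"
  "dp_over V K N (Indet j) \<longleftrightarrow> j \<in> N"
  "dp_over V K N (Deriv i p) \<longleftrightarrow> i \<in> V \<and> dp_over V K N p"
  "dp_over V K N (Plus p q) \<longleftrightarrow> dp_over V K N p \<and> dp_over V K N q"
  "dp_over V K N (Times p q) \<longleftrightarrow> dp_over V K N p \<and> dp_over V K N q"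
  by (auto simp: dp_over_def)

primrec dp_horner :: "('i, 'a :: zero) diff_poly list \<Rightarrow> ('i, 'a) diff_poly \<Rightarrow> ('i, 'a) diff_poly" where
  "dp_horner [] t = Coef 0"
| "dp_horner (r # rs) t = Plus r (Times t (dp_horner rs t))"

definition dp_poly :: "'a :: zero poly \<Rightarrow> ('i, 'a) diff_poly \<Rightarrow> ('i, 'a) diff_poly" where
  "dp_poly q t = dp_horner (map Coef (coeffs q)) t"

definition dp_bipoly ::
  "(nat \<Rightarrow> 'a :: zero poly) \<Rightarrow> nat \<Rightarrow> ('i, 'a) diff_poly \<Rightarrow> ('i, 'a) diff_poly \<Rightarrow> ('i, 'a) diff_poly" where
  "dp_bipoly q d c t = dp_horner (map (\<lambda>s. dp_poly (q s) c) [0..<Suc d]) t"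

definition dp_sum :: "('i, 'a :: zero) diff_poly list \<Rightarrow> ('i, 'a) diff_poly" where
  "dp_sum ts = foldr Plus ts (Coef 0)"

lemma dp_over_horner:
  "0 \<in> K \<Longrightarrow> (\<And>r. r \<in> set rs \<Longrightarrow> dp_over V K N r) \<Longrightarrow> dp_over V K N t \<Longrightarrow> dp_over V K N (dp_horner rs t)"
  by (induction rs) auto

lemma dp_over_poly: "0 \<in> K \<Longrightarrow> q \<in> polys_over K \<Longrightarrow> dp_over V K N t \<Longrightarrow> dp_over V K N (dp_poly q t)"
  unfolding dp_poly_def
  by (intro dp_over_horner) (auto simp: polys_over_def coeffs_def simp del: upt_Suc split: if_splits)

lemma dp_over_bipoly:
  "0 \<in> K \<Longrightarrow> (\<And>s. q s \<in> polys_over K) \<Longrightarrow> dp_over V K N c \<Longrightarrow> dp_over V K N t \<Longrightarrow>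
     dp_over V K N (dp_bipoly q d c t)"
  unfolding dp_bipoly_def
  by (intro dp_over_horner) (auto simp: dp_over_poly)

lemma dp_over_sum: "0 \<in> K \<Longrightarrow> (\<And>t. t \<in> set ts \<Longrightarrow> dp_over V K N t) \<Longrightarrow> dp_over V K N (dp_sum ts)"
  unfolding dp_sum_def by (induction ts) auto

context
  fixes E :: "'i \<Rightarrow> 'b :: field \<Rightarrow> 'b" and h :: "'a :: field \<Rightarrow> 'b" and y :: "nat \<Rightarrow> 'b"
  assumes h_0: "h 0 = 0"
begin

lemma dp_eval_horner:
  "dp_eval ambient E h y (dp_horner rs t) =
     poly (Poly (map (dp_eval ambient E h y) rs)) (dp_eval ambient E h y t)"
  by (induction rs) (simp_all add: h_0)

lemma dp_eval_poly: "dp_eval ambient E h y (dp_poly q t) = poly (map_poly h q) (dp_eval ambient E h y t)"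
  by (simp add: dp_poly_def dp_eval_horner map_poly_def comp_def)

lemma dp_eval_bipoly:
  "dp_eval ambient E h y (dp_bipoly q d c t) =
     bipoly h q d (dp_eval ambient E h y c) (dp_eval ambient E h y t)"
  by (simp only: dp_bipoly_def dp_eval_horner bipoly_def map_map comp_def dp_eval_poly)

lemma dp_eval_sum: "dp_eval ambient E h y (dp_sum ts) = (\<Sum>t\<leftarrow>ts. dp_eval ambient E h y t)"
  unfolding dp_sum_def by (induction ts) (simp_all add: h_0)

end

lemma bipoly_hom:
  fixes h :: "'b :: field \<Rightarrow> 'c :: field"
  assumes add: "\<And>a b. h (a + b) = h a + h b" and mult: "\<And>a b. h (a * b) = h a * h b"
  shows "bipoly (h \<circ> g) q d (h c) (h \<xi>) = h (bipoly g q d c \<xi>)"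
proof -
  have h0: "h 0 = 0" using add[of 0 0] by (metis add.right_neutral add_left_cancel)
  have 1: "poly (Poly (map h xs)) (h a) = h (poly (Poly xs) a)" for xs a
    by (induction xs) (simp_all add: h0 add mult)
  have "poly (map_poly (h \<circ> g) p) (h c) = h (poly (map_poly g p) c)" for p
    unfolding map_poly_def 1 [symmetric] by simp
  then have "map (\<lambda>s. poly (map_poly (h \<circ> g) (q s)) (h c)) [0..<Suc d]
      = map h (map (\<lambda>s. poly (map_poly g (q s)) c) [0..<Suc d])" by (simp del: upt_Suc)
  then show ?thesis unfolding bipoly_def by (simp only: 1)
qed

lemma sum_list_double_sum:
  "(\<Sum>t\<leftarrow>map (\<lambda>i. \<Sum>j\<leftarrow>[0..<n i]. g i j) [1..<Suc m]. t) = (\<Sum>i=1..m. \<Sum>j<n i. g i j)"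
  by (simp add: interv_sum_list_conv_sum_set_nat atLeastLessThanSuc_atLeastAtMost atLeast0LessThan
      del: upt_Suc)

theorem theorem3p1:
  fixes k K :: "'u :: field_char_0 set"
    and m :: nat
    and x f :: "nat \<Rightarrow> 'u"
    and D :: "nat \<Rightarrow> 'u \<Rightarrow> 'u"
  assumes k: "subfield k ambient"
    and x: "algebraically_independent k {1..m} x"
    and K: "K = adjoin k (x ` {1..m})"
    and D_k: "\<And>i a. i \<in> {1..m} \<Longrightarrow> a \<in> k \<Longrightarrow> D i a = 0"
    and D_x: "\<And>i j. i \<in> {1..m} \<Longrightarrow> j \<in> {1..m} \<Longrightarrow> D i (x j) = (if i = j then 1 else 0)"
    and U: "universal_extension m (subfield_ring K) D ambient D (\<lambda>a. a)"
    and f: "\<And>i. i \<in> {1..m} \<Longrightarrow> f i \<in> K"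
    and closed: "closed_form m D f"
  shows "\<exists>a (n :: nat \<Rightarrow> nat) (c :: nat \<Rightarrow> nat \<Rightarrow> 'u) (b :: nat \<Rightarrow> nat \<Rightarrow> 'u)
            (logb :: nat \<Rightarrow> nat \<Rightarrow> 'u) g.
      a \<in> K \<and>
      (\<forall>i\<in>{1..m}. \<forall>j<n i.
         c i j \<in> algebraic_closure_in_ambient k \<and>
         (\<exists>p\<in>polys_over (adjoin k (x ` {1..<i} \<union> {c i j})).
            0 < Polynomial.degree p \<and> b i j = poly p (x i)) \<and>
         is_log m D (b i j) (logb i j)) \<and>
      g = a + (\<Sum>i=1..m. \<Sum>j<n i. c i j * logb i j) \<and>
      is_differential_of m D f g"
proof -
  interpret K: ambient_subfield K
    unfolding K by (rule ambient_subfield.intro) (rule subfield_adjoin)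
  have diff: "differential_field m (subfield_ring K) D" "differential_field m ambient D"
    using U by (auto simp: universal_extension_def differential_extension_def)
  have D: "derivation_on UNIV (D i)" if "i \<in> {1..m}" for i
    using diff(2) that by (auto simp: differential_field_def)
  have comm: "D i (D j a) = D j (D i a)" if "i \<in> {1..m}" "j \<in> {1..m}" for i j a
    using diff(2) that by (auto simp: differential_field_def)
  have D_K: "D i a \<in> K" if "i \<in> {1..m}" "a \<in> K" for i a
    using diff(1) that by (auto simp: differential_field_def derivation_def)
  have k_K: "k \<subseteq> K" unfolding K by (rule base_subset_adjoin)
  have x_K: "x i \<in> K" if "i \<in> {1..m}" for i
    unfolding K using gens_subset_adjoin[of "x ` {1..m}" k] that by blast
  have tower: "adjoin k (x ` {1..<i}) \<subseteq> K" if "i \<in> {1..m}" for i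
    unfolding K using that by (intro adjoin_mono image_mono) auto

  obtain D' a c q d \<mu> and n :: "nat \<Rightarrow> nat" where
    D': "\<And>i. i \<in> {1..m} \<Longrightarrow> derivation_on UNIV (D' i)"
      "\<And>i a. i \<in> {1..m} \<Longrightarrow> D' i (to_ac a) = to_ac (D i a)"
      "\<And>i j a. i \<in> {1..m} \<Longrightarrow> j \<in> {1..m} \<Longrightarrow> D' i (D' j a) = D' j (D' i a)"
    and a: "a \<in> adjoin k (x ` {1..m})"
    and \<mu>: "\<And>i j. i \<in> {1..m} \<Longrightarrow> j < n i \<Longrightarrow> \<mu> i j \<in> polys_over k \<and> \<mu> i j \<noteq> 0 \<and>
       poly (map_poly to_ac (\<mu> i j)) (c i j) = 0"
    and q: "\<And>i j s. i \<in> {1..m} \<Longrightarrow> j < n i \<Longrightarrow> q i j s \<in> polys_over (adjoin k (x ` {1..<i}))"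
    and b: "\<And>i j. i \<in> {1..m} \<Longrightarrow> j < n i \<Longrightarrow> d i j > 0 \<and> q i j (d i j) = 1 \<and>
       bipoly to_ac (q i j) (d i j) (c i j) (to_ac (x i)) \<noteq> 0"
    and dec: "\<And>v. v \<in> {1..m} \<Longrightarrow> to_ac (f v) = D' v (to_ac a) + (\<Sum>i=1..m. \<Sum>j<n i. c i j *
       (D' v (bipoly to_ac (q i j) (d i j) (c i j) (to_ac (x i)))
          / bipoly to_ac (q i j) (d i j) (c i j) (to_ac (x i))))"
    by (rule decomposition_over_algebraic_closure[OF k D comm D_k D_x f[unfolded K] closed]) (assumption+, rule that)

  define \<beta> where "\<beta> i j = bipoly to_ac (q i j) (d i j) (c i j) (to_ac (x i))" for i j
  \<comment> \<open>The \<open>b\<^sub>i\<^sub>j\<close> as one sequence, with \<open>1\<close> in place of zeros, which occur only outside the index range.\<close>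
  define \<beta>s where "\<beta>s w = (case prod_decode w of (i, j) \<Rightarrow> if \<beta> i j = 0 then 1 else \<beta> i j)" for w
  have \<beta>s: "\<beta>s w \<noteq> 0" for w by (simp add: \<beta>s_def split: prod.splits)
  obtain h2 :: "'u alg_closure \<Rightarrow> (monomial \<Rightarrow>\<^sub>0 'u alg_closure) fract" and E l where
    h2: "\<And>a c. h2 (a + c) = h2 a + h2 c" "\<And>a c. h2 (a * c) = h2 a * h2 c" "h2 1 = 1"
    and E: "\<And>i. i \<in> {1..m} \<Longrightarrow> derivation_on UNIV (E i)"
      "\<And>i j a. i \<in> {1..m} \<Longrightarrow> j \<in> {1..m} \<Longrightarrow> E i (E j a) = E j (E i a)"
      "\<And>i a. i \<in> {1..m} \<Longrightarrow> E i (h2 a) = h2 (D' i a)"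
    and l: "\<And>i w. i \<in> {1..m} \<Longrightarrow> E i (l w) = h2 (D' i (\<beta>s w) / \<beta>s w)"
    by (rule logarithmic_extension[OF D'(1,3) \<beta>s]) (assumption+, rule that)
  have h2_0: "h2 0 = 0" using h2(1)[of 0 0] by (metis add.right_neutral add_left_cancel)
  have h2_uminus: "h2 (- r) = - h2 r" for r
    using h2(1)[of r "- r"] h2_0 by (simp add: eq_neg_iff_add_eq_0 add.commute)
  have h2_sum: "h2 (sum g I) = (\<Sum>i\<in>I. h2 (g i))" for g and I :: "nat set"
    by (induction I rule: infinite_finite_induct) (simp_all add: h2_0 h2(1))
  define h where "h = h2 \<circ> to_ac"
  have h: "h (r + s) = h r + h s" "h (r * s) = h r * h s" "h 1 = 1" "h 0 = 0" "h (- r) = - h r" for r s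
    by (simp_all add: h_def h2 h2_0 h2_uminus)

  \<comment> \<open>The unknowns for the residue \<open>c\<^sub>i\<^sub>j\<close>, for the logarithm of \<open>b\<^sub>i\<^sub>j\<close> and for the inverse of \<open>b\<^sub>i\<^sub>j\<close>.\<close>
  define C L Z :: "nat \<Rightarrow> nat \<Rightarrow> nat" where "C i j = 3 * prod_encode (i, j)"
    and "L i j = 3 * prod_encode (i, j) + 1" and "Z i j = 3 * prod_encode (i, j) + 2" for i j
  have "finite (\<Union>i\<in>{1..m}. \<Union>j<n i. {C i j, L i j, Z i j})" by simp
  then obtain N where N: "(\<Union>i\<in>{1..m}. \<Union>j<n i. {C i j, L i j, Z i j}) \<subseteq> {..<N}"
    using finite_nat_iff_bounded by blast
  define B :: "nat \<Rightarrow> nat \<Rightarrow> (nat, 'u) diff_poly" where "B i j = dp_bipoly (q i j) (d i j) (Indet (C i j)) (Coef (x i))" for i j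
  define eq_res eq_inv :: "nat \<Rightarrow> nat \<Rightarrow> (nat, 'u) diff_poly" where
    "eq_res i j = dp_poly (\<mu> i j) (Indet (C i j))"
    and "eq_inv i j = Plus (Times (Indet (Z i j)) (B i j)) (Coef (- 1))" for i j
  define eq_log where "eq_log v i j = Plus (Times (B i j) (Deriv v (Indet (L i j))))
      (Times (Coef (- 1)) (Deriv v (B i j)))" for v i j
  define eq_form :: "nat \<Rightarrow> (nat, 'u) diff_poly" where
    "eq_form v = Plus (Coef (D v a - f v)) (dp_sum (map (\<lambda>i. dp_sum (map (\<lambda>j.
       Times (Indet (C i j)) (Deriv v (Indet (L i j)))) [0..<n i])) [1..<Suc m]))" for v
  define S where "S = (\<Union>i\<in>{1..m}. \<Union>j<n i. {eq_res i j, eq_inv i j} \<union> (\<lambda>v. eq_log v i j) ` {1..m})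
    \<union> eq_form ` {1..m}"

  have over: "dp_over {1..m} K {..<N} p" if "p \<in> S" for p
  proof -
    have ind: "C i j < N" "L i j < N" "Z i j < N" if "i \<in> {1..m}" "j < n i" for i j
    proof -
      have "{C i j, L i j, Z i j} \<subseteq> {..<N}" by (rule subset_trans[OF _ N]) (use that in blast)
      then show "C i j < N" "L i j < N" "Z i j < N" by simp_all
    qed
    have q_K: "q i j s \<in> polys_over K" if "i \<in> {1..m}" "j < n i" for i j s
      using q[OF that] tower[OF that(1)] by (auto simp: polys_over_def)
    have B_over: "dp_over {1..m} K {..<N} (B i j)" if "i \<in> {1..m}" "j < n i" for i j
      unfolding B_def using ind[OF that] q_K[OF that] x_K[OF that(1)] by (intro dp_over_bipoly) auto
    have "dp_over {1..m} K {..<N} (eq_res i j)" "dp_over {1..m} K {..<N} (eq_inv i j)"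
      "\<And>v. v \<in> {1..m} \<Longrightarrow> dp_over {1..m} K {..<N} (eq_log v i j)" if "i \<in> {1..m}" "j < n i" for i j
    proof -
      have "\<mu> i j \<in> polys_over K" using \<mu>[OF that] k_K by (auto simp: polys_over_def)
      then show "dp_over {1..m} K {..<N} (eq_res i j)"
        unfolding eq_res_def using ind[OF that] by (intro dp_over_poly) auto
      show "dp_over {1..m} K {..<N} (eq_inv i j)"
        using ind[OF that] B_over[OF that] K.uminus[OF K.one] by (simp add: eq_inv_def)
      show "dp_over {1..m} K {..<N} (eq_log v i j)" if "v \<in> {1..m}" for v
        using ind[OF \<open>i \<in> {1..m}\<close> \<open>j < n i\<close>] B_over[OF \<open>i \<in> {1..m}\<close> \<open>j < n i\<close>] K.uminus[OF K.one] that
        by (simp add: eq_log_def)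
    qed
    moreover have "dp_over {1..m} K {..<N} (eq_form v)" if "v \<in> {1..m}" for v
    proof -
      have "D v a - f v \<in> K" using D_K[OF that] a f[OF that] K.minus by (simp add: K)
      then show ?thesis unfolding eq_form_def using ind that
        by (auto intro!: dp_over_sum simp del: upt_Suc)
    qed
    ultimately show ?thesis using \<open>p \<in> S\<close> unfolding S_def by blast
  qed

  define y where "y N = (let w = N div 3; ij = prod_decode w in
     if N mod 3 = 0 then h2 (c (fst ij) (snd ij))
     else if N mod 3 = 1 then l w else inverse (h2 (\<beta> (fst ij) (snd ij))))" for N
  have y: "y (C i j) = h2 (c i j)" "y (L i j) = l (prod_encode (i, j))" "y (Z i j) = inverse (h2 (\<beta> i j))"
    for i j
  proof -
    have div_mod: "(3 * w) div 3 = w" "(3 * w + 1) div 3 = w" "(3 * w + 2) div 3 = w"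
      "(3 * w) mod 3 = 0" "(3 * w + 1) mod 3 = 1" "(3 * w + 2) mod 3 = 2" for w :: nat
      by presburger+
    show "y (C i j) = h2 (c i j)" "y (L i j) = l (prod_encode (i, j))" "y (Z i j) = inverse (h2 (\<beta> i j))"
      unfolding y_def Let_def C_def L_def Z_def div_mod by simp_all
  qed
  have solves: "solves ambient E h y S"
  proof -
    have B_eval: "dp_eval ambient E h y (B i j) = h2 (\<beta> i j)" for i j
      unfolding B_def \<beta>_def dp_eval_bipoly[of h, OF h(4)] using bipoly_hom[OF h2(1,2), of to_ac]
      by (simp add: y h_def)
    have h2_nz: "h2 r \<noteq> 0" if "r \<noteq> 0" for r
      using h2(2)[of r "inverse r"] h2(3) that by auto
    have \<beta>_nz: "\<beta> i j \<noteq> 0" if "i \<in> {1..m}" "j < n i" for i j using b[OF that] by (simp add: \<beta>_def)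
    have l_eval: "E v (l (prod_encode (i, j))) = h2 (D' v (\<beta> i j) / \<beta> i j)"
      if "v \<in> {1..m}" "i \<in> {1..m}" "j < n i" for v i j
      using l[OF that(1)] \<beta>_nz[OF that(2,3)] by (simp add: \<beta>s_def)
    have "dp_eval ambient E h y (eq_res i j) = 0" "dp_eval ambient E h y (eq_inv i j) = 0"
      "\<And>v. v \<in> {1..m} \<Longrightarrow> dp_eval ambient E h y (eq_log v i j) = 0" if ij: "i \<in> {1..m}" "j < n i" for i j
    proof -
      have "poly (map_poly h (\<mu> i j)) (h2 (c i j)) = h2 (poly (map_poly to_ac (\<mu> i j)) (c i j))"
      proof -
        have "poly (Poly (map h2 xs)) (h2 r) = h2 (poly (Poly xs) r)" for xs r
          by (induction xs) (simp_all add: h2_0 h2)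
        from this[of "map to_ac (coeffs (\<mu> i j))"] show ?thesis by (simp add: map_poly_def h_def)
      qed
      then show "dp_eval ambient E h y (eq_res i j) = 0"
        using \<mu>[OF ij] by (simp add: eq_res_def dp_eval_poly[of h, OF h(4)] y h2_0)
      show "dp_eval ambient E h y (eq_inv i j) = 0"
        using h2_nz[OF \<beta>_nz[OF ij]] by (simp add: eq_inv_def y B_eval h)
      fix v assume v: "v \<in> {1..m}"
      have "h2 (\<beta> i j) * h2 (D' v (\<beta> i j) / \<beta> i j) = h2 (D' v (\<beta> i j))"
        using h2(2)[of "\<beta> i j" "D' v (\<beta> i j) / \<beta> i j"] \<beta>_nz[OF ij] by simp
      then show "dp_eval ambient E h y (eq_log v i j) = 0"
        by (simp add: eq_log_def y B_eval h l_eval[OF v ij] E(3)[OF v])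
    qed
    moreover have "dp_eval ambient E h y (eq_form v) = 0" if v: "v \<in> {1..m}" for v
    proof -
      have "h (f v) = h2 (D' v (to_ac a)) + (\<Sum>i=1..m. \<Sum>j<n i. h2 (c i j) * E v (l (prod_encode (i, j))))"
        using dec[OF v] l_eval[OF v] unfolding \<beta>_def [symmetric] by (simp add: h_def h2 h2_sum del: times_divide_eq_right)
      moreover have "h (D v a - f v) = h2 (D' v (to_ac a)) - h (f v)"
        using h(1)[of "D v a" "- f v"] D'(2)[OF v] by (simp add: h_def h2_uminus)
      ultimately show ?thesis
        using sum_list_double_sum[of "\<lambda>i j. h2 (c i j) * E v (l (prod_encode (i, j)))" n m]
        by (simp add: eq_form_def dp_eval_sum[of h, OF h(4)] y comp_def del: upt_Suc)
    qed
    ultimately show ?thesis by (auto simp: solves_def S_def)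
  qed
  have system: "diff_system m (carrier (subfield_ring K)) N S"
    using over by (auto simp: diff_system_def dp_over_def)
  have hom: "h \<in> ring_hom (subfield_ring K) ambient" by (auto simp: ring_hom_def h)
  have h_D: "h (D i r) = E i (h r)" if "i \<in> {1..m}" for i r
    using E(3)[OF that] D'(2)[OF that] by (simp add: h_def)
  obtain \<psi> :: "(monomial \<Rightarrow>\<^sub>0 'u alg_closure) fract \<Rightarrow> 'u" where "inj \<psi>"
    using logarithmic_extension_injection by blast
  then obtain u where u: "solves ambient D (\<lambda>a. a) u S"
    using universal_extension_solution[OF U E(1,2) hom h_D _ system solves] by blast

  define b' where "b' i j = bipoly (\<lambda>a. a) (q i j) (d i j) (u (C i j)) (x i)" for i j
  have B_eval: "dp_eval ambient D (\<lambda>a. a) u (B i j) = b' i j" for i j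
    by (simp add: B_def b'_def dp_eval_bipoly)
  have sol: "dp_eval ambient D (\<lambda>a. a) u p = 0" if "p \<in> S" for p using u that by (simp add: solves_def)
  have c_alg: "u (C i j) \<in> algebraic_closure_in_ambient k" if ij: "i \<in> {1..m}" "j < n i" for i j
  proof -
    have "eq_res i j \<in> S" unfolding S_def using ij by blast
    from sol[OF this] have "poly (\<mu> i j) (u (C i j)) = 0" by (simp add: eq_res_def dp_eval_poly)
    then show ?thesis using \<mu>[OF ij] by (auto simp: algebraic_closure_in_ambient_def)
  qed
  have b'_nz: "b' i j \<noteq> 0" if ij: "i \<in> {1..m}" "j < n i" for i j
  proof -
    have "eq_inv i j \<in> S" unfolding S_def using ij by blast
    from sol[OF this] show ?thesis by (auto simp: eq_inv_def B_eval)
  qed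
  have log: "is_log m D (b' i j) (u (L i j))" if ij: "i \<in> {1..m}" "j < n i" for i j
    unfolding is_log_def
  proof (intro conjI ballI)
    show "b' i j \<noteq> 0" by (rule b'_nz[OF ij])
    fix v assume v: "v \<in> {1..m}"
    then have "eq_log v i j \<in> S" unfolding S_def using ij by blast
    from sol[OF this] have "b' i j * D v (u (L i j)) = D v (b' i j)" by (simp add: eq_log_def B_eval)
    then show "D v (u (L i j)) = D v (b' i j) / b' i j"
      using b'_nz[OF ij] by (simp add: eq_divide_eq mult.commute)
  qed
  have poly_b': "\<exists>p\<in>polys_over (adjoin k (x ` {1..<i} \<union> {u (C i j)})).
      0 < Polynomial.degree p \<and> b' i j = poly p (x i)" if ij: "i \<in> {1..m}" "j < n i" for i j
  proof -
    let ?A = "adjoin k (x ` {1..<i} \<union> {u (C i j)})"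
    interpret A: ambient_subfield ?A by (rule ambient_subfield.intro) (rule subfield_adjoin)
    define p where "p = Poly (map (\<lambda>s. poly (q i j s) (u (C i j))) [0..<Suc (d i j)])"
    have coeff: "Polynomial.coeff p s = (if s \<le> d i j then poly (q i j s) (u (C i j)) else 0)" for s
      by (simp add: p_def nth_default_def del: upt_Suc)
    have "q i j s \<in> polys_over ?A" for s
      using q[OF ij] adjoin_mono[of "x ` {1..<i}" "x ` {1..<i} \<union> {u (C i j)}" k]
      by (auto simp: polys_over_def)
    moreover have "u (C i j) \<in> ?A" using gens_subset_adjoin[of "x ` {1..<i} \<union> {u (C i j)}" k] by blast
    ultimately have "p \<in> polys_over ?A" using A.poly_in A.zero by (simp add: polys_over_def coeff)
    moreover have "Polynomial.coeff p (d i j) = 1" using b[OF ij] by (simp add: coeff)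
    then have "Polynomial.degree p > 0" using b[OF ij] le_degree[of p "d i j"] by simp
    moreover have "b' i j = poly p (x i)" by (simp add: b'_def bipoly_def p_def del: upt_Suc)
    ultimately show ?thesis by blast
  qed

  define g where "g = a + (\<Sum>i=1..m. \<Sum>j<n i. u (C i j) * u (L i j))"
  have "f v = D v g" if v: "v \<in> {1..m}" for v
  proof -
    interpret k: char0_subfield k by (intro char0_subfield.intro ambient_subfield.intro k)
    have c_const: "D v (u (C i j)) = 0" if ij: "i \<in> {1..m}" "j < n i" for i j
      by (rule k.derivation_zero_on_algebraic[OF D[OF v] D_k[OF v] c_alg[OF ij]])
    have solve_for: "s = r + t" if "r - s + t = 0" for r s t :: 'u
      using that by (simp add: algebra_simps)
    have "eq_form v \<in> S" unfolding S_def using v by blast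
    from sol[OF this] have "D v a - f v + (\<Sum>i=1..m. \<Sum>j<n i. u (C i j) * D v (u (L i j))) = 0"
      using sum_list_double_sum[of "\<lambda>i j. u (C i j) * D v (u (L i j))" n m]
      by (simp add: eq_form_def dp_eval_sum comp_def del: upt_Suc)
    then have "f v = D v a + (\<Sum>i=1..m. \<Sum>j<n i. u (C i j) * D v (u (L i j)))"
      by (rule solve_for)
    also have "\<dots> = D v g"
      using c_const
      by (simp add: g_def derivation_add[OF D[OF v]] derivation_sum[OF D[OF v]] derivation_mult[OF D[OF v]])
    finally show ?thesis .
  qed
  then have "is_differential_of m D f g" by (simp add: is_differential_of_def)
  moreover have "a \<in> K" unfolding K by (rule a)
  moreover have "\<forall>i\<in>{1..m}. \<forall>j<n i. u (C i j) \<in> algebraic_closure_in_ambient k \<and>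
      (\<exists>p\<in>polys_over (adjoin k (x ` {1..<i} \<union> {u (C i j)})).
         0 < Polynomial.degree p \<and> b' i j = poly p (x i)) \<and> is_log m D (b' i j) (u (L i j))"
    by (intro ballI allI impI conjI c_alg poly_b' log)
  ultimately show ?thesis using g_def
    by (intro exI[of _ a] exI[of _ n] exI[of _ "\<lambda>i j. u (C i j)"] exI[of _ b']
        exI[of _ "\<lambda>i j. u (L i j)"] exI[of _ g] conjI)
qed

end
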